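(* Let $A$ be a uniform algebra on a compact Hausdorff space $\Omega$ and let $X$ be a Banach $A$-module. The following are equivalent: (i) $X$ and $A$ are almost $A$-isometric; (ii) $X$, with the symmetric bimodule action $xa = ax$ (and its minimal operator space structure), is a rank one strong Morita equivalence $A$-$A$-bimodule; (iii) there exists $f\in\overline{Q}^{+}$ such that $X$ is $A$-isometric to $Af$.
   Context: A uniform algebra on a compact Hausdorff space $\Omega$ is a closed subalgebra of $C(\Omega)$ (complex continuous functions, sup norm) which contains the constants and separates points; it carries the operator space structure inherited from $C(\Omega)$. $Q=\{|g|:g\in A^{-1}\}\subset C(\Omega)$, where $A^{-1}$ is the set of invertible elements of $A$; $\overline{Q}^{+}$ is the set of strictly positive functions in the uniform closure of $Q$. $Af=\{af:a\in A\}\subset C(\Omega)$. Two Banach $A$-modules are $A$-isometric if there is a surjective isometric $A$-module isomorphism between them, and almost $A$-isometric if for every $\epsilon>0$ there is an $A$-module isomorphism $T$ from one onto the other with $\|T\|\|T^{-1}\|<1+\epsilon$. The minimal operator space structure on a Banach space is the one obtained by embedding it isometrically in a commutative C$^*$-algebra. An operator $A$-$A$-bimodule is an operator space which is a (unital) $A$-$A$-bimodule whose left and right actions are completely contractive with respect to matrix products, i.e. $\|[\sum_k a_{ik}x_{kj}]\|\le\|[a_{ij}]\|\|[x_{ij}]\|$ for matrices over $A$ and $X$, and similarly on the right. $X$ is a strong Morita equivalence $A$-$A$-bimodule if there are an operator $A$-$A$-bimodule $Y$ (the inverse bimodule) and balanced bilinear $A$-$A$-bimodule pairings $(\cdot,\cdot):X\times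 Y\to A$ and $[\cdot,\cdot]:Y\times X\to A$ with $(x,y)x'=x[y,x']$ and $[y,x]y'=y(x,y')$ for all $x,x'\in X$, $y,y'\in Y$, such that the induced linear maps $X\otimes_hY\to A$ and $Y\otimes_hX\to A$ on Haagerup tensor products are complete quotient maps. A symmetric strong Morita equivalence bimodule $X$ ($ax=xa$ for all $a\in A$, $x\in X$) is rank one if it is algebraically rank 1, meaning $1=(x',y')=[y'',x'']$ for some $x',x''\in X$, $y',y''\in Y$, and for every $\epsilon>0$ the elements $x',y'$ may be chosen with norms within $\epsilon$ of $1$. *)

theory Defs
  imports "HOL-Analysis.Analysis" "HOL-Algebra.Module" "HOL-Library.Poly_Mapping"
    "Jordan_Normal_Form.Matrix"
begin

section \<open>Uniform algebras\<close>

text \<open>For compact \<open>'w\<close>, the type \<open>'w \<Rightarrow>\<^sub>C complex\<close> is \<open>C(\<Omega>)\<close> with the supremum norm; the library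
  only lacks its multiplication.\<close>

setup_lifting type_definition_bcontfun

instantiation bcontfun :: (topological_space, real_normed_algebra_1) ring_1
begin

lift_definition times_bcontfun :: "('a \<Rightarrow>\<^sub>C 'b) \<Rightarrow> ('a \<Rightarrow>\<^sub>C 'b) \<Rightarrow> 'a \<Rightarrow>\<^sub>C 'b"
  is "\<lambda>f g x. f x * g x"
proof -
  fix f g :: "'a \<Rightarrow> 'b"
  assume f: "f \<in> bcontfun" and g: "g \<in> bcontfun"
  obtain b c where b: "\<And>x. norm (f x) \<le> b" and c: "\<And>x. norm (g x) \<le> c"
    using f g by (auto simp: bcontfun_def bounded_iff)
  have "norm (f x * g x) \<le> b * c" for x
    by (meson b c mult_mono norm_ge_zero norm_mult_ineq order_trans)
  moreover have "continuous_on UNIV (\<lambda>x. f x * g x)"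
    using f g by (auto simp: bcontfun_def intro!: continuous_intros)
  ultimately show "(\<lambda>x. f x * g x) \<in> bcontfun"
    by (rule bcontfun_normI[rotated])
qed

lift_definition one_bcontfun :: "'a \<Rightarrow>\<^sub>C 'b" is "\<lambda>_. 1"
  by (rule const_bcontfun)

lemmas [simp] = times_bcontfun.rep_eq one_bcontfun.rep_eq

instance
proof
  show "(0 :: 'a \<Rightarrow>\<^sub>C 'b) \<noteq> 1"
    by (metis one_bcontfun.rep_eq zero_bcontfun.rep_eq zero_neq_one)
qed (auto intro!: bcontfun_eqI simp: algebra_simps)

end

instance bcontfun :: (topological_space, "{real_normed_algebra_1, comm_ring_1}") comm_ring_1
  by standard (auto intro!: bcontfun_eqI simp: algebra_simps)

type_synonym 'w cfun = "'w \<Rightarrow>\<^sub>C complex"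

locale uniform_algebra =
  fixes A :: "'w::t2_space cfun set"
  assumes compact_space: "compact (UNIV :: 'w set)"
    and closed: "closed A"
    and const_mem: "const_bcontfun c \<in> A"
    and add_mem: "f \<in> A \<Longrightarrow> g \<in> A \<Longrightarrow> f + g \<in> A"
    and mult_mem: "f \<in> A \<Longrightarrow> g \<in> A \<Longrightarrow> f * g \<in> A"
    and separates_points: "v \<noteq> w \<Longrightarrow> \<exists>f\<in>A. f v \<noteq> f w"

definition modulus_set :: "'w::t2_space cfun set \<Rightarrow> 'w cfun set" where
  "modulus_set A = {h :: 'w cfun. \<exists>g\<in>A. (\<exists>g'\<in>A. g * g' = 1) \<and> (\<forall>w. h w = complex_of_real (cmod (g w)))}"

definition positive_closure :: "'w::t2_space cfun set \<Rightarrow> 'w cfun set" where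
  "positive_closure S = {f \<in> closure S. \<forall>w. f w \<in> \<real> \<and> 0 < Re (f w)}"


section \<open>Banach modules\<close>

text \<open>A complex vector space is a \<^locale>\<open>module\<close> over \<open>complex_ring\<close>; the fields \<open>mult\<close> and \<open>one\<close>
  that the record \<open>module\<close> inherits from \<open>ring\<close> play no role.\<close>

definition complex_ring :: "complex ring" where
  "complex_ring = \<lparr>carrier = UNIV, mult = (*), one = 1, zero = 0, add = (+)\<rparr>"

locale complex_banach_space = module complex_ring V for V (structure) +
  fixes N :: "'x \<Rightarrow> real"
  assumes norm_eq_0: "x \<in> carrier V \<Longrightarrow> N x = 0 \<longleftrightarrow> x = \<zero>"
    and norm_triangle: "x \<in> carrier V \<Longrightarrow> y \<in> carrier V \<Longrightarrow> N (x \<oplus> y) \<le> N x + N y"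
    and norm_scale: "x \<in> carrier V \<Longrightarrow> N (c \<odot>\<^bsub>V\<^esub> x) = cmod c * N x"
    and complete: "Metric_space.mcomplete (carrier V) (\<lambda>x y. N (x \<ominus> y))"

locale unital_action =
  fixes A :: "'w::t2_space cfun set"
    and V :: "(complex, 'x, 'm) module_scheme" (structure)
    and act :: "'w cfun \<Rightarrow> 'x \<Rightarrow> 'x"
  assumes act_closed: "a \<in> A \<Longrightarrow> x \<in> carrier V \<Longrightarrow> act a x \<in> carrier V"
    and act_add_left: "a \<in> A \<Longrightarrow> b \<in> A \<Longrightarrow> x \<in> carrier V \<Longrightarrow> act (a + b) x = act a x \<oplus> act b x"
    and act_add_right: "a \<in> A \<Longrightarrow> x \<in> carrier V \<Longrightarrow> y \<in> carrier V \<Longrightarrow> act a (x \<oplus> y) = act a x \<oplus> act a y"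
    and act_scale_left: "a \<in> A \<Longrightarrow> x \<in> carrier V \<Longrightarrow> act (const_bcontfun c * a) x = c \<odot>\<^bsub>V\<^esub> act a x"
    and act_scale_right: "a \<in> A \<Longrightarrow> x \<in> carrier V \<Longrightarrow> act a (c \<odot>\<^bsub>V\<^esub> x) = c \<odot>\<^bsub>V\<^esub> act a x"
    and act_mult: "a \<in> A \<Longrightarrow> b \<in> A \<Longrightarrow> x \<in> carrier V \<Longrightarrow> act (a * b) x = act a (act b x)"
    and act_one: "x \<in> carrier V \<Longrightarrow> act 1 x = x"

record ('a, 'x) normed_module = "(complex, 'x) module" +
  nrm :: "'x \<Rightarrow> real"
  act :: "'a \<Rightarrow> 'x \<Rightarrow> 'x"

locale banach_module =
  complex_banach_space X "nrm X" + unital_action A X "act X"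
  for A :: "'w::t2_space cfun set" and X :: "('w cfun, 'x) normed_module" (structure) +
  assumes act_contractive: "a \<in> A \<Longrightarrow> x \<in> carrier X \<Longrightarrow> nrm X (act X a x) \<le> norm a * nrm X x"

text \<open>A subspace of \<open>C(\<Omega>)\<close> with the inherited norm and pointwise action.\<close>

definition function_module :: "'w::t2_space cfun set \<Rightarrow> ('w cfun, 'w cfun) normed_module" where
  "function_module S = \<lparr>carrier = S, mult = (*), one = 1, zero = 0, add = (+),
     smult = (\<lambda>c f. const_bcontfun c * f), nrm = norm, act = (*)\<rparr>"

definition module_iso ::
    "'w::t2_space cfun set \<Rightarrow> ('w cfun, 'x) normed_module \<Rightarrow> ('w cfun, 'y) normed_module \<Rightarrow> ('x \<Rightarrow> 'y) \<Rightarrow> bool"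
  where "module_iso A V W T \<longleftrightarrow> bij_betw T (carrier V) (carrier W) \<and>
     (\<forall>x\<in>carrier V. \<forall>y\<in>carrier V. T (x \<oplus>\<^bsub>V\<^esub> y) = T x \<oplus>\<^bsub>W\<^esub> T y) \<and>
     (\<forall>c. \<forall>x\<in>carrier V. T (c \<odot>\<^bsub>V\<^esub> x) = c \<odot>\<^bsub>W\<^esub> T x) \<and>
     (\<forall>a\<in>A. \<forall>x\<in>carrier V. T (act V a x) = act W a (T x))"

definition bounded_map :: "('a, 'x) normed_module \<Rightarrow> ('a, 'y) normed_module \<Rightarrow> ('x \<Rightarrow> 'y) \<Rightarrow> bool" where
  "bounded_map V W T \<longleftrightarrow> (\<exists>c. \<forall>x\<in>carrier V. nrm W (T x) \<le> c * nrm V x)"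

definition op_norm :: "('a, 'x) normed_module \<Rightarrow> ('a, 'y) normed_module \<Rightarrow> ('x \<Rightarrow> 'y) \<Rightarrow> real" where
  "op_norm V W T = (SUP x\<in>{x \<in> carrier V. nrm V x \<le> 1}. nrm W (T x))"

definition A_isometric ::
    "'w::t2_space cfun set \<Rightarrow> ('w cfun, 'x) normed_module \<Rightarrow> ('w cfun, 'y) normed_module \<Rightarrow> bool"
  where "A_isometric A V W \<longleftrightarrow>
     (\<exists>T. module_iso A V W T \<and> (\<forall>x\<in>carrier V. nrm W (T x) = nrm V x))"

definition almost_A_isometric ::
    "'w::t2_space cfun set \<Rightarrow> ('w cfun, 'x) normed_module \<Rightarrow> ('w cfun, 'y) normed_module \<Rightarrow> bool"
  where "almost_A_isometric A V W \<longleftrightarrow>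
     (\<forall>\<epsilon>>0. \<exists>T. module_iso A V W T \<and>
        bounded_map V W T \<and> bounded_map W V (inv_into (carrier V) T) \<and>
        op_norm V W T * op_norm W V (inv_into (carrier V) T) < 1 + \<epsilon>)"


section \<open>Operator spaces\<close>

text \<open>The norm of a complex matrix as an operator between Euclidean spaces.\<close>

definition cmat_norm :: "complex mat \<Rightarrow> real" where
  "cmat_norm M = (SUP v\<in>{v. (\<Sum>j<dim_col M. (cmod (v j))\<^sup>2) \<le> 1}.
     sqrt (\<Sum>i<dim_row M. (cmod (\<Sum>j<dim_col M. M $$ (i, j) * v j))\<^sup>2))"

record 'x opspace = "(complex, 'x) module" +
  mnorm :: "'x mat \<Rightarrow> real"

definition mats :: "('x, 'm) partial_object_scheme \<Rightarrow> nat \<Rightarrow> nat \<Rightarrow> 'x mat set" where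
  "mats V m n = {M \<in> carrier_mat m n. elements_mat M \<subseteq> carrier V}"

definition mat1 :: "'x \<Rightarrow> 'x mat" where
  "mat1 x = mat 1 1 (\<lambda>_. x)"

definition mat_sum :: "('x, 'm) ring_scheme \<Rightarrow> 'x mat \<Rightarrow> 'x mat \<Rightarrow> 'x mat" where
  "mat_sum V x y = mat (dim_row x) (dim_col x) (\<lambda>(i, j). x $$ (i, j) \<oplus>\<^bsub>V\<^esub> y $$ (i, j))"

definition mat_diag_sum :: "('x, 'm) ring_scheme \<Rightarrow> 'x mat \<Rightarrow> 'x mat \<Rightarrow> 'x mat" where
  "mat_diag_sum V x y = four_block_mat
     x (mat (dim_row x) (dim_col y) (\<lambda>_. \<zero>\<^bsub>V\<^esub>)) (mat (dim_row y) (dim_col x) (\<lambda>_. \<zero>\<^bsub>V\<^esub>)) y"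

text \<open>The matrix product with respect to an arbitrary multiplication \<open>\<mu>\<close> of entries with values in \<open>V\<close>.\<close>

definition mat_prod ::
    "('z, 'm) ring_scheme \<Rightarrow> ('x \<Rightarrow> 'y \<Rightarrow> 'z) \<Rightarrow> 'x mat \<Rightarrow> 'y mat \<Rightarrow> 'z mat"
  where "mat_prod V \<mu> x y = mat (dim_row x) (dim_col y)
     (\<lambda>(i, j). finsum V (\<lambda>k. \<mu> (x $$ (i, k)) (y $$ (k, j))) {..<dim_col x})"

text \<open>Abstract (complete) operator spaces in the sense of Ruan. The norms are also given on rectangular
  matrices; by the two Ruan axioms these are determined by the norms on square matrices
  (padding with zeros).\<close>

locale operator_space =
  complex_banach_space V "\<lambda>x. mnorm V (mat1 x)"
  for V :: "('x, 'm) opspace_scheme" (structure) +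
  assumes mnorm_eq_0: "x \<in> mats V m n \<Longrightarrow> mnorm V x = 0 \<longleftrightarrow> x = mat m n (\<lambda>_. \<zero>)"
    and mnorm_triangle: "x \<in> mats V m n \<Longrightarrow> y \<in> mats V m n \<Longrightarrow>
      mnorm V (mat_sum V x y) \<le> mnorm V x + mnorm V y"
    and mnorm_scale: "x \<in> mats V m n \<Longrightarrow> mnorm V (map_mat (\<lambda>z. c \<odot>\<^bsub>V\<^esub> z) x) = cmod c * mnorm V x"
    and mnorm_diag_sum: "x \<in> mats V m n \<Longrightarrow> y \<in> mats V p q \<Longrightarrow>
      mnorm V (mat_diag_sum V x y) = max (mnorm V x) (mnorm V y)"
    and mnorm_mult: "\<alpha> \<in> carrier_mat m p \<Longrightarrow> x \<in> mats V p q \<Longrightarrow> \<beta> \<in> carrier_mat q n \<Longrightarrow>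
      mnorm V (mat_prod V (\<lambda>z d. d \<odot>\<^bsub>V\<^esub> z) (mat_prod V (\<lambda>c z. c \<odot>\<^bsub>V\<^esub> z) \<alpha> x) \<beta>)
        \<le> cmat_norm \<alpha> * mnorm V x * cmat_norm \<beta>"

definition function_mnorm :: "'w::t2_space cfun mat \<Rightarrow> real" where
  "function_mnorm F = (SUP w. cmat_norm (map_mat (\<lambda>f. apply_bcontfun f w) F))"

definition function_opspace :: "'w::t2_space cfun set \<Rightarrow> 'w cfun opspace" where
  "function_opspace S = \<lparr>carrier = S, mult = (*), one = 1, zero = 0, add = (+),
     smult = (\<lambda>c f. const_bcontfun c * f), mnorm = function_mnorm\<rparr>"

text \<open>\<open>N\<close> is the minimal operator space structure of the Banach space \<open>X\<close>: it is inherited from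
  \<open>C(K)\<close> along a linear isometric embedding \<open>j\<close>, for a (nonempty) compact Hausdorff space \<open>K\<close>.
  The points of \<open>K\<close> are taken from the type of all functions \<open>'x \<Rightarrow> complex\<close>, which contains
  the unit ball of the dual with its weak-* topology; so every Banach space has such an embedding.
  The resulting \<open>N\<close> does not depend on the embedding.\<close>

definition minimal_structure :: "('a, 'x) normed_module \<Rightarrow> ('x mat \<Rightarrow> real) \<Rightarrow> bool" where
  "minimal_structure X N \<longleftrightarrow>
     (\<exists>(K :: ('x \<Rightarrow> complex) topology) (j :: 'x \<Rightarrow> ('x \<Rightarrow> complex) \<Rightarrow> complex).
        Abstract_Topology.compact_space K \<and> Hausdorff_space K \<and> topspace K \<noteq> {} \<and>
        (\<forall>x\<in>carrier X. continuous_map K euclidean (j x)) \<and>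
        (\<forall>x\<in>carrier X. \<forall>y\<in>carrier X. \<forall>k\<in>topspace K. j (x \<oplus>\<^bsub>X\<^esub> y) k = j x k + j y k) \<and>
        (\<forall>c. \<forall>x\<in>carrier X. \<forall>k\<in>topspace K. j (c \<odot>\<^bsub>X\<^esub> x) k = c * j x k) \<and>
        (\<forall>x\<in>carrier X. (SUP k\<in>topspace K. cmod (j x k)) = nrm X x) \<and>
        (\<forall>m n. \<forall>M\<in>mats X m n. N M = (SUP k\<in>topspace K. cmat_norm (map_mat (\<lambda>x. j x k) M))))"


section \<open>The Haagerup tensor product\<close>

text \<open>The free complex vector space on \<open>X \<times> Y\<close> is represented by finitely supported functions.\<close>

type_synonym ('x, 'y) formal_tensor = "('x \<times> 'y) \<Rightarrow>\<^sub>0 complex"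

definition formal_tensors :: "('x, 'm) partial_object_scheme \<Rightarrow> ('y, 'n) partial_object_scheme \<Rightarrow> ('x, 'y) formal_tensor set" where
  "formal_tensors X Y = {u. Poly_Mapping.keys u \<subseteq> carrier X \<times> carrier Y}"

definition formal_scale :: "complex \<Rightarrow> ('x, 'y) formal_tensor \<Rightarrow> ('x, 'y) formal_tensor" where
  "formal_scale c u = Poly_Mapping.map ((*) c) u"

definition formal_elem :: "'x \<Rightarrow> 'y \<Rightarrow> ('x, 'y) formal_tensor" where
  "formal_elem x y = Poly_Mapping.single (x, y) 1"

text \<open>The algebraic tensor product is \<open>formal_tensors X Y\<close> modulo this subspace.\<close>

definition tensor_relations ::
    "('x, 'm) opspace_scheme \<Rightarrow> ('y, 'n) opspace_scheme \<Rightarrow> ('x, 'y) formal_tensor set"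
  where "tensor_relations X Y = Modules.module.span formal_scale
    ({formal_elem (x \<oplus>\<^bsub>X\<^esub> x') y - formal_elem x y - formal_elem x' y | x x' y.
        x \<in> carrier X \<and> x' \<in> carrier X \<and> y \<in> carrier Y} \<union>
     {formal_elem x (y \<oplus>\<^bsub>Y\<^esub> y') - formal_elem x y - formal_elem x y' | x y y'.
        x \<in> carrier X \<and> y \<in> carrier Y \<and> y' \<in> carrier Y} \<union>
     {formal_elem (c \<odot>\<^bsub>X\<^esub> x) y - formal_scale c (formal_elem x y) | c x y.
        x \<in> carrier X \<and> y \<in> carrier Y} \<union>
     {formal_elem x (c \<odot>\<^bsub>Y\<^esub> y) - formal_scale c (formal_elem x y) | c x y.
        x \<in> carrier X \<and> y \<in> carrier Y})"

text \<open>The Haagerup norm of a matrix over the algebraic tensor product, as a seminorm of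
  representatives: the infimum of \<open>\<parallel>x\<parallel> \<parallel>y\<parallel>\<close> over all ways to write \<open>U\<close> as \<open>x \<odot> y\<close>, that is
  \<open>U\<^sub>i\<^sub>j = \<Sum>\<^sub>k x\<^sub>i\<^sub>k \<otimes> y\<^sub>k\<^sub>j\<close>.\<close>

definition haagerup_seminorm ::
    "('x, 'm) opspace_scheme \<Rightarrow> ('y, 'n) opspace_scheme \<Rightarrow> ('x, 'y) formal_tensor mat \<Rightarrow> real"
  where "haagerup_seminorm X Y U =
    Inf {mnorm X x * mnorm Y y | x y p.
      x \<in> mats X (dim_row U) p \<and> y \<in> mats Y p (dim_col U) \<and>
      (\<forall>i<dim_row U. \<forall>j<dim_col U.
         U $$ (i, j) - (\<Sum>k<p. formal_elem (x $$ (i, k)) (y $$ (k, j))) \<in> tensor_relations X Y)}"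

text \<open>Hausdorff completion of a subspace \<open>F\<close> with matrix seminorms \<open>N\<close>: Cauchy sequences modulo
  null sequences. The matrix norm of a matrix of classes is the limit of the seminorms along
  arbitrary representatives of the entries.\<close>

definition cauchy_seqs :: "'v::ab_group_add set \<Rightarrow> ('v mat \<Rightarrow> real) \<Rightarrow> (nat \<Rightarrow> 'v) set" where
  "cauchy_seqs F N = {s. range s \<subseteq> F \<and>
     (\<forall>e>0. \<exists>M. \<forall>m\<ge>M. \<forall>n\<ge>M. N (mat1 (s m - s n)) < e)}"

definition null_relation ::
    "'v::ab_group_add set \<Rightarrow> ('v mat \<Rightarrow> real) \<Rightarrow> ((nat \<Rightarrow> 'v) \<times> (nat \<Rightarrow> 'v)) set"
  where "null_relation F N = {(s, t). s \<in> cauchy_seqs F N \<and> t \<in> cauchy_seqs F N \<and>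
     (\<lambda>n. N (mat1 (s n - t n))) \<longlonglongrightarrow> 0}"

definition completion ::
    "'v::ab_group_add set \<Rightarrow> (complex \<Rightarrow> 'v \<Rightarrow> 'v) \<Rightarrow> ('v mat \<Rightarrow> real) \<Rightarrow> (nat \<Rightarrow> 'v) set opspace"
  where "completion F sc N = (let R = null_relation F N in
    \<lparr>carrier = cauchy_seqs F N // R,
     mult = undefined, one = undefined,
     zero = R `` {\<lambda>_. 0},
     add = (\<lambda>P P'. \<Union>s\<in>P. \<Union>t\<in>P'. R `` {\<lambda>n. s n + t n}),
     smult = (\<lambda>c P. \<Union>s\<in>P. R `` {\<lambda>n. sc c (s n)}),
     mnorm = (\<lambda>U. lim (\<lambda>n. N (map_mat (\<lambda>P. (SOME s. s \<in> P) n) U)))\<rparr>)"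

definition haagerup_tensor ::
    "('x, 'm) opspace_scheme \<Rightarrow> ('y, 'n) opspace_scheme \<Rightarrow> (nat \<Rightarrow> ('x, 'y) formal_tensor) set opspace"
    (infixl \<open>\<otimes>\<^sub>h\<close> 70)
  where "X \<otimes>\<^sub>h Y = completion (formal_tensors X Y) formal_scale (haagerup_seminorm X Y)"

definition haagerup_elem ::
    "('x, 'm) opspace_scheme \<Rightarrow> ('y, 'n) opspace_scheme \<Rightarrow> 'x \<Rightarrow> 'y \<Rightarrow> (nat \<Rightarrow> ('x, 'y) formal_tensor) set"
  where "haagerup_elem X Y x y =
    null_relation (formal_tensors X Y) (haagerup_seminorm X Y) `` {\<lambda>_. formal_elem x y}"

definition linear_map :: "('x, 'm) opspace_scheme \<Rightarrow> ('y, 'n) opspace_scheme \<Rightarrow> ('x \<Rightarrow> 'y) \<Rightarrow> bool" where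
  "linear_map V W T \<longleftrightarrow> T \<in> carrier V \<rightarrow> carrier W \<and>
     (\<forall>x\<in>carrier V. \<forall>y\<in>carrier V. T (x \<oplus>\<^bsub>V\<^esub> y) = T x \<oplus>\<^bsub>W\<^esub> T y) \<and>
     (\<forall>c. \<forall>x\<in>carrier V. T (c \<odot>\<^bsub>V\<^esub> x) = c \<odot>\<^bsub>W\<^esub> T x)"

text \<open>Every amplification maps the open unit ball onto the open unit ball.\<close>

definition complete_quotient_map ::
    "('x, 'm) opspace_scheme \<Rightarrow> ('y, 'n) opspace_scheme \<Rightarrow> ('x \<Rightarrow> 'y) \<Rightarrow> bool"
  where "complete_quotient_map V W T \<longleftrightarrow> linear_map V W T \<and>
     (\<forall>n. map_mat T ` {x \<in> mats V n n. mnorm V x < 1} = {y \<in> mats W n n. mnorm W y < 1})"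

text \<open>The linear map induced by a bilinear map \<open>\<beta>\<close> on \<open>X \<otimes>\<^sub>h Y\<close> is a complete quotient map onto
  \<open>W\<close>. Elementary tensors span a dense subspace, so \<open>T\<close> is determined by \<open>\<beta>\<close>.\<close>

definition induces_complete_quotient ::
    "('x, 'm) opspace_scheme \<Rightarrow> ('y, 'n) opspace_scheme \<Rightarrow> ('z, 'k) opspace_scheme \<Rightarrow> ('x \<Rightarrow> 'y \<Rightarrow> 'z) \<Rightarrow> bool"
  where "induces_complete_quotient X Y W \<beta> \<longleftrightarrow>
     (\<exists>T. (\<forall>x\<in>carrier X. \<forall>y\<in>carrier Y. T (haagerup_elem X Y x y) = \<beta> x y) \<and>
          complete_quotient_map (X \<otimes>\<^sub>h Y) W T)"


section \<open>Strong Morita equivalence bimodules\<close>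

record ('a, 'x) op_bimodule = "'x opspace" +
  lact :: "'a \<Rightarrow> 'x \<Rightarrow> 'x"
  ract :: "'x \<Rightarrow> 'a \<Rightarrow> 'x"

text \<open>Since \<open>A\<close> is commutative, a right action is also a left action.\<close>

locale operator_bimodule =
  operator_space X + left: unital_action A X "lact X" + right: unital_action A X "\<lambda>a x. ract X x a"
  for A :: "'w::t2_space cfun set" and X :: "('w cfun, 'x) op_bimodule" (structure) +
  assumes actions_commute: "a \<in> A \<Longrightarrow> b \<in> A \<Longrightarrow> x \<in> carrier X \<Longrightarrow>
      ract X (lact X a x) b = lact X a (ract X x b)"
    and lact_contractive: "M \<in> mats (function_opspace A) m p \<Longrightarrow> Z \<in> mats X p n \<Longrightarrow>
      mnorm X (mat_prod X (lact X) M Z) \<le> function_mnorm M * mnorm X Z"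
    and ract_contractive: "Z \<in> mats X m p \<Longrightarrow> M \<in> mats (function_opspace A) p n \<Longrightarrow>
      mnorm X (mat_prod X (ract X) Z M) \<le> mnorm X Z * function_mnorm M"

locale balanced_pairing =
  fixes A :: "'w::t2_space cfun set"
    and X :: "('w cfun, 'x) op_bimodule"
    and Y :: "('w cfun, 'y) op_bimodule"
    and \<beta> :: "'x \<Rightarrow> 'y \<Rightarrow> 'w cfun"
  assumes pairing_closed: "x \<in> carrier X \<Longrightarrow> y \<in> carrier Y \<Longrightarrow> \<beta> x y \<in> A"
    and pairing_add_left: "x \<in> carrier X \<Longrightarrow> x' \<in> carrier X \<Longrightarrow> y \<in> carrier Y \<Longrightarrow>
      \<beta> (x \<oplus>\<^bsub>X\<^esub> x') y = \<beta> x y + \<beta> x' y"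
    and pairing_add_right: "x \<in> carrier X \<Longrightarrow> y \<in> carrier Y \<Longrightarrow> y' \<in> carrier Y \<Longrightarrow>
      \<beta> x (y \<oplus>\<^bsub>Y\<^esub> y') = \<beta> x y + \<beta> x y'"
    and pairing_scale_left: "x \<in> carrier X \<Longrightarrow> y \<in> carrier Y \<Longrightarrow>
      \<beta> (c \<odot>\<^bsub>X\<^esub> x) y = const_bcontfun c * \<beta> x y"
    and pairing_scale_right: "x \<in> carrier X \<Longrightarrow> y \<in> carrier Y \<Longrightarrow>
      \<beta> x (c \<odot>\<^bsub>Y\<^esub> y) = const_bcontfun c * \<beta> x y"
    and pairing_lact: "a \<in> A \<Longrightarrow> x \<in> carrier X \<Longrightarrow> y \<in> carrier Y \<Longrightarrow> \<beta> (lact X a x) y = a * \<beta> x y"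
    and pairing_ract: "a \<in> A \<Longrightarrow> x \<in> carrier X \<Longrightarrow> y \<in> carrier Y \<Longrightarrow> \<beta> x (ract Y y a) = \<beta> x y * a"
    and pairing_balanced: "a \<in> A \<Longrightarrow> x \<in> carrier X \<Longrightarrow> y \<in> carrier Y \<Longrightarrow>
      \<beta> (ract X x a) y = \<beta> x (lact Y a y)"

text \<open>\<open>pr\<close> and \<open>br\<close> are the pairings \<open>(\<cdot>,\<cdot>)\<close> and \<open>[\<cdot>,\<cdot>]\<close>.\<close>

locale strong_morita_context =
  X: operator_bimodule A X + Y: operator_bimodule A Y +
  pr: balanced_pairing A X Y pr + br: balanced_pairing A Y X br
  for A :: "'w::t2_space cfun set"
    and X :: "('w cfun, 'x) op_bimodule" and Y :: "('w cfun, 'y) op_bimodule"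
    and pr :: "'x \<Rightarrow> 'y \<Rightarrow> 'w cfun" and br :: "'y \<Rightarrow> 'x \<Rightarrow> 'w cfun" +
  assumes assoc_X: "x \<in> carrier X \<Longrightarrow> y \<in> carrier Y \<Longrightarrow> x' \<in> carrier X \<Longrightarrow>
      lact X (pr x y) x' = ract X x (br y x')"
    and assoc_Y: "y \<in> carrier Y \<Longrightarrow> x \<in> carrier X \<Longrightarrow> y' \<in> carrier Y \<Longrightarrow>
      lact Y (br y x) y' = ract Y y (pr x y')"
    and pr_quotient: "induces_complete_quotient X Y (function_opspace A) pr"
    and br_quotient: "induces_complete_quotient Y X (function_opspace A) br"

text \<open>The type argument is the type from which the elements of the inverse bimodule are taken, since
  HOL has no existential quantifier over types.\<close>

definition rank_one_strong_morita ::
    "'y itself \<Rightarrow> 'w::t2_space cfun set \<Rightarrow> ('w cfun, 'x) op_bimodule \<Rightarrow> bool"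
  where "rank_one_strong_morita _ A X \<longleftrightarrow>
    (\<forall>a\<in>A. \<forall>x\<in>carrier X. lact X a x = ract X x a) \<and>
    (\<exists>(Y :: ('w cfun, 'y) op_bimodule) pr br. strong_morita_context A X Y pr br \<and>
       (\<exists>x'\<in>carrier X. \<exists>y'\<in>carrier Y. \<exists>x''\<in>carrier X. \<exists>y''\<in>carrier Y. pr x' y' = 1 \<and> br y'' x'' = 1) \<and>
       (\<forall>\<epsilon>>0. \<exists>x'\<in>carrier X. \<exists>y'\<in>carrier Y. pr x' y' = 1 \<and>
          \<bar>mnorm X (mat1 x') - 1\<bar> < \<epsilon> \<and> \<bar>mnorm Y (mat1 y') - 1\<bar> < \<epsilon>))"

definition symmetric_bimodule ::
    "('a, 'x) normed_module \<Rightarrow> ('x mat \<Rightarrow> real) \<Rightarrow> ('a, 'x) op_bimodule"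
  where "symmetric_bimodule X N = \<lparr>carrier = carrier X, mult = mult X, one = \<one>\<^bsub>X\<^esub>, zero = \<zero>\<^bsub>X\<^esub>,
    add = add X, smult = smult X, mnorm = N, lact = act X, ract = (\<lambda>x a. act X a x)\<rparr>"

end

theory Submission
  imports Defs
begin

text \<open>For (i) \<open>\<Rightarrow>\<close> (iii), rescale the almost isometries \<open>T\<^sub>n : X \<rightarrow> A\<close> to contractions and fix a generator
  \<open>e\<close> of \<open>X\<close>; then \<open>g\<^sub>n = T\<^sub>n e\<close> is invertible and \<open>\<parallel>a g\<^sub>n\<parallel> \<le> \<parallel>a e\<parallel> \<le> (1 + \<epsilon>\<^sub>n) \<parallel>a g\<^sub>n\<parallel>\<close>. Hence the
  \<open>\<bar>g\<^sub>n\<bar>\<close> converge uniformly to some \<open>f\<close> with \<open>\<parallel>a f\<parallel> = \<parallel>a e\<parallel>\<close>, and \<open>a e \<mapsto> a f\<close> is the isometry. For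
  (iii) \<open>\<Rightarrow>\<close> (ii), the inverse bimodule of \<open>A f\<close> is \<open>A f\<^sup>-\<^sup>1\<close> with the product of functions as pairing:
  an invertible \<open>h\<close> in \<open>A\<close> with \<open>\<bar>h\<bar>\<close> close to \<open>f\<close> gives \<open>1 = (h\<^sup>-\<^sup>1 f) (h f\<^sup>-\<^sup>1)\<close> with both factors of
  norm close to \<open>1\<close>, so a matrix \<open>Z\<close> over \<open>A\<close> lifts to \<open>Z h\<^sup>-\<^sup>1 f \<otimes> h f\<^sup>-\<^sup>1\<close> with almost no loss of
  norm. For (ii) \<open>\<Rightarrow>\<close> (i), the map \<open>x \<mapsto> (x, y')\<close> has the inverse \<open>a \<mapsto> a x'\<close>.\<close>

section \<open>Norms of complex matrices\<close>

text \<open>Only moduli are compared in (i) \<Rightarrow> (iii): an almost isometry times a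
  unimodular constant is another one, so the \<open>g n\<close> themselves need not converge.

  The length of (iii) \<Rightarrow> (ii) comes from the Haagerup tensor product, a completion of
  formal tensors modulo relations. Its seminorm is an infimum over factorizations
  \<open>U = x \<odot> y\<close>. The triangle inequality joins two of these into a block row and a
  block column, whose norms obey a law of squares; both factors must therefore first be scaled to a
  common bound. Bounding a matrix seminorm by its entries then makes limits of matrix norms
  independent of representatives. The map into \<open>A\<close> is analysed on formal tensors only:
  a contraction extends to the completion, and since open unit balls are compared, units of norm
  slightly above 1 lift matrices exactly, without a limit.

  In (ii) \<Rightarrow> (i) quotient maps are contractive, so \<open>(x, y)\<close> has norm at most
  that of \<open>x\<close> times that of \<open>y\<close>, and the minimal structure enters only
  through its value on single elements. In the other direction the isometry onto \<open>A f\<close>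
  itself realizes the minimal structure.\<close>

abbreviation vnorm :: "nat \<Rightarrow> (nat \<Rightarrow> complex) \<Rightarrow> real" where
  "vnorm n v \<equiv> L2_set (\<lambda>j. cmod (v j)) {..<n}"

definition mat_app :: "complex mat \<Rightarrow> (nat \<Rightarrow> complex) \<Rightarrow> nat \<Rightarrow> complex" where
  "mat_app M v i = (\<Sum>j<dim_col M. M $$ (i, j) * v j)"

lemma cmat_norm_alt:
  "cmat_norm M = (SUP v\<in>{v. vnorm (dim_col M) v \<le> 1}. vnorm (dim_row M) (mat_app M v))"
  unfolding cmat_norm_def mat_app_def L2_set_def by simp

lemma vnorm_scale: "vnorm n (\<lambda>j. c * v j) = cmod c * vnorm n v"
  by (simp add: norm_mult L2_set_right_distrib)

lemma mat_app_scale: "mat_app M (\<lambda>j. c * v j) = (\<lambda>i. c * mat_app M v i)"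
  by (simp add: mat_app_def sum_distrib_left fun_eq_iff mult.left_commute)

text \<open>A crude bound that makes the supremum in \<open>cmat_norm\<close> run over a bounded
  set; only then is it an upper bound. It is also the source of the entrywise estimates used for
  limits.\<close>

lemma vnorm_mat_app_le_sum:
  "vnorm (dim_row M) (mat_app M v) \<le>
     (\<Sum>i<dim_row M. \<Sum>j<dim_col M. cmod (M $$ (i, j))) * vnorm (dim_col M) v"
proof -
  have "vnorm (dim_row M) (mat_app M v) \<le> (\<Sum>i<dim_row M. cmod (mat_app M v i))"
    by (rule L2_set_le_sum) simp
  also have "\<dots> \<le> (\<Sum>i<dim_row M. \<Sum>j<dim_col M. cmod (M $$ (i, j)) * vnorm (dim_col M) v)"
  proof (rule sum_mono)
    fix i
    have "cmod (mat_app M v i) \<le> (\<Sum>j<dim_col M. cmod (M $$ (i, j)) * cmod (v j))"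
      unfolding mat_app_def by (rule order_trans[OF norm_sum]) (simp add: norm_mult)
    also have "\<dots> \<le> (\<Sum>j<dim_col M. cmod (M $$ (i, j)) * vnorm (dim_col M) v)"
      by (intro sum_mono mult_left_mono member_le_L2_set[where f = "\<lambda>j. cmod (v j)"]) auto
    finally show "cmod (mat_app M v i) \<le> \<dots>" .
  qed
  also have "\<dots> = (\<Sum>i<dim_row M. \<Sum>j<dim_col M. cmod (M $$ (i, j))) * vnorm (dim_col M) v"
    by (simp add: sum_distrib_right)
  finally show ?thesis .
qed

lemma cmat_norm_leI:
  assumes "0 \<le> c" and "\<And>v. vnorm (dim_row M) (mat_app M v) \<le> c * vnorm (dim_col M) v"
  shows "cmat_norm M \<le> c"
  unfolding cmat_norm_alt
proof (rule cSUP_least)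
  show "{v. vnorm (dim_col M) v \<le> 1} \<noteq> {}"
    by (auto simp: L2_set_def intro!: exI[of _ "\<lambda>_. 0"])
  fix v assume "v \<in> {v. vnorm (dim_col M) v \<le> 1}"
  then show "vnorm (dim_row M) (mat_app M v) \<le> c"
    using assms(2)[of v] mult_left_mono[of "vnorm (dim_col M) v" 1 c] assms(1) by auto
qed

lemma vnorm_mat_app_le_if:
  assumes "vnorm (dim_col M) v \<le> 1"
  shows "vnorm (dim_row M) (mat_app M v) \<le> cmat_norm M"
  unfolding cmat_norm_alt
proof (rule cSUP_upper)
  show "bdd_above ((\<lambda>v. vnorm (dim_row M) (mat_app M v)) ` {v. vnorm (dim_col M) v \<le> 1})"
  proof (rule bdd_aboveI2)
    fix v assume "v \<in> {v. vnorm (dim_col M) v \<le> 1}"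
    then have "vnorm (dim_col M) v \<le> 1" by simp
    from mult_left_mono[OF this] 
    show "vnorm (dim_row M) (mat_app M v) \<le> (\<Sum>i<dim_row M. \<Sum>j<dim_col M. cmod (M $$ (i, j)))"
      by (rule order_trans[OF vnorm_mat_app_le_sum, OF order_trans]) (auto intro!: sum_nonneg)
  qed
qed (use assms in simp)

lemma vnorm_mat_app_le: "vnorm (dim_row M) (mat_app M v) \<le> cmat_norm M * vnorm (dim_col M) v"
proof (cases "vnorm (dim_col M) v = 0")
  case True
  \<comment> \<open>\<open>v\<close> cannot be normalized here, and it need not be the zero
    function, since \<open>vnorm\<close> sees only the first \<open>dim_col M\<close> coordinates;
    the crude bound settles the case.\<close>
  then show ?thesis using vnorm_mat_app_le_sum[of M v] by simp
next
  case False
  define t where "t = vnorm (dim_col M) v"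
  have t: "t > 0" using False L2_set_nonneg[of "\<lambda>j. cmod (v j)"] unfolding t_def
    by (simp add: order_less_le)
  have "vnorm (dim_col M) (\<lambda>j. complex_of_real (1 / t) * v j) \<le> 1"
    unfolding vnorm_scale using t by (simp add: t_def[symmetric] norm_divide)
  from vnorm_mat_app_le_if[OF this]
  have "1 / t * vnorm (dim_row M) (mat_app M v) \<le> cmat_norm M"
    unfolding mat_app_scale vnorm_scale using t by (simp add: norm_divide)
  then show ?thesis using t by (simp add: t_def[symmetric] field_simps)
qed

lemma cmat_norm_nonneg: "0 \<le> cmat_norm M"
  by (rule order_trans[OF L2_set_nonneg vnorm_mat_app_le_if[where v = "\<lambda>_. 0"]])
    (simp add: L2_set_def)

lemma cmat_norm_le_sum: "cmat_norm M \<le> (\<Sum>i<dim_row M. \<Sum>j<dim_col M. cmod (M $$ (i, j)))"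
  by (rule cmat_norm_leI[OF _ vnorm_mat_app_le_sum]) (auto intro!: sum_nonneg)

lemma vnorm_unit: "j < n \<Longrightarrow> vnorm n (\<lambda>k. if k = j then 1 else 0) = 1"
  by (simp add: L2_set_def if_distrib[of cmod] if_distrib[of "\<lambda>x. x\<^sup>2"] cong: if_cong)

lemma cmat_norm_entry:
  assumes "i < dim_row M" "j < dim_col M"
  shows "cmod (M $$ (i, j)) \<le> cmat_norm M"
proof -
  let ?v = "\<lambda>k. if k = j then 1 else 0 :: complex"
  have "M $$ (i, j) = mat_app M ?v i"
    using assms by (simp add: mat_app_def if_distrib cong: if_cong)
  then have "cmod (M $$ (i, j)) \<le> vnorm (dim_row M) (mat_app M ?v)"
    using member_le_L2_set[of "{..<dim_row M}" i "\<lambda>i. cmod (mat_app M ?v i)"] assms by simp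
  also have "\<dots> \<le> cmat_norm M"
    using vnorm_mat_app_le[of M ?v] assms by (simp add: vnorm_unit)
  finally show ?thesis .
qed

lemma cmat_norm_eq_0_iff:
  "cmat_norm M = 0 \<longleftrightarrow> (\<forall>i<dim_row M. \<forall>j<dim_col M. M $$ (i, j) = 0)"
  (is "?L \<longleftrightarrow> ?R")
proof
  assume ?L
  then show ?R using cmat_norm_entry[of _ M] by fastforce
next
  assume ?R
  then show ?L using cmat_norm_le_sum[of M] cmat_norm_nonneg[of M] by simp
qed

lemma cmat_norm_1x1: "cmat_norm (mat 1 1 f) = cmod (f (0, 0))"
  using cmat_norm_le_sum[of "mat 1 1 f"] cmat_norm_entry[of 0 "mat 1 1 f" 0] by simp

lemma cmat_norm_add:
  assumes "M \<in> carrier_mat m n" "M' \<in> carrier_mat m n"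
  shows "cmat_norm (M + M') \<le> cmat_norm M + cmat_norm M'"
proof (rule cmat_norm_leI)
  fix v
  have "vnorm m (mat_app (M + M') v) \<le> L2_set (\<lambda>i. cmod (mat_app M v i) + cmod (mat_app M' v i)) {..<m}"
  proof (rule L2_set_mono)
    fix i assume i: "i \<in> {..<m}"
    have "mat_app (M + M') v i = mat_app M v i + mat_app M' v i"
      using assms i by (simp add: mat_app_def sum.distrib algebra_simps)
    then show "cmod (mat_app (M + M') v i) \<le> cmod (mat_app M v i) + cmod (mat_app M' v i)"
      by (simp add: norm_triangle_ineq)
  qed simp
  also have "\<dots> \<le> vnorm m (mat_app M v) + vnorm m (mat_app M' v)"
    by (rule L2_set_triangle_ineq)
  also have "\<dots> \<le> (cmat_norm M + cmat_norm M') * vnorm n v"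
    using vnorm_mat_app_le[of M v] vnorm_mat_app_le[of M' v] assms by (simp add: algebra_simps)
  finally show "vnorm (dim_row (M + M')) (mat_app (M + M') v)
      \<le> (cmat_norm M + cmat_norm M') * vnorm (dim_col (M + M')) v"
    using assms by simp
qed (simp add: cmat_norm_nonneg)

lemma cmat_norm_mult:
  assumes "M \<in> carrier_mat m p" "M' \<in> carrier_mat p n"
  shows "cmat_norm (M * M') \<le> cmat_norm M * cmat_norm M'"
proof (rule cmat_norm_leI)
  fix v
  have "mat_app (M * M') v i = mat_app M (mat_app M' v) i" if "i < m" for i
  proof -
    have "mat_app (M * M') v i = (\<Sum>j<n. \<Sum>k<p. M $$ (i, k) * M' $$ (k, j) * v j)"
      using assms that
      by (simp add: mat_app_def scalar_prod_def atLeast0LessThan sum_distrib_right)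
    also have "\<dots> = (\<Sum>k<p. \<Sum>j<n. M $$ (i, k) * M' $$ (k, j) * v j)"
      by (rule sum.swap)
    also have "\<dots> = mat_app M (mat_app M' v) i"
      using assms by (simp add: mat_app_def sum_distrib_left mult.assoc)
    finally show ?thesis .
  qed
  then have "vnorm m (mat_app (M * M') v) = vnorm m (mat_app M (mat_app M' v))"
    by (intro L2_set_cong) auto
  also have "\<dots> \<le> cmat_norm M * vnorm p (mat_app M' v)"
    using vnorm_mat_app_le[of M] assms by auto
  also have "\<dots> \<le> cmat_norm M * (cmat_norm M' * vnorm n v)"
    using vnorm_mat_app_le[of M' v] assms by (auto intro!: mult_left_mono simp: cmat_norm_nonneg)
  finally show "vnorm (dim_row (M * M')) (mat_app (M * M') v)
      \<le> cmat_norm M * cmat_norm M' * vnorm (dim_col (M * M')) v"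
    using assms by (simp add: mult.assoc)
qed (simp add: cmat_norm_nonneg)

lemma cmat_norm_smult_le: "cmat_norm (c \<cdot>\<^sub>m M) \<le> cmod c * cmat_norm M"
proof (rule cmat_norm_leI)
  fix v
  have "vnorm (dim_row M) (mat_app (c \<cdot>\<^sub>m M) v) = vnorm (dim_row M) (\<lambda>i. c * mat_app M v i)"
    by (intro L2_set_cong) (auto simp: mat_app_def sum_distrib_left mult.assoc)
  also have "\<dots> \<le> cmod c * cmat_norm M * vnorm (dim_col M) v"
    unfolding vnorm_scale using vnorm_mat_app_le[of M v] by (simp add: mult.assoc mult_left_mono)
  finally show "vnorm (dim_row (c \<cdot>\<^sub>m M)) (mat_app (c \<cdot>\<^sub>m M) v)
      \<le> cmod c * cmat_norm M * vnorm (dim_col (c \<cdot>\<^sub>m M)) v" by simp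
qed (simp add: cmat_norm_nonneg)

lemma cmat_norm_smult: "cmat_norm (c \<cdot>\<^sub>m M) = cmod c * cmat_norm M"
proof (cases "c = 0")
  case True
  then show ?thesis by (simp add: cmat_norm_eq_0_iff)
next
  case False
  have "M = inverse c \<cdot>\<^sub>m (c \<cdot>\<^sub>m M)" using False by auto
  then have "cmat_norm M \<le> cmod (inverse c) * cmat_norm (c \<cdot>\<^sub>m M)"
    by (metis cmat_norm_smult_le)
  then have "cmod c * cmat_norm M \<le> cmat_norm (c \<cdot>\<^sub>m M)"
    using False by (simp add: norm_divide field_simps)
  with cmat_norm_smult_le[of c M] show ?thesis by simp
qed

lemma sum_lessThan_add:
  fixes g :: "nat \<Rightarrow> 'a::comm_monoid_add"
  shows "(\<Sum>j<m + n. g j) = (\<Sum>j<m. g j) + (\<Sum>j<n. g (m + j))"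
  by (induction n) (simp_all add: add.assoc)

lemma vnorm_append: "(vnorm (m + n) v)\<^sup>2 = (vnorm m v)\<^sup>2 + (vnorm n (\<lambda>i. v (m + i)))\<^sup>2"
  by (simp add: L2_set_def sum_nonneg sum_lessThan_add)

text \<open>By \<open>vnorm_append\<close> the squared norms add over the two blocks, which gives
  the upper bound. For the lower bound, vectors supported in a single block are tested.\<close>

lemma cmat_norm_diag:
  assumes M: "M \<in> carrier_mat m n" and M': "M' \<in> carrier_mat p q"
  shows "cmat_norm (four_block_mat M (0\<^sub>m m q) (0\<^sub>m p n) M') = max (cmat_norm M) (cmat_norm M')"
    (is "cmat_norm ?D = ?c")
proof (rule antisym)
  have D: "?D \<in> carrier_mat (m + p) (n + q)" using assms by auto
  have app: "vnorm (m + p) (mat_app ?D v) ^ 2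
      = (vnorm m (mat_app M v))\<^sup>2 + (vnorm p (mat_app M' (\<lambda>i. v (n + i))))\<^sup>2" for v
  proof -
    have "vnorm m (mat_app ?D v) = vnorm m (mat_app M v)"
      using assms by (intro L2_set_cong) (auto simp: mat_app_def sum_lessThan_add)
    moreover have "vnorm p (\<lambda>i. mat_app ?D v (m + i)) = vnorm p (mat_app M' (\<lambda>i. v (n + i)))"
      using assms by (intro L2_set_cong) (auto simp: mat_app_def sum_lessThan_add)
    ultimately show ?thesis unfolding vnorm_append by simp
  qed
  have c: "0 \<le> ?c" by (simp add: cmat_norm_nonneg le_max_iff_disj)
  show "cmat_norm ?D \<le> ?c"
  proof (rule cmat_norm_leI[OF c])
    fix v
    have le1: "vnorm m (mat_app M v) \<le> ?c * vnorm n v"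
      using vnorm_mat_app_le[of M v] M mult_right_mono[of "cmat_norm M" ?c "vnorm n v"] by auto
    have le2: "vnorm p (mat_app M' (\<lambda>i. v (n + i))) \<le> ?c * vnorm q (\<lambda>i. v (n + i))"
      using vnorm_mat_app_le[of M' "\<lambda>i. v (n + i)"] M'
        mult_right_mono[of "cmat_norm M'" ?c "vnorm q (\<lambda>i. v (n + i))"] by auto
    have "(vnorm (m + p) (mat_app ?D v))\<^sup>2 \<le> (?c * vnorm n v)\<^sup>2 + (?c * vnorm q (\<lambda>i. v (n + i)))\<^sup>2"
      unfolding app by (intro add_mono power_mono le1 le2) auto
    also have "\<dots> = (?c * vnorm (n + q) v)\<^sup>2"
      by (simp add: power_mult_distrib vnorm_append distrib_left)
    finally show "vnorm (dim_row ?D) (mat_app ?D v) \<le> ?c * vnorm (dim_col ?D) v"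
      using assms c by (auto dest!: power2_le_imp_le)
  qed
  have "cmat_norm M \<le> cmat_norm ?D"
  proof (rule cmat_norm_leI[OF cmat_norm_nonneg])
    fix v
    define u where "u j = (if j < n then v j else (0::complex))" for j
    have "mat_app M u = mat_app M v"
      using M by (auto simp: mat_app_def u_def fun_eq_iff)
    then have "vnorm m (mat_app M v) \<le> vnorm (m + p) (mat_app ?D u)"
      by (intro power2_le_imp_le[OF _ L2_set_nonneg]) (simp add: app)
    also have "vnorm (m + p) (mat_app ?D u) \<le> cmat_norm ?D * vnorm (n + q) u"
      using vnorm_mat_app_le[of ?D u] assms by simp
    also have "vnorm (n + q) u = vnorm n v"
      using vnorm_append[of u n q] by (auto simp: u_def L2_set_def sum_nonneg)
    finally show "vnorm (dim_row M) (mat_app M v) \<le> cmat_norm ?D * vnorm (dim_col M) v"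
      using M by simp
  qed
  moreover have "cmat_norm M' \<le> cmat_norm ?D"
  proof (rule cmat_norm_leI[OF cmat_norm_nonneg])
    fix v
    define u where "u j = (if j < n then 0 else v (j - n) :: complex)" for j
    have "mat_app M' (\<lambda>i. u (n + i)) = mat_app M' v"
      using M' by (auto simp: mat_app_def u_def fun_eq_iff)
    then have "vnorm p (mat_app M' v) \<le> vnorm (m + p) (mat_app ?D u)"
      by (intro power2_le_imp_le[OF _ L2_set_nonneg]) (simp add: app)
    also have "vnorm (m + p) (mat_app ?D u) \<le> cmat_norm ?D * vnorm (n + q) u"
      using vnorm_mat_app_le[of ?D u] assms by simp
    also have "vnorm (n + q) u = vnorm q v"
      using vnorm_append[of u n q] by (auto simp: u_def L2_set_def sum_nonneg)
    finally show "vnorm (dim_row M') (mat_app M' v) \<le> cmat_norm ?D * vnorm (dim_col M') v"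
      using M' by simp
  qed
  ultimately show "?c \<le> cmat_norm ?D" by simp
qed

text \<open>Not an equation: for \<open>n = 0\<close> the norm is 0.\<close>

lemma cmat_norm_one_le: "cmat_norm (1\<^sub>m n) \<le> 1"
proof (rule cmat_norm_leI)
  fix v :: "nat \<Rightarrow> complex"
  have "vnorm n (mat_app (1\<^sub>m n) v) = vnorm n v"
    by (intro L2_set_cong) (auto simp: mat_app_def if_distrib[of "\<lambda>x. x * _"] cong: if_cong)
  then show "vnorm (dim_row (1\<^sub>m n)) (mat_app (1\<^sub>m n) v) \<le> 1 * vnorm (dim_col (1\<^sub>m n)) v"
    by simp
qed simp

text \<open>The scalar block row \<open>[s 1, t 1]\<close>, with \<open>col_pair\<close> as its
  transpose. Multiplied by the block diagonal matrix of \<open>x / s\<close> and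
  \<open>y / t\<close> it gives \<open>[x y]\<close>; in this way Ruan's two axioms yield the norm
  bound for block rows and columns.\<close>

definition row_pair :: "nat \<Rightarrow> real \<Rightarrow> real \<Rightarrow> complex mat" where
  "row_pair m s t = mat m (m + m) (\<lambda>(i, k). if k = i then of_real s else if k = m + i then of_real t else 0)"

definition col_pair :: "nat \<Rightarrow> real \<Rightarrow> real \<Rightarrow> complex mat" where
  "col_pair m s t = mat (m + m) m (\<lambda>(k, i). if k = i then of_real s else if k = m + i then of_real t else 0)"

lemma pair_carrier [simp]:
  "row_pair m s t \<in> carrier_mat m (m + m)" "col_pair m s t \<in> carrier_mat (m + m) m"
  "dim_row (row_pair m s t) = m" "dim_col (row_pair m s t) = m + m"
  "dim_row (col_pair m s t) = m + m" "dim_col (col_pair m s t) = m"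
  by (simp_all add: row_pair_def col_pair_def)

lemma cmat_norm_col_pair: "cmat_norm (col_pair m s t) \<le> sqrt (s\<^sup>2 + t\<^sup>2)"
proof (rule cmat_norm_leI)
  fix v
  have "vnorm m (mat_app (col_pair m s t) v) = vnorm m (\<lambda>i. of_real s * v i)"
    by (intro L2_set_cong)
      (auto simp: mat_app_def col_pair_def if_distrib[of "\<lambda>x. x * _"] cong: if_cong)
  moreover have "vnorm m (\<lambda>i. mat_app (col_pair m s t) v (m + i)) = vnorm m (\<lambda>i. of_real t * v i)"
    by (intro L2_set_cong)
      (auto simp: mat_app_def col_pair_def if_distrib[of "\<lambda>x. x * _"] cong: if_cong)
  ultimately have "(vnorm (m + m) (mat_app (col_pair m s t) v))\<^sup>2 = (sqrt (s\<^sup>2 + t\<^sup>2) * vnorm m v)\<^sup>2"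
    unfolding vnorm_append vnorm_scale by (simp add: power_mult_distrib algebra_simps)
  then show "vnorm (dim_row (col_pair m s t)) (mat_app (col_pair m s t) v)
      \<le> sqrt (s\<^sup>2 + t\<^sup>2) * vnorm (dim_col (col_pair m s t)) v"
    by (auto dest!: power2_le_imp_le)
qed simp

lemma cmat_norm_row_pair: "cmat_norm (row_pair m s t) \<le> sqrt (s\<^sup>2 + t\<^sup>2)"
proof (rule cmat_norm_leI)
  fix v
  have "mat_app (row_pair m s t) v i = of_real s * v i + of_real t * v (m + i)" if "i < m" for i
  proof -
    have "mat_app (row_pair m s t) v i
        = (\<Sum>k<m + m. (if k = i then of_real s * v k else 0) + (if k = m + i then of_real t * v k else 0))"
      unfolding mat_app_def using that by (auto simp: row_pair_def intro!: sum.cong)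
    then show ?thesis using that by (simp add: sum.distrib)
  qed
  then have "(vnorm m (mat_app (row_pair m s t) v))\<^sup>2 = (\<Sum>i<m. (cmod (of_real s * v i + of_real t * v (m + i)))\<^sup>2)"
    by (simp add: L2_set_def sum_nonneg)
  also have "\<dots> \<le> (\<Sum>i<m. (s\<^sup>2 + t\<^sup>2) * ((cmod (v i))\<^sup>2 + (cmod (v (m + i)))\<^sup>2))"
  proof (rule sum_mono)
    fix i
    let ?a = "cmod (v i)" and ?b = "cmod (v (m + i))"
    have "cmod (of_real s * v i + of_real t * v (m + i)) \<le> \<bar>s\<bar> * ?a + \<bar>t\<bar> * ?b"
      by (rule order_trans[OF norm_triangle_ineq]) (simp add: norm_mult)
    then have "(cmod (of_real s * v i + of_real t * v (m + i)))\<^sup>2 \<le> (\<bar>s\<bar> * ?a + \<bar>t\<bar> * ?b)\<^sup>2"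
      by (rule power_mono) simp
    also have "\<dots> \<le> (\<bar>s\<bar>\<^sup>2 + \<bar>t\<bar>\<^sup>2) * (?a\<^sup>2 + ?b\<^sup>2)"
    proof -
      \<comment> \<open>Lagrange's identity; dropping the second square leaves the Cauchy-Schwarz
        inequality in two dimensions.\<close>
      have "(p * a + q * b)\<^sup>2 + (p * b - q * a)\<^sup>2 = (p\<^sup>2 + q\<^sup>2) * (a\<^sup>2 + b\<^sup>2)" for p q a b :: real
        by (simp add: power2_eq_square algebra_simps)
      then show ?thesis by (metis le_add_same_cancel1 zero_le_power2)
    qed
    finally show "(cmod (of_real s * v i + of_real t * v (m + i)))\<^sup>2 \<le> (s\<^sup>2 + t\<^sup>2) * (?a\<^sup>2 + ?b\<^sup>2)"
      by simp
  qed
  also have "\<dots> = (sqrt (s\<^sup>2 + t\<^sup>2) * vnorm (m + m) v)\<^sup>2"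
    by (simp add: power_mult_distrib vnorm_append sum_distrib_left[symmetric] sum.distrib)
      (simp add: L2_set_def sum_nonneg)
  finally show "vnorm (dim_row (row_pair m s t)) (mat_app (row_pair m s t) v)
      \<le> sqrt (s\<^sup>2 + t\<^sup>2) * vnorm (dim_col (row_pair m s t)) v"
    by (auto dest!: power2_le_imp_le)
qed simp

section \<open>Operator spaces\<close>

lemma complex_ring_simps [simp]:
  "carrier complex_ring = UNIV" "(\<otimes>\<^bsub>complex_ring\<^esub>) = (*)" "(\<oplus>\<^bsub>complex_ring\<^esub>) = (+)"
  "\<one>\<^bsub>complex_ring\<^esub> = 1" "\<zero>\<^bsub>complex_ring\<^esub> = 0"
  by (simp_all add: complex_ring_def)

lemma matsI:
  "M \<in> carrier_mat m n \<Longrightarrow> (\<And>i j. i < m \<Longrightarrow> j < n \<Longrightarrow> M $$ (i, j) \<in> carrier V) \<Longrightarrow> M \<in> mats V m n"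
  unfolding mats_def by (auto dest!: elements_matD)

lemma mats_carrier: "M \<in> mats V m n \<Longrightarrow> M \<in> carrier_mat m n"
  unfolding mats_def by simp

lemma mats_dim [simp]: "M \<in> mats V m n \<Longrightarrow> dim_row M = m" "M \<in> mats V m n \<Longrightarrow> dim_col M = n"
  by (auto dest!: mats_carrier)

lemma mats_entry: "M \<in> mats V m n \<Longrightarrow> i < m \<Longrightarrow> j < n \<Longrightarrow> M $$ (i, j) \<in> carrier V"
  unfolding mats_def by (auto intro: elements_matI)

lemma mats_map:
  "M \<in> mats V m n \<Longrightarrow> (\<And>x. x \<in> carrier V \<Longrightarrow> f x \<in> carrier W) \<Longrightarrow> map_mat f M \<in> mats W m n"
  by (rule matsI) (auto intro: mats_entry dest: mats_carrier)

lemma mat1_mats: "x \<in> carrier V \<Longrightarrow> mat1 x \<in> mats V 1 1"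
  by (rule matsI) (auto simp: mat1_def)

lemma mat1_simps [simp]: "dim_row (mat1 x) = 1" "dim_col (mat1 x) = 1" "mat1 x $$ (0, 0) = x"
  "mat1 x \<in> carrier_mat 1 1"
  by (auto simp: mat1_def)

lemma map_mat1 [simp]: "map_mat f (mat1 x) = mat1 (f x)"
  by (rule eq_matI) (auto simp: mat1_def)

lemma mats_1_1: "M \<in> mats V 1 1 \<longleftrightarrow> (\<exists>x\<in>carrier V. M = mat1 x)"
proof
  assume "M \<in> mats V 1 1"
  then show "\<exists>x\<in>carrier V. M = mat1 x"
    by (intro bexI[of _ "M $$ (0, 0)"] eq_matI) (auto simp: mat1_def mats_entry)
qed (auto intro!: mat1_mats[simplified])

lemma (in abelian_monoid) finsum_single:
  assumes "finite A" "i \<in> A" "f i \<in> carrier G" "\<And>k. k \<in> A \<Longrightarrow> k \<noteq> i \<Longrightarrow> f k = \<zero>"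
  shows "finsum G f A = f i"
proof -
  have "finsum G f A = finsum G (\<lambda>k. if i = k then f i else \<zero>) A"
    by (rule finsum_cong') (use assms in auto)
  also have "\<dots> = f i"
    using add.finprod_singleton[of i A "\<lambda>_. f i"] assms by simp
  finally show ?thesis .
qed

section \<open>Block rows and block columns over an operator space\<close>

definition hcat :: "'x mat \<Rightarrow> 'x mat \<Rightarrow> 'x mat" where
  "hcat x y = mat (dim_row x) (dim_col x + dim_col y)
     (\<lambda>(i, j). if j < dim_col x then x $$ (i, j) else y $$ (i, j - dim_col x))"

definition vcat :: "'x mat \<Rightarrow> 'x mat \<Rightarrow> 'x mat" where
  "vcat x y = mat (dim_row x + dim_row y) (dim_col x)
     (\<lambda>(i, j). if i < dim_row x then x $$ (i, j) else y $$ (i - dim_row x, j))"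

lemma hcat_mats: "x \<in> mats V m p \<Longrightarrow> y \<in> mats V m q \<Longrightarrow> hcat x y \<in> mats V m (p + q)"
  by (rule matsI) (auto simp: hcat_def mats_entry)

lemma vcat_mats: "x \<in> mats V p n \<Longrightarrow> y \<in> mats V q n \<Longrightarrow> vcat x y \<in> mats V (p + q) n"
  by (rule matsI) (auto simp: vcat_def mats_entry)

text \<open>If the row \<open>x\<close> and the column \<open>y\<close> factor a single tensor, then
  \<open>row_at\<close> and \<open>col_at\<close> factor the matrix that has this tensor at one
  position and zeros elsewhere.\<close>

definition row_at :: "('x, 'm) ring_scheme \<Rightarrow> nat \<Rightarrow> nat \<Rightarrow> 'x mat \<Rightarrow> 'x mat" where
  "row_at V m i x = mat m (dim_col x) (\<lambda>(k, j). if k = i then x $$ (0, j) else \<zero>\<^bsub>V\<^esub>)"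

definition col_at :: "('x, 'm) ring_scheme \<Rightarrow> nat \<Rightarrow> nat \<Rightarrow> 'x mat \<Rightarrow> 'x mat" where
  "col_at V n j y = mat (dim_row y) n (\<lambda>(i, k). if k = j then y $$ (i, 0) else \<zero>\<^bsub>V\<^esub>)"

context operator_space
begin

lemma smult_smult: "x \<in> carrier V \<Longrightarrow> c \<odot>\<^bsub>V\<^esub> (d \<odot>\<^bsub>V\<^esub> x) = (c * d) \<odot>\<^bsub>V\<^esub> x"
  using smult_assoc1[of c d x] by simp

lemma smult_1: "x \<in> carrier V \<Longrightarrow> 1 \<odot>\<^bsub>V\<^esub> x = x"
  using smult_one[of x] by simp

lemma smult_0: "x \<in> carrier V \<Longrightarrow> 0 \<odot>\<^bsub>V\<^esub> x = \<zero>"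
  using smult_l_null[of x] by simp

lemma smult_zero: "c \<odot>\<^bsub>V\<^esub> \<zero> = \<zero>"
  using smult_r_null[of c] by simp

lemma zero_mats: "mat m n (\<lambda>_. \<zero>) \<in> mats V m n"
  by (rule matsI) auto

text \<open>Nonnegativity is not among the axioms; it comes from \<open>0 = \<parallel>x + (-1)
  x\<parallel> \<le> 2 \<parallel>x\<parallel>\<close>.\<close>

lemma mnorm_nonneg:
  assumes "x \<in> mats V m n"
  shows "0 \<le> mnorm V x"
proof -
  let ?y = "map_mat (\<lambda>z. (-1) \<odot>\<^bsub>V\<^esub> z) x"
  have y: "?y \<in> mats V m n"
    using assms by (rule mats_map) simp
  have "z \<oplus> (-1) \<odot>\<^bsub>V\<^esub> z = \<zero>" if "z \<in> carrier V" for z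
    using smult_l_distr[of 1 "-1" z] that by (simp add: smult_1 smult_0)
  then have "mat_sum V x ?y = mat m n (\<lambda>_. \<zero>)"
    by (intro eq_matI) (auto simp: mat_sum_def mats_entry[OF assms] mats_dim[OF assms])
  then have "0 = mnorm V (mat_sum V x ?y)"
    using mnorm_eq_0[OF zero_mats] by simp
  also have "\<dots> \<le> mnorm V x + mnorm V x"
    using mnorm_triangle[OF assms y] mnorm_scale[OF assms, of "-1"] by simp
  finally show ?thesis by simp
qed

lemma mat_prod_left_carrier:
  assumes "x \<in> mats V p n" "\<alpha> \<in> carrier_mat m p"
  shows "mat_prod V (\<lambda>c z. c \<odot>\<^bsub>V\<^esub> z) \<alpha> x \<in> mats V m n"
  using assms by (intro matsI) (auto simp: mat_prod_def mats_entry intro!: finsum_closed)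

lemma mat_prod_one_left:
  assumes "x \<in> mats V m n"
  shows "mat_prod V (\<lambda>c z. c \<odot>\<^bsub>V\<^esub> z) (1\<^sub>m m) x = x"
proof (rule eq_matI)
  fix i j assume "i < dim_row x" "j < dim_col x"
  then have ij: "i < m" "j < n" using assms by auto
  have "finsum V (\<lambda>k. 1\<^sub>m m $$ (i, k) \<odot>\<^bsub>V\<^esub> x $$ (k, j)) {..<m} = 1\<^sub>m m $$ (i, i) \<odot>\<^bsub>V\<^esub> x $$ (i, j)"
    by (rule finsum_single) (use assms ij in \<open>auto simp: mats_entry smult_0\<close>)
  then show "mat_prod V (\<lambda>c z. c \<odot>\<^bsub>V\<^esub> z) (1\<^sub>m m) x $$ (i, j) = x $$ (i, j)"
    using assms ij by (simp add: mat_prod_def smult_1 mats_entry)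
qed (use assms in \<open>auto simp: mat_prod_def\<close>)

lemma mat_prod_one_right:
  assumes "x \<in> mats V m n"
  shows "mat_prod V (\<lambda>z d. d \<odot>\<^bsub>V\<^esub> z) x (1\<^sub>m n) = x"
proof (rule eq_matI)
  fix i j assume "i < dim_row x" "j < dim_col x"
  then have ij: "i < m" "j < n" using assms by auto
  have "finsum V (\<lambda>k. 1\<^sub>m n $$ (k, j) \<odot>\<^bsub>V\<^esub> x $$ (i, k)) {..<n} = 1\<^sub>m n $$ (j, j) \<odot>\<^bsub>V\<^esub> x $$ (i, j)"
    by (rule finsum_single) (use assms ij in \<open>auto simp: mats_entry smult_0\<close>)
  then show "mat_prod V (\<lambda>z d. d \<odot>\<^bsub>V\<^esub> z) x (1\<^sub>m n) $$ (i, j) = x $$ (i, j)"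
    using assms ij by (simp add: mat_prod_def smult_1 mats_entry)
qed (use assms in \<open>auto simp: mat_prod_def\<close>)

lemma mnorm_mult_left:
  assumes "x \<in> mats V p n" "\<alpha> \<in> carrier_mat m p"
  shows "mnorm V (mat_prod V (\<lambda>c z. c \<odot>\<^bsub>V\<^esub> z) \<alpha> x) \<le> cmat_norm \<alpha> * mnorm V x"
proof -
  have "mnorm V (mat_prod V (\<lambda>c z. c \<odot>\<^bsub>V\<^esub> z) \<alpha> x) \<le> cmat_norm \<alpha> * mnorm V x * cmat_norm (1\<^sub>m n)"
    using mnorm_mult[OF assms(2,1), of "1\<^sub>m n" n]
      mat_prod_one_right[OF mat_prod_left_carrier[OF assms]] by simp
  also have "\<dots> \<le> cmat_norm \<alpha> * mnorm V x * 1"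
    using cmat_norm_nonneg mnorm_nonneg[OF assms(1)] cmat_norm_one_le by (intro mult_left_mono) auto
  finally show ?thesis by simp
qed

lemma mnorm_mult_right:
  assumes "x \<in> mats V m p" "\<beta> \<in> carrier_mat p n"
  shows "mnorm V (mat_prod V (\<lambda>z d. d \<odot>\<^bsub>V\<^esub> z) x \<beta>) \<le> mnorm V x * cmat_norm \<beta>"
proof -
  have "mnorm V (mat_prod V (\<lambda>z d. d \<odot>\<^bsub>V\<^esub> z) x \<beta>) \<le> cmat_norm (1\<^sub>m m) * mnorm V x * cmat_norm \<beta>"
    using mnorm_mult[OF _ assms, of "1\<^sub>m m" m] mat_prod_one_left[OF assms(1)] by simp
  also have "\<dots> \<le> 1 * mnorm V x * cmat_norm \<beta>"
    using cmat_norm_nonneg mnorm_nonneg[OF assms(1)] cmat_norm_one_le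
    by (intro mult_right_mono) auto
  finally show ?thesis by simp
qed

lemma mat_diag_sum_mats:
  assumes "x \<in> mats V m n" "y \<in> mats V p q"
  shows "mat_diag_sum V x y \<in> mats V (m + p) (n + q)"
  using assms by (intro matsI) (auto simp: mat_diag_sum_def mats_entry mats_carrier)

lemma mnorm_diag_scaled:
  assumes x: "x \<in> mats V m n" and y: "y \<in> mats V p q"
    and "mnorm V x \<le> s" "mnorm V y \<le> t" and pos: "0 < s" "0 < t"
  shows "mnorm V (mat_diag_sum V (map_mat (\<lambda>z. of_real (1 / s) \<odot>\<^bsub>V\<^esub> z) x)
    (map_mat (\<lambda>z. of_real (1 / t) \<odot>\<^bsub>V\<^esub> z) y)) \<le> 1"
proof -
  have "map_mat (\<lambda>z. of_real (1 / s) \<odot>\<^bsub>V\<^esub> z) x \<in> mats V m n"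
    "map_mat (\<lambda>z. of_real (1 / t) \<odot>\<^bsub>V\<^esub> z) y \<in> mats V p q"
    using x y by (auto intro!: mats_map)
  from mnorm_diag_sum[OF this] show ?thesis
    unfolding mnorm_scale[OF x] mnorm_scale[OF y] using assms(3-6) by (simp add: norm_divide)
qed

text \<open>\<open>[x y]\<close> is \<open>[s 1, t 1]\<close> times the block diagonal matrix of
  \<open>x / s\<close> and \<open>y / t\<close>, which is a contraction. Bounds \<open>s\<close> and
  \<open>t\<close> replace the norms themselves because a norm may be 0 and could not be divided
  by.\<close>

lemma mnorm_hcat:
  assumes x: "x \<in> mats V m p" and y: "y \<in> mats V m q"
    and le: "mnorm V x \<le> s" "mnorm V y \<le> t" and pos: "0 < s" "0 < t"
  shows "mnorm V (hcat x y) \<le> sqrt (s\<^sup>2 + t\<^sup>2)"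
proof -
  let ?x = "map_mat (\<lambda>z. of_real (1 / s) \<odot>\<^bsub>V\<^esub> z) x" and ?y = "map_mat (\<lambda>z. of_real (1 / t) \<odot>\<^bsub>V\<^esub> z) y"
  define D where "D = mat_diag_sum V ?x ?y"
  have D: "D \<in> mats V (m + m) (p + q)"
    unfolding D_def using x y by (intro mat_diag_sum_mats) (auto intro!: mats_map)
  have "hcat x y = mat_prod V (\<lambda>c z. c \<odot>\<^bsub>V\<^esub> z) (row_pair m s t) D" (is "_ = ?P")
  proof (rule eq_matI)
    fix i j assume "i < dim_row ?P" "j < dim_col ?P"
    then have ij: "i < m" "j < p + q" using D by (auto simp: mat_prod_def)
    \<comment> \<open>The only summand that survives: row \<open>i\<close> of
      \<open>row_pair\<close> is nonzero at \<open>i\<close> and \<open>m + i\<close> only, and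
      column \<open>j\<close> of \<open>D\<close> vanishes in one of the two blocks of rows.\<close>
    let ?k = "if j < p then i else m + i"
    let ?g = "\<lambda>k. row_pair m s t $$ (i, k) \<odot>\<^bsub>V\<^esub> D $$ (k, j)"
    have Dg: "D $$ (k, j) = (if k < m then (if j < p then ?x $$ (k, j) else \<zero>)
        else if j < p then \<zero> else ?y $$ (k - m, j - p))" if "k < m + m" for k
      using that ij x y unfolding D_def mat_diag_sum_def by auto
    have "finsum V ?g {..<m + m} = ?g ?k"
    proof (rule finsum_single)
      show "?g ?k \<in> carrier V" using ij D by (auto simp: mats_entry)
      fix k assume k: "k \<in> {..<m + m}" "k \<noteq> ?k"
      then show "?g k = \<zero>"
        using Dg[of k] ij D mats_entry[OF D, of k j]
        by (auto simp: row_pair_def smult_zero smult_0 split: if_splits)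
    qed (use ij in auto)
    also have "\<dots> = hcat x y $$ (i, j)"
      using Dg[of ?k] ij x y pos by (auto simp: row_pair_def hcat_def smult_smult smult_1 mats_entry)
    finally show "hcat x y $$ (i, j) = ?P $$ (i, j)"
      using ij D by (simp add: mat_prod_def)
  qed (use x y D in \<open>auto simp: mat_prod_def hcat_def\<close>)
  then have "mnorm V (hcat x y) \<le> cmat_norm (row_pair m s t) * mnorm V D"
    using mnorm_mult_left[OF D, of "row_pair m s t" m] by simp
  also have "\<dots> \<le> sqrt (s\<^sup>2 + t\<^sup>2) * 1"
    using mnorm_diag_scaled[OF x y le pos] mnorm_nonneg[OF D] unfolding D_def[symmetric]
    by (intro mult_mono cmat_norm_row_pair) auto
  finally show ?thesis by simp
qed

text \<open>The transposed factorization, with the scalar block column on the right of the block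
  diagonal matrix.\<close>

lemma mnorm_vcat:
  assumes x: "x \<in> mats V p n" and y: "y \<in> mats V q n"
    and le: "mnorm V x \<le> s" "mnorm V y \<le> t" and pos: "0 < s" "0 < t"
  shows "mnorm V (vcat x y) \<le> sqrt (s\<^sup>2 + t\<^sup>2)"
proof -
  let ?x = "map_mat (\<lambda>z. of_real (1 / s) \<odot>\<^bsub>V\<^esub> z) x" and ?y = "map_mat (\<lambda>z. of_real (1 / t) \<odot>\<^bsub>V\<^esub> z) y"
  define D where "D = mat_diag_sum V ?x ?y"
  have D: "D \<in> mats V (p + q) (n + n)"
    unfolding D_def using x y by (intro mat_diag_sum_mats) (auto intro!: mats_map)
  have "vcat x y = mat_prod V (\<lambda>z d. d \<odot>\<^bsub>V\<^esub> z) D (col_pair n s t)" (is "_ = ?P")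
  proof (rule eq_matI)
    fix i j assume "i < dim_row ?P" "j < dim_col ?P"
    then have ij: "i < p + q" "j < n" using D by (auto simp: mat_prod_def)
    let ?k = "if i < p then j else n + j"
    let ?g = "\<lambda>k. col_pair n s t $$ (k, j) \<odot>\<^bsub>V\<^esub> D $$ (i, k)"
    have Dg: "D $$ (i, k) = (if i < p then (if k < n then ?x $$ (i, k) else \<zero>)
        else if k < n then \<zero> else ?y $$ (i - p, k - n))" if "k < n + n" for k
      using that ij x y unfolding D_def mat_diag_sum_def by auto
    have "finsum V ?g {..<n + n} = ?g ?k"
    proof (rule finsum_single)
      show "?g ?k \<in> carrier V" using ij D by (auto simp: mats_entry)
      fix k assume k: "k \<in> {..<n + n}" "k \<noteq> ?k"
      then show "?g k = \<zero>"
        using Dg[of k] ij D mats_entry[OF D, of i k]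
        by (auto simp: col_pair_def smult_zero smult_0 split: if_splits)
    qed (use ij in auto)
    also have "\<dots> = vcat x y $$ (i, j)"
      using Dg[of ?k] ij x y pos by (auto simp: col_pair_def vcat_def smult_smult smult_1 mats_entry)
    finally show "vcat x y $$ (i, j) = ?P $$ (i, j)"
      using ij D by (simp add: mat_prod_def)
  qed (use x y D in \<open>auto simp: mat_prod_def vcat_def\<close>)
  then have "mnorm V (vcat x y) \<le> mnorm V D * cmat_norm (col_pair n s t)"
    using mnorm_mult_right[OF D, of "col_pair n s t" n] by simp
  also have "\<dots> \<le> 1 * sqrt (s\<^sup>2 + t\<^sup>2)"
    using mnorm_diag_scaled[OF x y le pos] mnorm_nonneg[OF D] unfolding D_def[symmetric]
    by (intro mult_mono cmat_norm_col_pair) (auto simp: cmat_norm_nonneg)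
  finally show ?thesis by simp
qed

lemma row_at_mats: "x \<in> mats V 1 p \<Longrightarrow> row_at V m i x \<in> mats V m p"
  by (rule matsI) (auto simp: row_at_def mats_entry)

lemma col_at_mats: "y \<in> mats V p 1 \<Longrightarrow> col_at V n j y \<in> mats V p n"
  by (rule matsI) (auto simp: col_at_def mats_entry)

text \<open>The padding is multiplication from the left by a column with a single entry 1, whose
  norm is at most the sum of its moduli.\<close>

lemma mnorm_row_at:
  assumes x: "x \<in> mats V 1 p" and i: "i < m"
  shows "mnorm V (row_at V m i x) \<le> mnorm V x"
proof -
  let ?e = "mat m 1 (\<lambda>(k, _). if k = i then 1 else 0) :: complex mat"
  have "row_at V m i x = mat_prod V (\<lambda>c z. c \<odot>\<^bsub>V\<^esub> z) ?e x"
    using x by (intro eq_matI)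
      (auto simp: row_at_def mat_prod_def finsum_insert mats_entry smult_1 smult_0 lessThan_Suc)
  then have "mnorm V (row_at V m i x) \<le> cmat_norm ?e * mnorm V x"
    using mnorm_mult_left[OF x, of ?e m] by simp
  also have "\<dots> \<le> 1 * mnorm V x"
    using cmat_norm_le_sum[of ?e] i mnorm_nonneg[OF x]
    by (intro mult_right_mono) (auto simp: if_distrib[of cmod] cong: if_cong)
  finally show ?thesis by simp
qed

lemma mnorm_col_at:
  assumes y: "y \<in> mats V p 1" and j: "j < n"
  shows "mnorm V (col_at V n j y) \<le> mnorm V y"
proof -
  let ?e = "mat 1 n (\<lambda>(_, k). if k = j then 1 else 0) :: complex mat"
  have "col_at V n j y = mat_prod V (\<lambda>z d. d \<odot>\<^bsub>V\<^esub> z) y ?e"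
    using y by (intro eq_matI)
      (auto simp: col_at_def mat_prod_def finsum_insert mats_entry smult_1 smult_0 lessThan_Suc)
  then have "mnorm V (col_at V n j y) \<le> mnorm V y * cmat_norm ?e"
    using mnorm_mult_right[OF y, of ?e n] by simp
  also have "\<dots> \<le> mnorm V y * 1"
    using cmat_norm_le_sum[of ?e] j mnorm_nonneg[OF y]
    by (intro mult_left_mono) (auto simp: if_distrib[of cmod] cong: if_cong)
  finally show ?thesis by simp
qed

end

section \<open>The Haagerup seminorm\<close>

lemma lookup_formal_scale: "Poly_Mapping.lookup (formal_scale c u) k = c * Poly_Mapping.lookup u k"
  by (simp add: formal_scale_def Poly_Mapping.map.rep_eq when_def)

interpretation formal: Modules.module formal_scale
  by standard (auto intro!: poly_mapping_eqI simp: lookup_formal_scale lookup_add algebra_simps)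

lemma formal_elem_mem:
  "x \<in> carrier X \<Longrightarrow> y \<in> carrier Y \<Longrightarrow> formal_elem x y \<in> formal_tensors X Y"
  by (auto simp: formal_elem_def formal_tensors_def)

lemma formal_subspace: "formal.subspace (formal_tensors X Y)"
proof (rule formal.subspaceI)
  fix u v assume "u \<in> formal_tensors X Y" "v \<in> formal_tensors X Y"
  then show "u + v \<in> formal_tensors X Y"
    using Poly_Mapping.keys_add[of u v] unfolding formal_tensors_def by blast
next
  fix c u assume "u \<in> formal_tensors X Y"
  moreover have "Poly_Mapping.keys (formal_scale c u) \<subseteq> Poly_Mapping.keys u"
    by (auto simp: in_keys_iff lookup_formal_scale)
  ultimately show "formal_scale c u \<in> formal_tensors X Y"
    unfolding formal_tensors_def by blast
qed (simp add: formal_tensors_def)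

lemma formal_scale_single: "formal_scale c (formal_elem x y) = Poly_Mapping.single (x, y) c"
  by (rule poly_mapping_eqI) (auto simp: lookup_formal_scale formal_elem_def lookup_single when_def)

lemma formal_tensors_induct [consumes 1, case_names zero add]:
  assumes "u \<in> formal_tensors X Y" "P 0"
    and step: "\<And>u c x y. P u \<Longrightarrow> u \<in> formal_tensors X Y \<Longrightarrow> x \<in> carrier X \<Longrightarrow> y \<in> carrier Y \<Longrightarrow>
      P (formal_scale c (formal_elem x y) + u)"
  shows "P u"
proof -
  have "P (\<Sum>k\<in>S. Poly_Mapping.single k (Poly_Mapping.lookup u k)) \<and>
      (\<Sum>k\<in>S. Poly_Mapping.single k (Poly_Mapping.lookup u k)) \<in> formal_tensors X Y"
    if "finite S" "S \<subseteq> carrier X \<times> carrier Y" for S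
    using that
  proof (induction S rule: finite_induct)
    case empty
    then show ?case using assms(2) formal.subspace_0[OF formal_subspace] by simp
  next
    case (insert k S)
    obtain x y where k: "k = (x, y)" "x \<in> carrier X" "y \<in> carrier Y" using insert by auto
    have "Poly_Mapping.single k (Poly_Mapping.lookup u k)
        = formal_scale (Poly_Mapping.lookup u k) (formal_elem x y)"
      unfolding formal_scale_single k(1) ..
    moreover have "formal_scale (Poly_Mapping.lookup u k) (formal_elem x y) \<in> formal_tensors X Y"
      using k by (intro formal.subspace_scale[OF formal_subspace] formal_elem_mem)
    ultimately show ?case
      using insert k by (auto intro!: step formal.subspace_add[OF formal_subspace])
  qed
  moreover have "u = (\<Sum>k\<in>Poly_Mapping.keys u. Poly_Mapping.single k (Poly_Mapping.lookup u k))"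
    by (rule poly_mapping_eqI)
      (simp add: lookup_sum lookup_single when_def in_keys_iff sum.delta)
  ultimately show ?thesis
    using assms(1) unfolding formal_tensors_def by (metis finite_keys mem_Collect_eq)
qed

lemma relations_subspace: "formal.subspace (tensor_relations X Y)"
  unfolding tensor_relations_def by (rule formal.subspace_span)

lemma relation_smult_left:
  "x \<in> carrier X \<Longrightarrow> y \<in> carrier Y \<Longrightarrow>
    formal_elem (c \<odot>\<^bsub>X\<^esub> x) y - formal_scale c (formal_elem x y) \<in> tensor_relations X Y"
  unfolding tensor_relations_def by (rule formal.span_base) blast

lemma relation_smult_right:
  "x \<in> carrier X \<Longrightarrow> y \<in> carrier Y \<Longrightarrow>
    formal_elem x (c \<odot>\<^bsub>Y\<^esub> y) - formal_scale c (formal_elem x y) \<in> tensor_relations X Y"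
  unfolding tensor_relations_def by (rule formal.span_base) blast

text \<open>One of the factorizations \<open>U = x \<odot> y\<close> over which the Haagerup infimum
  runs. The inner dimension is read off from \<open>x\<close>, so that it need not be carried along
  as a further argument.\<close>

definition tensor_rep ::
    "('x, 'm) opspace_scheme \<Rightarrow> ('y, 'n) opspace_scheme \<Rightarrow> ('x, 'y) formal_tensor mat \<Rightarrow> 'x mat \<Rightarrow> 'y mat \<Rightarrow> bool"
  where "tensor_rep X Y U x y \<longleftrightarrow>
    (\<exists>p. x \<in> mats X (dim_row U) p \<and> y \<in> mats Y p (dim_col U)) \<and>
    (\<forall>i<dim_row U. \<forall>j<dim_col U.
       U $$ (i, j) - (\<Sum>k<dim_col x. formal_elem (x $$ (i, k)) (y $$ (k, j))) \<in> tensor_relations X Y)"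

lemma tensor_rep_alt:
  "tensor_rep X Y U x y \<longleftrightarrow> (\<exists>p. x \<in> mats X (dim_row U) p \<and> y \<in> mats Y p (dim_col U) \<and>
    (\<forall>i<dim_row U. \<forall>j<dim_col U.
       U $$ (i, j) - (\<Sum>k<p. formal_elem (x $$ (i, k)) (y $$ (k, j))) \<in> tensor_relations X Y))"
  unfolding tensor_rep_def ex_simps(1)[symmetric] conj_assoc
  by (intro ex_cong1 conj_cong refl) simp

lemma haagerup_alt:
  "haagerup_seminorm X Y U = Inf {mnorm X x * mnorm Y y | x y. tensor_rep X Y U x y}"
  unfolding haagerup_seminorm_def tensor_rep_alt ex_simps(6)[symmetric]
  by (rule arg_cong[of _ _ Inf]) blast

locale operator_space_pair = X: operator_space X + Y: operator_space Y
  for X :: "('x, 'm) opspace_scheme" and Y :: "('y, 'n) opspace_scheme"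
begin

abbreviation "haag \<equiv> haagerup_seminorm X Y"
abbreviation "rep \<equiv> tensor_rep X Y"

lemma rep_nonneg: "rep U x y \<Longrightarrow> 0 \<le> mnorm X x * mnorm Y y"
  unfolding tensor_rep_def by (auto intro: mult_nonneg_nonneg X.mnorm_nonneg Y.mnorm_nonneg)

lemma haag_le: "rep U x y \<Longrightarrow> haag U \<le> mnorm X x * mnorm Y y"
  unfolding haagerup_alt by (rule cInf_lower) (auto intro!: bdd_belowI[of _ 0] rep_nonneg)

text \<open>A factorization must be supplied here and in the following bounds, because the infimum
  of an empty set of reals has no meaningful value.\<close>

lemma haag_nonneg: "rep U x y \<Longrightarrow> 0 \<le> haag U"
  unfolding haagerup_alt by (rule cInf_greatest) (auto intro: rep_nonneg)

lemma le_haag: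
  assumes "rep U x0 y0" "\<And>x y. rep U x y \<Longrightarrow> c \<le> mnorm X x * mnorm Y y"
  shows "c \<le> haag U"
  unfolding haagerup_alt by (rule cInf_greatest) (use assms in auto)

lemma haag_less:
  assumes "rep U x0 y0" "haag U < r"
  obtains x y where "rep U x y" "mnorm X x * mnorm Y y < r"
  using le_haag[OF assms(1), of r] assms(2) by (meson not_le)

text \<open>Moving a scalar across the tensor sign changes the formal tensor only by an element of
  \<open>tensor_relations\<close>. This freedom is what allows the norms of the two factors to be
  balanced.\<close>

lemma rep_scaleR:
  assumes "rep U x y" "s \<noteq> 0"
  shows "rep U (map_mat (\<lambda>z. s \<odot>\<^bsub>X\<^esub> z) x) (map_mat (\<lambda>z. inverse s \<odot>\<^bsub>Y\<^esub> z) y)" (is "rep U ?x ?y")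
proof -
  obtain p where xy: "x \<in> mats X (dim_row U) p" "y \<in> mats Y p (dim_col U)"
    using assms unfolding tensor_rep_def by auto
  have rel: "formal_elem a b - formal_elem (s \<odot>\<^bsub>X\<^esub> a) (inverse s \<odot>\<^bsub>Y\<^esub> b) \<in> tensor_relations X Y"
    if ab: "a \<in> carrier X" "b \<in> carrier Y" for a b
  proof -
    let ?r = "formal_elem (s \<odot>\<^bsub>X\<^esub> a) (inverse s \<odot>\<^bsub>Y\<^esub> b) - formal_scale s (formal_elem a (inverse s \<odot>\<^bsub>Y\<^esub> b))"
    let ?q = "formal_elem a (inverse s \<odot>\<^bsub>Y\<^esub> b) - formal_scale (inverse s) (formal_elem a b)"
    have "formal_scale s ?q = formal_scale s (formal_elem a (inverse s \<odot>\<^bsub>Y\<^esub> b)) - formal_elem a b"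
      using assms(2) by (simp add: formal.scale_right_diff_distrib)
    then have "formal_elem a b - formal_elem (s \<odot>\<^bsub>X\<^esub> a) (inverse s \<odot>\<^bsub>Y\<^esub> b)
        = - (?r + formal_scale s ?q)"
      by simp
    moreover have "?r \<in> tensor_relations X Y" "?q \<in> tensor_relations X Y"
      using ab by (auto intro!: relation_smult_left relation_smult_right)
    ultimately show ?thesis
      by (metis formal.subspace_add formal.subspace_neg formal.subspace_scale relations_subspace)
  qed
  have "U $$ (i, j) - (\<Sum>k<dim_col ?x. formal_elem (?x $$ (i, k)) (?y $$ (k, j))) \<in> tensor_relations X Y"
    if ij: "i < dim_row U" "j < dim_col U" for i j
  proof -
    have "U $$ (i, j) - (\<Sum>k<dim_col ?x. formal_elem (?x $$ (i, k)) (?y $$ (k, j)))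
      = (U $$ (i, j) - (\<Sum>k<p. formal_elem (x $$ (i, k)) (y $$ (k, j))))
        + (\<Sum>k<p. formal_elem (x $$ (i, k)) (y $$ (k, j))
             - formal_elem (s \<odot>\<^bsub>X\<^esub> x $$ (i, k)) (inverse s \<odot>\<^bsub>Y\<^esub> y $$ (k, j)))"
      using xy ij by (simp add: sum_subtractf mats_carrier)
    moreover have "U $$ (i, j) - (\<Sum>k<p. formal_elem (x $$ (i, k)) (y $$ (k, j))) \<in> tensor_relations X Y"
      using assms(1) ij xy unfolding tensor_rep_def by auto
    moreover have "(\<Sum>k<p. formal_elem (x $$ (i, k)) (y $$ (k, j))
        - formal_elem (s \<odot>\<^bsub>X\<^esub> x $$ (i, k)) (inverse s \<odot>\<^bsub>Y\<^esub> y $$ (k, j))) \<in> tensor_relations X Y"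
      using xy ij by (intro formal.subspace_sum[OF relations_subspace] rel) (auto intro: mats_entry)
    ultimately show ?thesis
      by (simp only: formal.subspace_add[OF relations_subspace])
  qed
  moreover have "?x \<in> mats X (dim_row U) p" "?y \<in> mats Y p (dim_col U)"
    using xy by (auto intro!: mats_map)
  ultimately show ?thesis unfolding tensor_rep_def by blast
qed

text \<open>Needed for the triangle inequality: block rows and columns add squares of norms, so the
  product bound for a sum becomes additive only when both factors are at most
  \<open>sqrt r\<close>.\<close>

lemma rep_balanced:
  assumes "rep U x y" "mnorm X x * mnorm Y y < r"
  obtains x' y' where "rep U x' y'" "mnorm X x' \<le> sqrt r" "mnorm Y y' \<le> sqrt r"
proof -
  obtain p where xy: "x \<in> mats X (dim_row U) p" "y \<in> mats Y p (dim_col U)"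
    using assms unfolding tensor_rep_def by auto
  let ?a = "mnorm X x" and ?b = "mnorm Y y"
  have a: "0 \<le> ?a" and b: "0 \<le> ?b"
    using X.mnorm_nonneg[OF xy(1)] Y.mnorm_nonneg[OF xy(2)] by auto
  have r: "r > 0" using assms(2) a b by (meson le_less_trans mult_nonneg_nonneg)
  \<comment> \<open>\<open>a'\<close> replaces \<open>?a\<close> as divisor in the scaling factor:
    it is positive even if \<open>?a = 0\<close>, and the slack \<open>r - ?a * ?b\<close>, divided
    by \<open>?b + 1\<close>, is small enough to keep \<open>a' * ?b \<le> r\<close>.\<close>
  define a' where "a' = ?a + (r - ?a * ?b) / (?b + 1)"
  have a': "?a < a'" "a' * ?b \<le> r"
  proof -
    show "?a < a'" unfolding a'_def using assms(2) b by simp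
    have "(r - ?a * ?b) * (?b / (?b + 1)) \<le> (r - ?a * ?b) * 1"
      using assms(2) b by (intro mult_left_mono) auto
    then show "a' * ?b \<le> r" unfolding a'_def by (simp add: algebra_simps)
  qed
  then have pos: "0 < a'" using a by simp
  define s where "s = sqrt r / a'"
  have s: "s > 0" unfolding s_def using r pos by simp
  have "s * ?a \<le> s * a'" using a' s by simp
  then have 1: "s * ?a \<le> sqrt r" unfolding s_def using pos by simp
  have "?b / s = a' * ?b / sqrt r" unfolding s_def by simp
  also have "\<dots> \<le> r / sqrt r" using a' r by (intro divide_right_mono) auto
  also have "\<dots> = sqrt r" using r by (simp add: real_div_sqrt)
  finally have 2: "?b / s \<le> sqrt r" .
  show thesis
  proof
    show "rep U (map_mat (\<lambda>z. of_real s \<odot>\<^bsub>X\<^esub> z) x) (map_mat (\<lambda>z. inverse (of_real s) \<odot>\<^bsub>Y\<^esub> z) y)"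
      using assms(1) s by (intro rep_scaleR) auto
    show "mnorm X (map_mat (\<lambda>z. of_real s \<odot>\<^bsub>X\<^esub> z) x) \<le> sqrt r"
      using X.mnorm_scale[OF xy(1)] 1 s by simp
    show "mnorm Y (map_mat (\<lambda>z. inverse (of_real s) \<odot>\<^bsub>Y\<^esub> z) y) \<le> sqrt r"
      using Y.mnorm_scale[OF xy(2)] 2 s by (simp add: norm_inverse norm_divide divide_inverse mult.commute)
  qed
qed

text \<open>The block identity
  \<open>[x x'] \<odot> [y; y'] = x \<odot> y + x' \<odot> y'\<close>.\<close>

lemma rep_add:
  assumes "rep U x y" "rep U' x' y'" and dim: "U \<in> carrier_mat m n" "U' \<in> carrier_mat m n"
  shows "rep (U + U') (hcat x x') (vcat y y')"
proof -
  obtain p where xy: "x \<in> mats X m p" "y \<in> mats Y p n"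
    using assms unfolding tensor_rep_def by auto
  obtain p' where xy': "x' \<in> mats X m p'" "y' \<in> mats Y p' n"
    using assms unfolding tensor_rep_def by auto
  have "(U + U') $$ (i, j) - (\<Sum>k<dim_col (hcat x x'). formal_elem (hcat x x' $$ (i, k)) (vcat y y' $$ (k, j)))
      \<in> tensor_relations X Y" if ij: "i < m" "j < n" for i j
  proof -
    have "(U + U') $$ (i, j) - (\<Sum>k<dim_col (hcat x x'). formal_elem (hcat x x' $$ (i, k)) (vcat y y' $$ (k, j)))
      = (U $$ (i, j) - (\<Sum>k<p. formal_elem (x $$ (i, k)) (y $$ (k, j))))
      + (U' $$ (i, j) - (\<Sum>k<p'. formal_elem (x' $$ (i, k)) (y' $$ (k, j))))"
      using ij dim xy xy' by (simp add: hcat_def vcat_def sum_lessThan_add)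
    moreover have "U $$ (i, j) - (\<Sum>k<p. formal_elem (x $$ (i, k)) (y $$ (k, j))) \<in> tensor_relations X Y"
      "U' $$ (i, j) - (\<Sum>k<p'. formal_elem (x' $$ (i, k)) (y' $$ (k, j))) \<in> tensor_relations X Y"
      using ij dim xy xy' assms(1,2) unfolding tensor_rep_def by auto
    ultimately show ?thesis
      by (simp only: formal.subspace_add[OF relations_subspace])
  qed
  then show ?thesis
    using hcat_mats[OF xy(1) xy'(1)] vcat_mats[OF xy(2) xy'(2)] dim unfolding tensor_rep_def by auto
qed

text \<open>With factorizations balanced to \<open>sqrt r\<close> and \<open>sqrt r'\<close>, the
  block row and the block column are both bounded by \<open>sqrt (r + r')\<close>, and their product
  is \<open>r + r'\<close>, which exceeds the sum of the seminorms by \<open>e\<close>.\<close>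

lemma haag_add:
  assumes U: "rep U x y" and U': "rep U' x' y'" and dim: "U \<in> carrier_mat m n" "U' \<in> carrier_mat m n"
  shows "haag (U + U') \<le> haag U + haag U'"
proof (rule field_le_epsilon)
  fix e :: real assume e: "0 < e"
  define r r' where "r = haag U + e / 2" and "r' = haag U' + e / 2"
  obtain x1 y1 where 1: "rep U x1 y1" "mnorm X x1 \<le> sqrt r" "mnorm Y y1 \<le> sqrt r"
    using haag_less[OF U, of r] rep_balanced[of U _ _ r] e unfolding r_def by (metis half_gt_zero less_add_same_cancel1)
  obtain x2 y2 where 2: "rep U' x2 y2" "mnorm X x2 \<le> sqrt r'" "mnorm Y y2 \<le> sqrt r'"
    using haag_less[OF U', of r'] rep_balanced[of U' _ _ r'] e unfolding r'_def by (metis half_gt_zero less_add_same_cancel1)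
  have pos: "0 < r" "0 < r'" unfolding r_def r'_def using haag_nonneg[OF U] haag_nonneg[OF U'] e by auto
  obtain p where xy: "x1 \<in> mats X m p" "y1 \<in> mats Y p n"
    using 1 dim unfolding tensor_rep_def by auto
  obtain p' where xy': "x2 \<in> mats X m p'" "y2 \<in> mats Y p' n"
    using 2 dim unfolding tensor_rep_def by auto
  have h: "mnorm X (hcat x1 x2) \<le> sqrt (r + r')"
    using X.mnorm_hcat[OF xy(1) xy'(1) 1(2) 2(2)] pos by simp
  have v: "mnorm Y (vcat y1 y2) \<le> sqrt (r + r')"
    using Y.mnorm_vcat[OF xy(2) xy'(2) 1(3) 2(3)] pos by simp
  have "haag (U + U') \<le> mnorm X (hcat x1 x2) * mnorm Y (vcat y1 y2)"
    by (rule haag_le[OF rep_add[OF 1(1) 2(1) dim]])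
  also have "\<dots> \<le> sqrt (r + r') * sqrt (r + r')"
    using h v Y.mnorm_nonneg[OF vcat_mats[OF xy(2) xy'(2)]] pos by (intro mult_mono) auto
  also have "\<dots> = haag U + haag U' + e" using pos by (simp add: r_def r'_def)
  finally show "haag (U + U') \<le> haag U + haag U' + e" .
qed

lemma rep_scale:
  assumes "rep U x y"
  shows "rep (map_mat (formal_scale c) U) (map_mat (\<lambda>z. c \<odot>\<^bsub>X\<^esub> z) x) y" (is "rep ?U ?x y")
proof -
  obtain p where xy: "x \<in> mats X (dim_row U) p" "y \<in> mats Y p (dim_col U)"
    using assms unfolding tensor_rep_def by auto
  have "?U $$ (i, j) - (\<Sum>k<dim_col ?x. formal_elem (?x $$ (i, k)) (y $$ (k, j))) \<in> tensor_relations X Y"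
    if ij: "i < dim_row U" "j < dim_col U" for i j
  proof -
    have "?U $$ (i, j) - (\<Sum>k<dim_col ?x. formal_elem (?x $$ (i, k)) (y $$ (k, j)))
      = formal_scale c (U $$ (i, j) - (\<Sum>k<p. formal_elem (x $$ (i, k)) (y $$ (k, j))))
        - (\<Sum>k<p. formal_elem (c \<odot>\<^bsub>X\<^esub> x $$ (i, k)) (y $$ (k, j))
            - formal_scale c (formal_elem (x $$ (i, k)) (y $$ (k, j))))"
      using xy ij by (simp add: sum_subtractf mats_carrier formal.scale_right_diff_distrib formal.scale_sum_right)
    moreover have "U $$ (i, j) - (\<Sum>k<p. formal_elem (x $$ (i, k)) (y $$ (k, j))) \<in> tensor_relations X Y"
      using assms(1) ij xy unfolding tensor_rep_def by auto
    ultimately show ?thesis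
      using xy ij by (auto intro!: formal.subspace_diff[OF relations_subspace]
          formal.subspace_scale[OF relations_subspace]
          formal.subspace_sum[OF relations_subspace] relation_smult_left simp: mats_entry)
  qed
  moreover have "?x \<in> mats X (dim_row U) p"
    using xy by (auto intro!: mats_map)
  ultimately show ?thesis using xy unfolding tensor_rep_def by auto
qed

lemma haag_scale_le:
  assumes "rep U x y"
  shows "haag (map_mat (formal_scale c) U) \<le> cmod c * haag U"
proof (cases "c = 0")
  case True
  obtain p where "x \<in> mats X (dim_row U) p"
    using assms unfolding tensor_rep_def by auto
  then show ?thesis
    using haag_le[OF rep_scale[OF assms, of c]] X.mnorm_scale[of x "dim_row U" p c] True by simp
next
  case False
  have "haag (map_mat (formal_scale c) U) / cmod c \<le> haag U"
  proof (rule le_haag[OF assms])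
    fix x y assume r: "rep U x y"
    then obtain p where "x \<in> mats X (dim_row U) p" unfolding tensor_rep_def by auto
    then show "haag (map_mat (formal_scale c) U) / cmod c \<le> mnorm X x * mnorm Y y"
      using haag_le[OF rep_scale[OF r, of c]] X.mnorm_scale[of x "dim_row U" p c] False
      by (simp add: field_simps)
  qed
  then show ?thesis using False by (simp add: field_simps)
qed

text \<open>Inner dimension 0: the sum is empty, and since the factors have no entries,
  \<open>undefined\<close> is harmless.\<close>

lemma rep_zero: "rep (mat m n (\<lambda>_. 0)) (mat m 0 (\<lambda>_. undefined)) (mat 0 n (\<lambda>_. undefined))"
  unfolding tensor_rep_def
  by (auto intro!: exI[of _ 0] matsI formal.subspace_0[OF relations_subspace])

lemma haag_zero: "haag (mat m n (\<lambda>_. 0)) = 0"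
proof -
  have "mnorm X (mat m 0 (\<lambda>_. undefined)) = 0"
    by (subst X.mnorm_eq_0[of _ m 0]) (auto intro!: matsI eq_matI)
  then show ?thesis using haag_le[OF rep_zero[of m n]] haag_nonneg[OF rep_zero[of m n]] by simp
qed

lemma elem_zero_left: "y \<in> carrier Y \<Longrightarrow> formal_elem \<zero>\<^bsub>X\<^esub> y \<in> tensor_relations X Y"
  using relation_smult_left[OF X.zero_closed, of y Y 0] by (simp add: X.smult_zero)

lemma elem_zero_right: "x \<in> carrier X \<Longrightarrow> formal_elem x \<zero>\<^bsub>Y\<^esub> \<in> tensor_relations X Y"
  using relation_smult_right[OF _ Y.zero_closed, of x X 0] by (simp add: Y.smult_zero)

lemma rep_elem: "x \<in> carrier X \<Longrightarrow> y \<in> carrier Y \<Longrightarrow> rep (mat1 (formal_elem x y)) (mat1 x) (mat1 y)"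
  unfolding tensor_rep_def using mat1_mats[of x X] mat1_mats[of y Y]
  by (auto intro!: formal.subspace_0[OF relations_subspace])

lemma rep_mat1_exists:
  assumes "u \<in> formal_tensors X Y"
  shows "\<exists>x y. rep (mat1 u) x y"
  using assms
proof (induction rule: formal_tensors_induct)
  case zero
  then show ?case using rep_zero[of 1 1] by (auto simp: mat1_def)
next
  case (add u c x y)
  have "mat1 (formal_scale c (formal_elem x y) + u) = map_mat (formal_scale c) (mat1 (formal_elem x y)) + mat1 u"
    by (rule eq_matI) (auto simp: mat1_def)
  then show ?case
    using add rep_add[OF rep_scale[OF rep_elem], of x y _ _ _ c 1 1] by fastforce
qed

text \<open>At every other position each summand has a zero in its left or in its right factor, and
  such elementary tensors are relations.\<close>

lemma rep_at:
  assumes "rep (mat1 u) x y" "i < m" "j < n"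
  shows "rep (mat m n (\<lambda>p. if p = (i, j) then u else 0)) (row_at X m i x) (col_at Y n j y)"
    (is "rep ?U ?x ?y")
proof -
  obtain p where xy: "x \<in> mats X 1 p" "y \<in> mats Y p 1"
    using assms unfolding tensor_rep_def by auto
  have "?U $$ (k, l) - (\<Sum>q<dim_col ?x. formal_elem (?x $$ (k, q)) (?y $$ (q, l))) \<in> tensor_relations X Y"
    if kl: "k < m" "l < n" for k l
  proof (cases "k = i \<and> l = j")
    case True
    then show ?thesis using assms xy kl unfolding tensor_rep_def by (auto simp: row_at_def col_at_def)
  next
    case False
    have "(\<Sum>q<p. formal_elem (?x $$ (k, q)) (?y $$ (q, l))) \<in> tensor_relations X Y"
      using False xy kl
      by (intro formal.subspace_sum[OF relations_subspace])
        (auto simp: row_at_def col_at_def mats_entry intro!: elem_zero_left elem_zero_right)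
    then have "0 - (\<Sum>q<p. formal_elem (?x $$ (k, q)) (?y $$ (q, l))) \<in> tensor_relations X Y"
      by (intro formal.subspace_diff[OF relations_subspace] formal.subspace_0[OF relations_subspace])
    then show ?thesis using False xy kl by (auto simp: row_at_def)
  qed
  then show ?thesis
    using X.row_at_mats[OF xy(1)] Y.col_at_mats[OF xy(2)] unfolding tensor_rep_def
    by (auto intro!: exI[of _ p])
qed

lemma haag_at_le:
  assumes "rep (mat1 u) x y" "i < m" "j < n"
  shows "haag (mat m n (\<lambda>p. if p = (i, j) then u else 0)) \<le> haag (mat1 u)"
proof (rule le_haag[OF assms(1)])
  fix x y assume r: "rep (mat1 u) x y"
  then obtain p where xy: "x \<in> mats X 1 p" "y \<in> mats Y p 1"
    unfolding tensor_rep_def by auto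
  show "haag (mat m n (\<lambda>p. if p = (i, j) then u else 0)) \<le> mnorm X x * mnorm Y y"
    using haag_le[OF rep_at[OF r assms(2,3)]]
      mult_mono[OF X.mnorm_row_at[OF xy(1) assms(2)] Y.mnorm_col_at[OF xy(2) assms(3)]]
      X.mnorm_nonneg[OF xy(1)] Y.mnorm_nonneg[OF Y.col_at_mats[OF xy(2)]] by fastforce
qed

text \<open>The matrix is filled in one position at a time, \<open>S\<close> being the set of filled
  positions. Existence of a factorization and the bound by entries are proved together, since the
  triangle inequality for the bound already needs the factorizations.\<close>

lemma rep_restrict:
  assumes "finite S" "S \<subseteq> {..<m} \<times> {..<n}" and "\<And>p. p \<in> S \<Longrightarrow> u p \<in> formal_tensors X Y"
  shows "(\<exists>x y. rep (mat m n (\<lambda>p. if p \<in> S then u p else 0)) x y) \<and>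
    haag (mat m n (\<lambda>p. if p \<in> S then u p else 0)) \<le> (\<Sum>p\<in>S. haag (mat1 (u p)))"
  using assms
proof (induction S rule: finite_induct)
  case empty
  then show ?case using rep_zero haag_zero by auto
next
  case (insert q S)
  let ?S = "mat m n (\<lambda>p. if p \<in> S then u p else 0)"
  let ?q = "mat m n (\<lambda>p. if p = (fst q, snd q) then u q else 0)"
  have q: "fst q < m" "snd q < n" using insert by auto
  obtain x y where 1: "rep (mat1 (u q)) x y" using rep_mat1_exists[of "u q"] insert by auto
  obtain x' y' where 2: "rep ?S x' y'" "haag ?S \<le> (\<Sum>p\<in>S. haag (mat1 (u p)))" using insert by auto
  have eq: "mat m n (\<lambda>p. if p \<in> insert q S then u p else 0) = ?q + ?S"
    using insert(2) by (intro eq_matI) auto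
  note r = rep_at[OF 1 q]
  have "haag (?q + ?S) \<le> haag (mat1 (u q)) + (\<Sum>p\<in>S. haag (mat1 (u p)))"
    using haag_add[OF r 2(1), of m n] haag_at_le[OF 1 q] 2(2) by simp
  moreover have "\<exists>x y. rep (?q + ?S) x y" using rep_add[OF r 2(1), of m n] by auto
  ultimately show ?case unfolding eq using insert by simp
qed

lemma
  assumes "U \<in> carrier_mat m n" "elements_mat U \<subseteq> formal_tensors X Y"
  shows rep_exists: "\<exists>x y. rep U x y"
    and haag_le_sum: "haag U \<le> (\<Sum>p\<in>{..<m} \<times> {..<n}. haag (mat1 (U $$ p)))"
proof -
  have eq: "mat m n (\<lambda>p. if p \<in> {..<m} \<times> {..<n} then U $$ p else 0) = U"
    using assms by (intro eq_matI) auto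
  have "U $$ p \<in> formal_tensors X Y" if "p \<in> {..<m} \<times> {..<n}" for p
    using assms that elements_matI[OF assms(1)] by (cases p) auto
  from rep_restrict[of "{..<m} \<times> {..<n}" m n "($$) U", OF _ _ this, unfolded eq]
  show "\<exists>x y. rep U x y" "haag U \<le> (\<Sum>p\<in>{..<m} \<times> {..<n}. haag (mat1 (U $$ p)))" by auto
qed

end

section \<open>Matrices of continuous functions\<close>

lemma cmat_norm_eval_le_sum:
  "cmat_norm (map_mat (\<lambda>f. apply_bcontfun f w) F) \<le> (\<Sum>i<dim_row F. \<Sum>j<dim_col F. norm (F $$ (i, j)))"
  by (rule order_trans[OF cmat_norm_le_sum]) (auto intro!: sum_mono norm_bounded)

lemma function_mnorm_upper:
  "cmat_norm (map_mat (\<lambda>f. apply_bcontfun f w) F) \<le> function_mnorm F"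
  unfolding function_mnorm_def
  by (rule cSUP_upper) (auto intro!: bdd_aboveI2 cmat_norm_eval_le_sum)

lemma function_mnorm_least:
  "(\<And>w. cmat_norm (map_mat (\<lambda>f. apply_bcontfun f w) F) \<le> c) \<Longrightarrow> function_mnorm F \<le> c"
  unfolding function_mnorm_def by (rule cSUP_least) auto

lemma function_mnorm_nonneg: "0 \<le> function_mnorm F"
  using function_mnorm_upper cmat_norm_nonneg order_trans by blast

lemma cmat_norm_mat1: "cmat_norm (mat1 c) = cmod c"
  by (simp only: mat1_def cmat_norm_1x1)

lemma function_mnorm_mat1: "function_mnorm (mat1 f) = norm f"
proof (rule antisym)
  show "function_mnorm (mat1 f) \<le> norm f"
    by (rule function_mnorm_least) (simp add: cmat_norm_mat1 norm_bounded)
  show "norm f \<le> function_mnorm (mat1 f)"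
  proof (rule norm_bound)
    fix w show "norm (apply_bcontfun f w) \<le> function_mnorm (mat1 f)"
      using function_mnorm_upper[of w "mat1 f"] by (simp add: cmat_norm_mat1)
  qed
qed

lemma function_mnorm_entry:
  assumes "i < dim_row F" "j < dim_col F"
  shows "norm (F $$ (i, j)) \<le> function_mnorm F"
proof (rule norm_bound)
  fix w
  have "norm (apply_bcontfun (F $$ (i, j)) w) \<le> cmat_norm (map_mat (\<lambda>f. apply_bcontfun f w) F)"
    using cmat_norm_entry[of i "map_mat (\<lambda>f. apply_bcontfun f w) F" j] assms by simp
  then show "norm (apply_bcontfun (F $$ (i, j)) w) \<le> function_mnorm F"
    using function_mnorm_upper order_trans by blast
qed

lemma function_mnorm_le_sum:
  "function_mnorm F \<le> (\<Sum>i<dim_row F. \<Sum>j<dim_col F. norm (F $$ (i, j)))"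
  by (rule function_mnorm_least) (rule cmat_norm_eval_le_sum)

lemma function_mnorm_add:
  assumes "F \<in> carrier_mat m n" "G \<in> carrier_mat m n"
  shows "function_mnorm (F + G) \<le> function_mnorm F + function_mnorm G"
proof (rule function_mnorm_least)
  fix w
  have "map_mat (\<lambda>f. apply_bcontfun f w) (F + G)
      = map_mat (\<lambda>f. apply_bcontfun f w) F + map_mat (\<lambda>f. apply_bcontfun f w) G"
    using assms by (intro eq_matI) auto
  then have "cmat_norm (map_mat (\<lambda>f. apply_bcontfun f w) (F + G))
      \<le> cmat_norm (map_mat (\<lambda>f. apply_bcontfun f w) F) + cmat_norm (map_mat (\<lambda>f. apply_bcontfun f w) G)"
    using cmat_norm_add[of _ m n] assms by simp
  then show "cmat_norm (map_mat (\<lambda>f. apply_bcontfun f w) (F + G)) \<le> function_mnorm F + function_mnorm G"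
    using function_mnorm_upper[of w F] function_mnorm_upper[of w G] by linarith
qed

lemma apply_bcontfun_sum:
  "apply_bcontfun (\<Sum>i\<in>I. f i) w = (\<Sum>i\<in>I. apply_bcontfun (f i) w :: 'b::real_normed_vector)"
  by (induction I rule: infinite_finite_induct) auto

lemma function_mnorm_mult:
  assumes "F \<in> carrier_mat m p" "G \<in> carrier_mat p n"
  shows "function_mnorm (F * G) \<le> function_mnorm F * function_mnorm G"
proof (rule function_mnorm_least)
  fix w
  have "map_mat (\<lambda>f. apply_bcontfun f w) (F * G)
      = map_mat (\<lambda>f. apply_bcontfun f w) F * map_mat (\<lambda>f. apply_bcontfun f w) G"
    using assms by (intro eq_matI) (auto simp: scalar_prod_def apply_bcontfun_sum)
  then have "cmat_norm (map_mat (\<lambda>f. apply_bcontfun f w) (F * G))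
      \<le> cmat_norm (map_mat (\<lambda>f. apply_bcontfun f w) F) * cmat_norm (map_mat (\<lambda>f. apply_bcontfun f w) G)"
    using cmat_norm_mult[of _ m p _ n] assms by simp
  also have "\<dots> \<le> function_mnorm F * function_mnorm G"
    by (intro mult_mono function_mnorm_upper cmat_norm_nonneg function_mnorm_nonneg)
  finally show "cmat_norm (map_mat (\<lambda>f. apply_bcontfun f w) (F * G)) \<le> \<dots>" .
qed


section \<open>Completion of a matrix-seminormed space\<close>

lemma elements_mat1 [simp]: "elements_mat (mat1 u) = {u}"
  by (simp add: elements_mat_def mat1_def)

text \<open>What the completion needs from a matrix seminorm. The decisive assumption is
  \<open>N_le_sum\<close>: control by the entries lets convergence of entries imply convergence of
  matrix seminorms.\<close>

locale matrix_seminorm =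
  fixes F :: "'v::ab_group_add set" and sc :: "complex \<Rightarrow> 'v \<Rightarrow> 'v" and N :: "'v mat \<Rightarrow> real"
  assumes zero_mem: "0 \<in> F"
    and add_mem: "u \<in> F \<Longrightarrow> v \<in> F \<Longrightarrow> u + v \<in> F"
    and sc_mem: "u \<in> F \<Longrightarrow> sc c u \<in> F"
    and sc_minus_one: "sc (-1) u = - u"
    and sc_diff: "sc c (u - v) = sc c u - sc c v"
    and N_nonneg: "U \<in> carrier_mat m n \<Longrightarrow> elements_mat U \<subseteq> F \<Longrightarrow> 0 \<le> N U"
    and N_add: "U \<in> carrier_mat m n \<Longrightarrow> U' \<in> carrier_mat m n \<Longrightarrow> elements_mat U \<subseteq> F \<Longrightarrow>
      elements_mat U' \<subseteq> F \<Longrightarrow> N (U + U') \<le> N U + N U'"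
    and N_le_sum: "U \<in> carrier_mat m n \<Longrightarrow> elements_mat U \<subseteq> F \<Longrightarrow>
      N U \<le> (\<Sum>p\<in>{..<m} \<times> {..<n}. N (mat1 (U $$ p)))"
    and N_scale: "u \<in> F \<Longrightarrow> N (mat1 (sc c u)) \<le> cmod c * N (mat1 u)"
begin

abbreviation "nu u \<equiv> N (mat1 u)"
abbreviation "C \<equiv> cauchy_seqs F N"
abbreviation "R \<equiv> null_relation F N"

lemma minus_mem: "u \<in> F \<Longrightarrow> - u \<in> F"
  using sc_mem[of u "-1"] by (simp add: sc_minus_one)

lemma diff_mem: "u \<in> F \<Longrightarrow> v \<in> F \<Longrightarrow> u - v \<in> F"
  using add_mem[of u "- v"] minus_mem by simp

lemma nu_nonneg: "u \<in> F \<Longrightarrow> 0 \<le> nu u"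
  by (rule N_nonneg[OF mat1_simps(4)]) simp

lemma nu_add: "u \<in> F \<Longrightarrow> v \<in> F \<Longrightarrow> nu (u + v) \<le> nu u + nu v"
proof -
  have "mat1 (u + v) = mat1 u + mat1 v" by (rule eq_matI) (auto simp: mat1_def)
  then show "u \<in> F \<Longrightarrow> v \<in> F \<Longrightarrow> nu (u + v) \<le> nu u + nu v"
    using N_add[OF mat1_simps(4) mat1_simps(4), of u v] by simp
qed

lemma nu_uminus: "u \<in> F \<Longrightarrow> nu (- u) = nu u"
proof -
  have le: "nu (- u) \<le> nu u" if "u \<in> F" for u
    using N_scale[OF that, of "-1"] by (simp add: sc_minus_one)
  show "u \<in> F \<Longrightarrow> nu (- u) = nu u"
    using le[of u] le[of "- u"] minus_mem[of u] by simp
qed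

lemma nu_minus_commute: "u \<in> F \<Longrightarrow> v \<in> F \<Longrightarrow> nu (u - v) = nu (v - u)"
  using nu_uminus[OF diff_mem, of u v] by simp

lemma nu_zero: "nu 0 = 0"
proof -
  have "sc 0 0 = 0" using sc_diff[of 0 0 0] by simp
  then show ?thesis using N_scale[OF zero_mem, of 0] nu_nonneg[OF zero_mem] by simp
qed

lemma nu_triangle: "u \<in> F \<Longrightarrow> v \<in> F \<Longrightarrow> w \<in> F \<Longrightarrow> nu (u - w) \<le> nu (u - v) + nu (v - w)"
  using nu_add[OF diff_mem diff_mem, of u v v w] by simp

text \<open>Triangle inequality for \<open>U = V + (U - V)\<close> plus the bound by entries: the
  seminorm is Lipschitz in the entries, so limits may be taken entrywise.\<close>

lemma N_diff:
  assumes "U \<in> carrier_mat m n" "V \<in> carrier_mat m n" "elements_mat U \<subseteq> F" "elements_mat V \<subseteq> F"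
  shows "\<bar>N U - N V\<bar> \<le> (\<Sum>p\<in>{..<m} \<times> {..<n}. nu (U $$ p - V $$ p))"
proof -
  have ent: "U $$ (i, j) \<in> F" "V $$ (i, j) \<in> F" if "i < m" "j < n" for i j
    using assms that by (blast intro: elements_matI)+
  have one: "N U \<le> N V + (\<Sum>p\<in>{..<m} \<times> {..<n}. nu (U $$ p - V $$ p))"
    if UV: "U \<in> carrier_mat m n" "V \<in> carrier_mat m n"
      and ent: "\<And>i j. i < m \<Longrightarrow> j < n \<Longrightarrow> U $$ (i, j) \<in> F" "\<And>i j. i < m \<Longrightarrow> j < n \<Longrightarrow> V $$ (i, j) \<in> F"
    for U V
  proof -
    let ?D = "mat m n (\<lambda>p. U $$ p - V $$ p)"
    have D: "?D \<in> carrier_mat m n" "elements_mat ?D \<subseteq> F"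
      by (auto dest!: elements_matD intro!: diff_mem ent)
    have V: "elements_mat V \<subseteq> F" using UV ent by (auto dest!: elements_matD)
    have "U = V + ?D" using UV by (intro eq_matI) auto
    then have "N U \<le> N V + N ?D"
      using N_add[OF UV(2) D(1) V D(2)] by simp
    also have "N ?D \<le> (\<Sum>p\<in>{..<m} \<times> {..<n}. nu (?D $$ p))"
      by (rule N_le_sum[OF D])
    also have "\<dots> = (\<Sum>p\<in>{..<m} \<times> {..<n}. nu (U $$ p - V $$ p))"
      by (intro sum.cong) auto
    finally show ?thesis by simp
  qed
  have "(\<Sum>p\<in>{..<m} \<times> {..<n}. nu (U $$ p - V $$ p)) = (\<Sum>p\<in>{..<m} \<times> {..<n}. nu (V $$ p - U $$ p))"
    by (intro sum.cong) (auto intro: nu_minus_commute ent)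
  then show ?thesis using one[of U V] one[of V U] assms(1,2) ent by fastforce
qed

lemma cauchy_mem: "s \<in> C \<Longrightarrow> s n \<in> F"
  unfolding cauchy_seqs_def by auto

lemma cauchyD: "s \<in> C \<Longrightarrow> 0 < e \<Longrightarrow> \<exists>M. \<forall>m\<ge>M. \<forall>n\<ge>M. nu (s m - s n) < e"
  unfolding cauchy_seqs_def by simp

lemma const_cauchy: "u \<in> F \<Longrightarrow> (\<lambda>_. u) \<in> C"
  unfolding cauchy_seqs_def by (auto simp: nu_zero)

lemma add_cauchy:
  assumes "s \<in> C" "t \<in> C"
  shows "(\<lambda>n. s n + t n) \<in> C"
  unfolding cauchy_seqs_def
proof (clarsimp, intro conjI allI impI)
  show "range (\<lambda>n. s n + t n) \<subseteq> F" by (auto intro!: add_mem cauchy_mem[OF assms(1)] cauchy_mem[OF assms(2)])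
  fix e :: real assume "0 < e"
  then have e: "0 < e / 2" by simp
  obtain M1 M2 where
    1: "\<And>m n. m \<ge> M1 \<Longrightarrow> n \<ge> M1 \<Longrightarrow> nu (s m - s n) < e / 2" and
    2: "\<And>m n. m \<ge> M2 \<Longrightarrow> n \<ge> M2 \<Longrightarrow> nu (t m - t n) < e / 2"
    using cauchyD[OF assms(1) e] cauchyD[OF assms(2) e] by metis
  have "nu (s m + t m - (s n + t n)) < e" if "m \<ge> max M1 M2" "n \<ge> max M1 M2" for m n
    using nu_add[OF diff_mem[OF cauchy_mem cauchy_mem] diff_mem[OF cauchy_mem cauchy_mem], OF assms(1,1,2,2), of m n m n]
      1[of m n] 2[of m n] that by (simp add: add_diff_add)
  then show "\<exists>M. \<forall>m\<ge>M. \<forall>n\<ge>M. nu (s m + t m - (s n + t n)) < e" by blast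
qed

lemma scale_cauchy:
  assumes "s \<in> C"
  shows "(\<lambda>n. sc c (s n)) \<in> C"
  unfolding cauchy_seqs_def
proof (clarsimp, intro conjI allI impI)
  show "range (\<lambda>n. sc c (s n)) \<subseteq> F" by (auto intro!: sc_mem cauchy_mem[OF assms])
  fix e :: real assume "0 < e"
  then have e: "0 < e / (cmod c + 1)" by (simp add: add_nonneg_pos)
  obtain M where 1: "\<And>m n. m \<ge> M \<Longrightarrow> n \<ge> M \<Longrightarrow> nu (s m - s n) < e / (cmod c + 1)"
    using cauchyD[OF assms e] by auto
  have "nu (sc c (s m) - sc c (s n)) < e" if "m \<ge> M" "n \<ge> M" for m n
  proof -
    have "nu (sc c (s m) - sc c (s n)) \<le> cmod c * nu (s m - s n)"
      using N_scale[OF diff_mem[OF cauchy_mem cauchy_mem], OF assms assms] by (simp add: sc_diff)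
    also have "\<dots> \<le> (cmod c + 1) * nu (s m - s n)"
      using nu_nonneg[OF diff_mem[OF cauchy_mem cauchy_mem], OF assms assms] by (intro mult_right_mono) auto
    also have "\<dots> < e" using 1[OF that] norm_ge_zero[of c] by (simp add: pos_less_divide_eq mult.commute del: norm_ge_zero)
    finally show ?thesis .
  qed
  then show "\<exists>M. \<forall>m\<ge>M. \<forall>n\<ge>M. nu (sc c (s m) - sc c (s n)) < e" by blast
qed

lemma null_relationD: "(s, t) \<in> R \<Longrightarrow> s \<in> C \<and> t \<in> C \<and> (\<lambda>n. nu (s n - t n)) \<longlonglongrightarrow> 0"
  unfolding null_relation_def by simp

lemma null_relationI:
  assumes "s \<in> C" "t \<in> C" "\<And>n. nu (s n - t n) \<le> d n" "d \<longlonglongrightarrow> 0"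
  shows "(s, t) \<in> R"
proof -
  have "(\<lambda>n. nu (s n - t n)) \<longlonglongrightarrow> 0"
    by (rule tendsto_sandwich[OF _ _ tendsto_const assms(4)])
      (use assms(3) nu_nonneg[OF diff_mem[OF cauchy_mem cauchy_mem, OF assms(1,2)]] in auto)
  then show ?thesis unfolding null_relation_def using assms by simp
qed

lemma equiv_null: "equiv C R"
proof (rule equivI)
  show "R \<subseteq> C \<times> C" unfolding null_relation_def by auto
  show "refl_on C R" by (rule refl_onI) (auto intro!: null_relationI[where d = "\<lambda>_. 0"] simp: nu_zero)
  show "sym R"
  proof (rule symI)
    fix s t assume "(s, t) \<in> R"
    then show "(t, s) \<in> R"
      using null_relationD[of s t]
      by (auto intro!: null_relationI[where d = "\<lambda>n. nu (s n - t n)"] simp: nu_minus_commute cauchy_mem)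
  qed
  show "trans R"
  proof (rule transI)
    fix s t r assume "(s, t) \<in> R" "(t, r) \<in> R"
    then have *: "s \<in> C" "t \<in> C" "r \<in> C" "(\<lambda>n. nu (s n - t n)) \<longlonglongrightarrow> 0" "(\<lambda>n. nu (t n - r n)) \<longlonglongrightarrow> 0"
      by (auto dest: null_relationD)
    show "(s, r) \<in> R"
      using tendsto_add[OF *(4,5)] *
      by (intro null_relationI[where d = "\<lambda>n. nu (s n - t n) + nu (t n - r n)"])
        (auto intro: nu_triangle cauchy_mem)
  qed
qed

lemma completion_carrier: "carrier (completion F sc N) = C // R"
  by (simp add: completion_def Let_def)

lemma class_mem: "s \<in> C \<Longrightarrow> R `` {s} \<in> carrier (completion F sc N)"
  by (simp add: completion_carrier quotientI)

lemma class_cases: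
  assumes "P \<in> carrier (completion F sc N)"
  obtains s where "s \<in> C" "P = R `` {s}"
  using assms unfolding completion_carrier by (auto elim: quotientE)

lemma mem_class_cauchy: "P \<in> carrier (completion F sc N) \<Longrightarrow> s \<in> P \<Longrightarrow> s \<in> C"
  by (auto elim!: class_cases dest: null_relationD)

lemma class_rel:
  "P \<in> carrier (completion F sc N) \<Longrightarrow> s \<in> P \<Longrightarrow> t \<in> P \<Longrightarrow> (s, t) \<in> R"
  unfolding completion_carrier using equiv_null by (auto intro: quotient_eqI[of C R] dest: in_quotient_imp_in_rel)

lemma class_self: "s \<in> C \<Longrightarrow> s \<in> R `` {s}"
  by (rule equiv_class_self[OF equiv_null])

lemma some_mem:
  assumes "P \<in> carrier (completion F sc N)"
  shows "(SOME s. s \<in> P) \<in> P"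
proof -
  from assms obtain s where "s \<in> C" "P = R `` {s}" by (rule class_cases)
  then have "s \<in> P" using class_self by simp
  then show ?thesis by (rule someI[of "\<lambda>s. s \<in> P"])
qed

lemma completion_add:
  assumes "s \<in> C" "t \<in> C"
  shows "R `` {s} \<oplus>\<^bsub>completion F sc N\<^esub> R `` {t} = R `` {\<lambda>n. s n + t n}"
proof -
  have "congruent2 R R (\<lambda>s t. R `` {\<lambda>n. s n + t n})"
  proof (rule congruent2I[OF equiv_null equiv_null])
    show "R `` {\<lambda>n. s n + t n} = R `` {\<lambda>n. s' n + t n}" if "(s, s') \<in> R" "t \<in> C" for s s' t
      using null_relationD[OF that(1)] that(2)
      by (intro equiv_class_eq[OF equiv_null] null_relationI[where d = "\<lambda>n. nu (s n - s' n)"])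
        (auto intro: add_cauchy)
    show "R `` {\<lambda>n. s n + t n} = R `` {\<lambda>n. s n + t' n}" if "(t, t') \<in> R" "s \<in> C" for s t t'
      using null_relationD[OF that(1)] that(2)
      by (intro equiv_class_eq[OF equiv_null] null_relationI[where d = "\<lambda>n. nu (t n - t' n)"])
        (auto intro: add_cauchy)
  qed
  then show ?thesis
    using UN_equiv_class2[OF equiv_null equiv_null _ assms] by (simp add: completion_def Let_def)
qed

lemma completion_smult:
  assumes "s \<in> C"
  shows "c \<odot>\<^bsub>completion F sc N\<^esub> R `` {s} = R `` {\<lambda>n. sc c (s n)}"
proof -
  have "congruent R (\<lambda>s. R `` {\<lambda>n. sc c (s n)})"
  proof (rule congruentI)
    fix s t assume "(s, t) \<in> R"
    from null_relationD[OF this] have *: "s \<in> C" "t \<in> C" "(\<lambda>n. nu (s n - t n)) \<longlonglongrightarrow> 0" by auto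
    show "R `` {\<lambda>n. sc c (s n)} = R `` {\<lambda>n. sc c (t n)}"
      using tendsto_mult_left[OF *(3), of "cmod c"] *
      by (intro equiv_class_eq[OF equiv_null] null_relationI[where d = "\<lambda>n. cmod c * nu (s n - t n)"])
        (auto intro: scale_cauchy diff_mem cauchy_mem N_scale simp: sc_diff[symmetric])
  qed
  then show ?thesis
    using UN_equiv_class[OF equiv_null _ assms] by (simp add: completion_def Let_def)
qed

text \<open>The matrix norm of the completion is defined through representatives picked by
  \<open>SOME\<close>. By \<open>N_diff\<close> the seminorms along these form a Cauchy sequence,
  and any other choice differs from it by a null sequence.\<close>

lemma completion_mnorm_tendsto:
  assumes U: "U \<in> mats (completion F sc N) m n"
    and \<tau>: "\<And>i j. i < m \<Longrightarrow> j < n \<Longrightarrow> \<tau> (i, j) \<in> U $$ (i, j)"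
  shows "(\<lambda>k. N (mat m n (\<lambda>p. \<tau> p k))) \<longlonglongrightarrow> mnorm (completion F sc N) U"
proof -
  \<comment> \<open>Exactly the representatives that occur in the definition of
    \<open>completion\<close>.\<close>
  define \<sigma> where "\<sigma> p = (SOME s. s \<in> U $$ p)" for p
  define g where "g k = N (mat m n (\<lambda>p. \<sigma> p k))" for k
  have \<sigma>: "\<sigma> (i, j) \<in> U $$ (i, j)" if "i < m" "j < n" for i j
    unfolding \<sigma>_def using that by (intro some_mem mats_entry[OF U])
  have \<sigma>C: "\<sigma> p \<in> C" if "p \<in> {..<m} \<times> {..<n}" for p
    using that mem_class_cauchy[OF mats_entry[OF U] \<sigma>] by (cases p) auto
  have \<tau>C: "\<tau> p \<in> C" if "p \<in> {..<m} \<times> {..<n}" for p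
    using that mem_class_cauchy[OF mats_entry[OF U] \<tau>] by (cases p) auto
  have el: "elements_mat (mat m n (\<lambda>p. \<rho> p k)) \<subseteq> F"
    if "\<And>p. p \<in> {..<m} \<times> {..<n} \<Longrightarrow> \<rho> p \<in> C" for \<rho> k
  proof -
    have "\<rho> (i, j) k \<in> F" if "i < m" "j < n" for i j
      using cauchy_mem[of "\<rho> (i, j)" k] \<open>\<And>p. p \<in> _ \<Longrightarrow> \<rho> p \<in> C\<close>[of "(i, j)"] that by simp
    then show ?thesis by (auto dest!: elements_matD)
  qed
  have "Cauchy g"
  proof (rule metric_CauchyI)
    fix e :: real assume "0 < e"
    \<comment> \<open>There are \<open>m * n\<close> entries to share the error; the added 1 keeps
      the quotient meaningful for empty matrices and the final inequality strict.\<close>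
    define e' where "e' = e / (real (m * n) + 1)"
    have e': "0 < e'" using \<open>0 < e\<close> unfolding e'_def by (simp add: add_nonneg_pos)
    have "\<exists>M. \<forall>k\<ge>M. \<forall>l\<ge>M. nu (\<sigma> p k - \<sigma> p l) < e'" if "p \<in> {..<m} \<times> {..<n}" for p
      by (rule cauchyD[OF \<sigma>C[OF that] e'])
    then obtain M where M: "\<And>p k l. p \<in> {..<m} \<times> {..<n} \<Longrightarrow> k \<ge> M p \<Longrightarrow> l \<ge> M p \<Longrightarrow> nu (\<sigma> p k - \<sigma> p l) < e'"
      by metis
    \<comment> \<open>The sum of the finitely many thresholds \<open>M p\<close> serves as a common
      threshold.\<close>
    have "dist (g k) (g l) < e" if "k \<ge> (\<Sum>p\<in>{..<m} \<times> {..<n}. M p)" "l \<ge> (\<Sum>p\<in>{..<m} \<times> {..<n}. M p)" for k l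
    proof -
      have "nu (\<sigma> p k - \<sigma> p l) \<le> e'" if p: "p \<in> {..<m} \<times> {..<n}" for p
      proof -
        have "M p \<le> (\<Sum>p\<in>{..<m} \<times> {..<n}. M p)" using p by (intro member_le_sum) auto
        then show ?thesis using M[OF p, of k l] \<open>k \<ge> _\<close> \<open>l \<ge> _\<close> by simp
      qed
      then have "(\<Sum>p\<in>{..<m} \<times> {..<n}. nu (\<sigma> p k - \<sigma> p l)) \<le> (\<Sum>p\<in>{..<m} \<times> {..<n}. e')"
        by (rule sum_mono)
      moreover have "\<bar>g k - g l\<bar> \<le> (\<Sum>p\<in>{..<m} \<times> {..<n}. nu (mat m n (\<lambda>p. \<sigma> p k) $$ p - mat m n (\<lambda>p. \<sigma> p l) $$ p))"
        unfolding g_def by (rule N_diff) (auto intro!: el \<sigma>C)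
      moreover have "(\<Sum>p\<in>{..<m} \<times> {..<n}. nu (mat m n (\<lambda>p. \<sigma> p k) $$ p - mat m n (\<lambda>p. \<sigma> p l) $$ p))
          = (\<Sum>p\<in>{..<m} \<times> {..<n}. nu (\<sigma> p k - \<sigma> p l))"
        by (intro sum.cong) auto
      ultimately have "dist (g k) (g l) \<le> real (m * n) * e'"
        by (simp add: dist_real_def)
      also have "\<dots> < (real (m * n) + 1) * e'" using e' by (simp add: algebra_simps)
      also have "\<dots> = e" unfolding e'_def using of_nat_0_le_iff[of "m * n", where 'a = real]
        by (simp del: of_nat_0_le_iff of_nat_mult)
      finally show ?thesis .
    qed
    then show "\<exists>M. \<forall>k\<ge>M. \<forall>l\<ge>M. dist (g k) (g l) < e" by blast
  qed
  then have "convergent g" by (rule Cauchy_convergent)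
  moreover have "mnorm (completion F sc N) U = lim g"
  proof -
    have "map_mat (\<lambda>P. (SOME s. s \<in> P) k) U = mat m n (\<lambda>p. \<sigma> p k)" for k
      using U by (intro eq_matI) (auto simp: \<sigma>_def)
    then show ?thesis unfolding completion_def Let_def g_def by simp
  qed
  ultimately have lim: "g \<longlonglongrightarrow> mnorm (completion F sc N) U"
    by (simp add: convergent_LIMSEQ_iff)
  have "(\<lambda>k. N (mat m n (\<lambda>p. \<tau> p k)) - g k) \<longlonglongrightarrow> 0"
  proof (rule Lim_null_comparison)
    have "\<bar>N (mat m n (\<lambda>p. \<tau> p k)) - g k\<bar>
        \<le> (\<Sum>p\<in>{..<m} \<times> {..<n}. nu (mat m n (\<lambda>p. \<tau> p k) $$ p - mat m n (\<lambda>p. \<sigma> p k) $$ p))" for k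
      unfolding g_def by (rule N_diff) (auto intro!: el \<sigma>C \<tau>C)
    moreover have "(\<Sum>p\<in>{..<m} \<times> {..<n}. nu (mat m n (\<lambda>p. \<tau> p k) $$ p - mat m n (\<lambda>p. \<sigma> p k) $$ p))
        = (\<Sum>p\<in>{..<m} \<times> {..<n}. nu (\<tau> p k - \<sigma> p k))" for k
      by (intro sum.cong) auto
    ultimately show "\<forall>\<^sub>F k in sequentially. norm (N (mat m n (\<lambda>p. \<tau> p k)) - g k)
        \<le> (\<Sum>p\<in>{..<m} \<times> {..<n}. nu (\<tau> p k - \<sigma> p k))"
      by (auto simp: real_norm_def)
    have "(\<lambda>k. nu (\<tau> p k - \<sigma> p k)) \<longlonglongrightarrow> 0" if "p \<in> {..<m} \<times> {..<n}" for p
      using that null_relationD[OF class_rel[OF mats_entry[OF U] \<tau> \<sigma>]] by (cases p) auto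
    then show "(\<lambda>k. \<Sum>p\<in>{..<m} \<times> {..<n}. nu (\<tau> p k - \<sigma> p k)) \<longlonglongrightarrow> 0"
      by (rule tendsto_null_sum)
  qed
  from tendsto_add[OF this lim] show ?thesis by simp
qed

lemma completion_mnorm_const:
  assumes "U \<in> carrier_mat m n" "elements_mat U \<subseteq> F"
  shows "map_mat (\<lambda>u. R `` {\<lambda>_. u}) U \<in> mats (completion F sc N) m n" (is "?U \<in> _")
    and "mnorm (completion F sc N) (map_mat (\<lambda>u. R `` {\<lambda>_. u}) U) = N U"
proof -
  have ent: "U $$ (i, j) \<in> F" if "i < m" "j < n" for i j
    using assms that by (blast intro: elements_matI)
  show U: "?U \<in> mats (completion F sc N) m n"
    using assms(1) ent by (intro matsI) (auto intro!: class_mem const_cauchy)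
  have "(\<lambda>k. N (mat m n (\<lambda>p. (\<lambda>_. U $$ p) k))) \<longlonglongrightarrow> mnorm (completion F sc N) ?U"
    using assms(1) class_self[OF const_cauchy[OF ent]] by (intro completion_mnorm_tendsto[OF U]) auto
  moreover have "mat m n (\<lambda>p. U $$ p) = U" using assms(1) by (intro eq_matI) auto
  ultimately show "mnorm (completion F sc N) ?U = N U"
    by (simp add: LIMSEQ_const_iff)
qed

end

lemma (in operator_space_pair) haag_matrix_seminorm:
  "matrix_seminorm (formal_tensors X Y) formal_scale haag"
proof
  show "haag (U + U') \<le> haag U + haag U'"
    if "U \<in> carrier_mat m n" "U' \<in> carrier_mat m n"
      "elements_mat U \<subseteq> formal_tensors X Y" "elements_mat U' \<subseteq> formal_tensors X Y" for U U' m n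
    using haag_add[of U _ _ U' _ _ m n] rep_exists[of U m n] rep_exists[of U' m n] that by metis
  show "haag (mat1 (formal_scale c u)) \<le> cmod c * haag (mat1 u)" if "u \<in> formal_tensors X Y" for c u
    using rep_mat1_exists[OF that] haag_scale_le[of "mat1 u" _ _ c] by auto
  show "0 \<le> haag U" if "U \<in> carrier_mat m n" "elements_mat U \<subseteq> formal_tensors X Y" for U m n
    using rep_exists[OF that] haag_nonneg by auto
qed (auto intro: formal.subspace_0 formal.subspace_add formal.subspace_scale formal_subspace haag_le_sum
    simp: formal.scale_right_diff_distrib)

text \<open>This instance supplies \<open>fun_norm.N_diff\<close>, the entrywise Lipschitz estimate
  for matrices of functions, with which norms of images in \<open>A\<close> are compared along a
  limit.\<close>

interpretation fun_norm: matrix_seminorm UNIV "\<lambda>c f. const_bcontfun c * f" function_mnorm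
proof
  show "const_bcontfun (-1) * u = - u" for u :: "'a \<Rightarrow>\<^sub>C complex"
    by (rule bcontfun_eqI) simp
  show "function_mnorm (mat1 (const_bcontfun c * u)) \<le> cmod c * function_mnorm (mat1 u)"
    for c and u :: "'a \<Rightarrow>\<^sub>C complex"
    unfolding function_mnorm_mat1
    by (rule norm_bound) (simp add: norm_mult mult_left_mono norm_bounded)
  show "function_mnorm U \<le> (\<Sum>p\<in>{..<m} \<times> {..<n}. function_mnorm (mat1 (U $$ p)))"
    if "U \<in> carrier_mat m n" for U :: "('a \<Rightarrow>\<^sub>C complex) mat" and m n
    using function_mnorm_le_sum[of U] that
    by (simp add: function_mnorm_mat1 sum.cartesian_product case_prod_unfold)
qed (auto simp: algebra_simps function_mnorm_nonneg intro: function_mnorm_add)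

text \<open>The library has this only for metric domains.\<close>

lemma bcontfun_Cauchy_convergent:
  fixes f :: "nat \<Rightarrow> 'a::topological_space \<Rightarrow>\<^sub>C 'b::complete_space"
  assumes "Cauchy f"
  shows "convergent f"
proof -
  obtain g where "uniform_limit UNIV f g sequentially"
    using assms uniformly_convergent_eq_cauchy[of "\<lambda>_. True" f]
    unfolding Cauchy_def uniform_limit_sequentially_iff
    by (metis dist_fun_lt_imp_dist_val_lt)
  from uniform_limit_bcontfunE[OF this sequentially_bot] show ?thesis
    by (auto intro: convergentI)
qed

text \<open>Reduces the quotient property to statements about \<open>F\<close>. Contractivity
  survives the limit along representatives, and \<open>A\<close> is closed, so values stay in
  \<open>A\<close>. Conversely, a matrix in the open unit ball is lifted within \<open>F\<close> and
  then viewed as a matrix of constant sequences, whose norm in the completion is unchanged.\<close>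

lemma (in matrix_seminorm) complete_quotient_completion:
  fixes \<phi> :: "'v \<Rightarrow> 'w::t2_space cfun"
  assumes A: "closed A" and \<phi>_mem: "\<And>u. u \<in> F \<Longrightarrow> \<phi> u \<in> A"
    and \<phi>_add: "\<And>u v. u \<in> F \<Longrightarrow> v \<in> F \<Longrightarrow> \<phi> (u + v) = \<phi> u + \<phi> v"
    and \<phi>_sc: "\<And>c u. u \<in> F \<Longrightarrow> \<phi> (sc c u) = const_bcontfun c * \<phi> u"
    and contractive: "\<And>m n U. U \<in> carrier_mat m n \<Longrightarrow> elements_mat U \<subseteq> F \<Longrightarrow> function_mnorm (map_mat \<phi> U) \<le> N U"
    and lift: "\<And>n Z. Z \<in> mats (function_opspace A) n n \<Longrightarrow> function_mnorm Z < 1 \<Longrightarrow>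
      \<exists>U\<in>carrier_mat n n. elements_mat U \<subseteq> F \<and> N U < 1 \<and> map_mat \<phi> U = Z"
  shows "\<exists>T. (\<forall>u\<in>F. T (R `` {\<lambda>_. u}) = \<phi> u) \<and>
    complete_quotient_map (completion F sc N) (function_opspace A) T"
proof -
  let ?V = "completion F sc N" and ?W = "function_opspace A"
  \<comment> \<open>The choice of representative is immaterial by \<open>T_lim\<close> below, which
    identifies the limit along any member of the class.\<close>
  define T where "T P = lim (\<lambda>k. \<phi> ((SOME s. s \<in> P) k))" for P
  have \<phi>_le: "norm (\<phi> u - \<phi> v) \<le> nu (u - v)" if "u \<in> F" "v \<in> F" for u v
  proof -
    have "\<phi> (u - v) = \<phi> u - \<phi> v"
      using \<phi>_add[OF diff_mem[OF that] that(2)] by simp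
    then show ?thesis
      using contractive[OF mat1_simps(4), of "u - v"] diff_mem[OF that] by (simp add: function_mnorm_mat1)
  qed
  have conv: "convergent (\<lambda>k. \<phi> (s k))" if s: "s \<in> C" for s
  proof (rule bcontfun_Cauchy_convergent, rule CauchyI)
    fix e :: real assume "0 < e"
    then obtain M where "\<And>m n. m \<ge> M \<Longrightarrow> n \<ge> M \<Longrightarrow> nu (s m - s n) < e"
      using cauchyD[OF s] by metis
    then show "\<exists>M. \<forall>m\<ge>M. \<forall>n\<ge>M. norm (\<phi> (s m) - \<phi> (s n)) < e"
      using \<phi>_le[OF cauchy_mem[OF s] cauchy_mem[OF s]] le_less_trans by blast
  qed
  have T_lim: "(\<lambda>k. \<phi> (s k)) \<longlonglongrightarrow> T P" if P: "P \<in> carrier ?V" and s: "s \<in> P" for P s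
  proof -
    let ?\<sigma> = "SOME s. s \<in> P"
    have mem: "s \<in> C" "?\<sigma> \<in> C" using mem_class_cauchy[OF P] s some_mem[OF P] by auto
    have "(\<lambda>k. nu (s k - ?\<sigma> k)) \<longlonglongrightarrow> 0"
      using null_relationD[OF class_rel[OF P s some_mem[OF P]]] by simp
    then have "(\<lambda>k. \<phi> (s k) - \<phi> (?\<sigma> k)) \<longlonglongrightarrow> 0"
      by (rule Lim_null_comparison[rotated]) (simp add: \<phi>_le cauchy_mem mem)
    moreover have "(\<lambda>k. \<phi> (?\<sigma> k)) \<longlonglongrightarrow> T P"
      unfolding T_def using conv[OF mem(2)] by (simp add: convergent_LIMSEQ_iff)
    ultimately show ?thesis by (rule Lim_transform[rotated])
  qed
  have T_mem: "T P \<in> A" if P: "P \<in> carrier ?V" for P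
    by (rule closed_sequentially[OF A _ T_lim[OF P some_mem[OF P]]])
      (rule \<phi>_mem[OF cauchy_mem[OF mem_class_cauchy[OF P some_mem[OF P]]]])
  have T_const: "T (R `` {\<lambda>_. u}) = \<phi> u" if "u \<in> F" for u
    using T_lim[OF class_mem class_self, OF const_cauchy const_cauchy, OF that that]
    by (simp add: LIMSEQ_const_iff)
  have T_add: "T (P \<oplus>\<^bsub>?V\<^esub> Q) = T P + T Q" if P: "P \<in> carrier ?V" and Q: "Q \<in> carrier ?V" for P Q
  proof -
    obtain s t where s: "s \<in> C" "P = R `` {s}" and t: "t \<in> C" "Q = R `` {t}"
      using P Q by (metis class_cases)
    have eq: "P \<oplus>\<^bsub>?V\<^esub> Q = R `` {\<lambda>n. s n + t n}"
      unfolding s(2) t(2) by (rule completion_add[OF s(1) t(1)])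
    have "(\<lambda>k. \<phi> (s k + t k)) \<longlonglongrightarrow> T (P \<oplus>\<^bsub>?V\<^esub> Q)"
      unfolding eq using add_cauchy[OF s(1) t(1)] by (intro T_lim class_mem class_self)
    moreover have "(\<lambda>k. \<phi> (s k + t k)) \<longlonglongrightarrow> T P + T Q"
      unfolding \<phi>_add[OF cauchy_mem[OF s(1)] cauchy_mem[OF t(1)]] using P Q class_self s t
      by (intro tendsto_add T_lim) auto
    ultimately show ?thesis by (rule LIMSEQ_unique)
  qed
  have T_smult: "T (c \<odot>\<^bsub>?V\<^esub> P) = const_bcontfun c * T P" if P: "P \<in> carrier ?V" for c P
  proof -
    obtain s where s: "s \<in> C" "P = R `` {s}"
      using P by (metis class_cases)
    have eq: "c \<odot>\<^bsub>?V\<^esub> P = R `` {\<lambda>n. sc c (s n)}"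
      unfolding s(2) by (rule completion_smult[OF s(1)])
    have "(\<lambda>k. \<phi> (sc c (s k))) \<longlonglongrightarrow> T (c \<odot>\<^bsub>?V\<^esub> P)"
      unfolding eq using scale_cauchy[OF s(1)] by (intro T_lim class_mem class_self)
    moreover have "(\<lambda>k. \<phi> (sc c (s k))) \<longlonglongrightarrow> const_bcontfun c * T P"
    proof -
      have le: "norm (const_bcontfun c * f) \<le> cmod c * norm f" for f :: "'w cfun"
        by (rule norm_bound) (simp add: norm_mult mult_left_mono norm_bounded)
      have "(\<lambda>k. cmod c * norm (\<phi> (s k) - T P)) \<longlonglongrightarrow> 0"
        using T_lim[OF P, of s] s class_self
        by (intro tendsto_mult_right_zero) (simp add: LIM_zero_iff tendsto_norm_zero_iff)
      then have "(\<lambda>k. const_bcontfun c * \<phi> (s k) - const_bcontfun c * T P) \<longlonglongrightarrow> 0"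
        by (rule Lim_null_comparison[rotated]) (simp only: eventually_True le flip: right_diff_distrib)
      then show ?thesis
        unfolding \<phi>_sc[OF cauchy_mem[OF s(1)]] by (rule LIM_zero_cancel)
    qed
    ultimately show ?thesis by (rule LIMSEQ_unique)
  qed
  have "linear_map ?V ?W T"
    unfolding linear_map_def using T_mem T_add T_smult by (simp add: function_opspace_def)
  moreover have "map_mat T ` {x \<in> mats ?V n n. mnorm ?V x < 1} = {y \<in> mats ?W n n. mnorm ?W y < 1}" for n
  proof (intro equalityI subsetI; clarify)
    fix U assume U: "U \<in> mats ?V n n" "mnorm ?V U < 1"
    define \<sigma> where "\<sigma> p = (SOME s. s \<in> U $$ p)" for p
    have \<sigma>: "\<sigma> (i, j) \<in> U $$ (i, j)" if "i < n" "j < n" for i j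
      unfolding \<sigma>_def using that by (intro some_mem mats_entry[OF U(1)])
    have \<sigma>F: "\<sigma> (i, j) k \<in> F" if "i < n" "j < n" for i j k
      using cauchy_mem[OF mem_class_cauchy[OF mats_entry[OF U(1) that] \<sigma>[OF that]]] .
    let ?S = "\<lambda>k. mat n n (\<lambda>p. \<sigma> p k)"
    \<comment> \<open>The error made when the class in each entry is replaced by the
      \<open>k\<close>-th term of its representative. It tends to 0, while \<open>N (?S k)\<close>
      tends to the norm of \<open>U\<close>; the limit of \<open>le\<close> is the contractivity of
      \<open>T\<close>.\<close>
    let ?d = "\<lambda>k. \<Sum>p\<in>{..<n} \<times> {..<n}. norm (T (U $$ p) - \<phi> (\<sigma> p k))"
    have le: "function_mnorm (map_mat T U) \<le> N (?S k) + ?d k" for k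
    proof -
      have "\<bar>function_mnorm (map_mat T U) - function_mnorm (map_mat \<phi> (?S k))\<bar>
          \<le> (\<Sum>p\<in>{..<n} \<times> {..<n}. function_mnorm (mat1 (map_mat T U $$ p - map_mat \<phi> (?S k) $$ p)))"
        using U by (intro fun_norm.N_diff) (auto dest: mats_carrier)
      also have "\<dots> = ?d k"
        using U by (intro sum.cong) (auto simp: function_mnorm_mat1)
      finally show ?thesis
        using contractive[of "?S k" n n] \<sigma>F by (fastforce dest!: elements_matD)
    qed
    have "(\<lambda>k. N (?S k) + ?d k) \<longlonglongrightarrow> mnorm ?V U + 0"
    proof (intro tendsto_add completion_mnorm_tendsto[OF U(1) \<sigma>] tendsto_null_sum)
      fix p assume p: "p \<in> {..<n} \<times> {..<n}"
      have "(\<lambda>k. \<phi> (\<sigma> p k)) \<longlonglongrightarrow> T (U $$ p)"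
        using T_lim[OF mats_entry[OF U(1)] \<sigma>] p by (cases p) auto
      then show "(\<lambda>k. norm (T (U $$ p) - \<phi> (\<sigma> p k))) \<longlonglongrightarrow> 0"
        using tendsto_norm_zero[OF LIM_zero] by (simp add: norm_minus_commute)
    qed
    then have "function_mnorm (map_mat T U) \<le> mnorm ?V U"
      using le LIMSEQ_le_const by fastforce
    with U T_mem show "map_mat T U \<in> mats ?W n n \<and> mnorm ?W (map_mat T U) < 1"
      by (auto intro!: mats_map[OF U(1)] simp: function_opspace_def)
  next
    fix Z assume Z: "Z \<in> mats ?W n n" "mnorm ?W Z < 1"
    obtain U where U: "U \<in> carrier_mat n n" "elements_mat U \<subseteq> F" "N U < 1" "map_mat \<phi> U = Z"
      using lift[OF Z(1)] Z(2) by (auto simp: function_opspace_def)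
    have "map_mat T (map_mat (\<lambda>u. R `` {\<lambda>_. u}) U) = Z"
      using U(2) T_const unfolding U(4)[symmetric]
      by (intro eq_matI) (auto intro!: elements_matI[OF U(1)] T_const dest!: subsetD[OF U(2)] simp: U(1)[THEN carrier_matD(1)] U(1)[THEN carrier_matD(2)])
    then show "Z \<in> map_mat T ` {x \<in> mats ?V n n. mnorm ?V x < 1}"
      using completion_mnorm_const[OF U(1,2)] U(3) by (intro image_eqI) auto
  qed
  ultimately show ?thesis
    unfolding complete_quotient_map_def using T_const by blast
qed


section \<open>Operator spaces of functions\<close>

lemma function_mnorm_eq_0_iff:
  "function_mnorm F = 0 \<longleftrightarrow> (\<forall>i<dim_row F. \<forall>j<dim_col F. F $$ (i, j) = 0)"
proof
  assume "function_mnorm F = 0"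
  then show "\<forall>i<dim_row F. \<forall>j<dim_col F. F $$ (i, j) = 0"
    by (metis function_mnorm_entry norm_le_zero_iff)
next
  assume "\<forall>i<dim_row F. \<forall>j<dim_col F. F $$ (i, j) = 0"
  then show "function_mnorm F = 0"
    using function_mnorm_le_sum[of F] function_mnorm_nonneg[of F] by simp
qed

lemma function_mnorm_smult_le: "function_mnorm (f \<cdot>\<^sub>m F) \<le> norm f * function_mnorm F"
proof (rule function_mnorm_least)
  fix w
  have "map_mat (\<lambda>f. apply_bcontfun f w) (f \<cdot>\<^sub>m F) = apply_bcontfun f w \<cdot>\<^sub>m map_mat (\<lambda>f. apply_bcontfun f w) F"
    by (rule eq_matI) auto
  then show "cmat_norm (map_mat (\<lambda>f. apply_bcontfun f w) (f \<cdot>\<^sub>m F)) \<le> norm f * function_mnorm F"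
    by (simp add: cmat_norm_smult mult_mono norm_bounded function_mnorm_upper cmat_norm_nonneg)
qed

lemma norm_const_bcontfun: "norm (const_bcontfun c :: 'w::topological_space \<Rightarrow>\<^sub>C complex) \<le> cmod c"
  by (rule norm_bound) simp

lemma function_mnorm_const_smult:
  "function_mnorm (const_bcontfun c \<cdot>\<^sub>m F) = cmod c * function_mnorm F"
proof (rule antisym)
  have le: "function_mnorm (const_bcontfun c \<cdot>\<^sub>m F) \<le> cmod c * function_mnorm F" for c and F :: "'w::t2_space cfun mat"
    using function_mnorm_smult_le[of "const_bcontfun c" F]
      mult_right_mono[OF norm_const_bcontfun function_mnorm_nonneg] by (rule order_trans)
  then show "function_mnorm (const_bcontfun c \<cdot>\<^sub>m F) \<le> cmod c * function_mnorm F" .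
  show "cmod c * function_mnorm F \<le> function_mnorm (const_bcontfun c \<cdot>\<^sub>m F)"
  proof (cases "c = 0")
    case False
    have "const_bcontfun (inverse c) * (const_bcontfun c * f) = f" for f :: "'w::t2_space cfun"
      using False by (intro bcontfun_eqI) simp
    then have "const_bcontfun (inverse c) \<cdot>\<^sub>m (const_bcontfun c \<cdot>\<^sub>m F) = F"
      by (intro eq_matI) auto
    then show ?thesis
      using le[of "inverse c" "const_bcontfun c \<cdot>\<^sub>m F"] False by (simp add: norm_divide field_simps)
  qed (simp add: function_mnorm_nonneg)
qed

lemma function_mnorm_smult_one_le:
  fixes f :: "'w::t2_space cfun"
  shows "function_mnorm (f \<cdot>\<^sub>m 1\<^sub>m n) \<le> norm f"
proof -
  have "function_mnorm (1\<^sub>m n :: 'w cfun mat) \<le> 1"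
  proof (rule function_mnorm_least)
    fix w :: 'w
    have "map_mat (\<lambda>f. apply_bcontfun f w) (1\<^sub>m n :: 'w cfun mat) = 1\<^sub>m n" by (rule eq_matI) auto
    then show "cmat_norm (map_mat (\<lambda>f. apply_bcontfun f w) (1\<^sub>m n)) \<le> 1"
      using cmat_norm_one_le by simp
  qed
  then show ?thesis
    using function_mnorm_smult_le[of f "1\<^sub>m n"] mult_left_mono[of "function_mnorm (1\<^sub>m n)" 1 "norm f"]
    by fastforce
qed

lemma function_mnorm_const_le: "function_mnorm (map_mat const_bcontfun \<alpha>) \<le> cmat_norm \<alpha>"
proof (rule function_mnorm_least)
  fix w
  have "map_mat (\<lambda>f. apply_bcontfun f w) (map_mat const_bcontfun \<alpha>) = \<alpha>" by (rule eq_matI) auto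
  then show "cmat_norm (map_mat (\<lambda>f. apply_bcontfun f w) (map_mat const_bcontfun \<alpha>)) \<le> cmat_norm \<alpha>" by simp
qed

lemma function_mnorm_diag:
  assumes "F \<in> carrier_mat m n" "G \<in> carrier_mat p q"
  shows "function_mnorm (four_block_mat F (0\<^sub>m m q) (0\<^sub>m p n) G) = max (function_mnorm F) (function_mnorm G)"
proof -
  let ?D = "four_block_mat F (0\<^sub>m m q) (0\<^sub>m p n) G"
  have eval: "cmat_norm (map_mat (\<lambda>f. apply_bcontfun f w) ?D)
      = max (cmat_norm (map_mat (\<lambda>f. apply_bcontfun f w) F)) (cmat_norm (map_mat (\<lambda>f. apply_bcontfun f w) G))" for w
  proof -
    have "map_mat (\<lambda>f. apply_bcontfun f w) ?D = four_block_mat (map_mat (\<lambda>f. apply_bcontfun f w) F)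
        (0\<^sub>m m q) (0\<^sub>m p n) (map_mat (\<lambda>f. apply_bcontfun f w) G)"
      using assms by (intro eq_matI) auto
    then show ?thesis using assms by (simp add: cmat_norm_diag[of _ m n _ p q])
  qed
  show ?thesis
  proof (rule antisym)
    show "function_mnorm ?D \<le> max (function_mnorm F) (function_mnorm G)"
      by (rule function_mnorm_least) (unfold eval, intro max.mono function_mnorm_upper)
    have "function_mnorm F \<le> function_mnorm ?D" "function_mnorm G \<le> function_mnorm ?D"
      using eval function_mnorm_upper[of _ ?D] by (auto intro!: function_mnorm_least)
    then show "max (function_mnorm F) (function_mnorm G) \<le> function_mnorm ?D" by simp
  qed
qed

text \<open>An operator space given by a complete isometry \<open>J\<close> into functions. Ruan's
  axioms then need no separate argument: each of them is the pointwise statement about complex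
  matrices, transported by \<open>J\<close>.\<close>

locale function_representation = complex_banach_space V "\<lambda>x. mnorm V (mat1 x)"
  for V :: "('x, 'm) opspace_scheme" (structure) +
  fixes J :: "'x \<Rightarrow> 'w::t2_space cfun"
  assumes J_add: "x \<in> carrier V \<Longrightarrow> y \<in> carrier V \<Longrightarrow> J (x \<oplus> y) = J x + J y"
    and J_smult: "x \<in> carrier V \<Longrightarrow> J (c \<odot>\<^bsub>V\<^esub> x) = const_bcontfun c * J x"
    and mnorm_J: "M \<in> mats V m n \<Longrightarrow> mnorm V M = function_mnorm (map_mat J M)"
begin

lemma smult_carrier: "x \<in> carrier V \<Longrightarrow> c \<odot>\<^bsub>V\<^esub> x \<in> carrier V"
  by simp

lemma J_zero [simp]: "J \<zero> = 0"
  using J_add[of \<zero> \<zero>] by simp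

lemma J_finsum: "finite I \<Longrightarrow> f \<in> I \<rightarrow> carrier V \<Longrightarrow> J (finsum V f I) = (\<Sum>i\<in>I. J (f i))"
proof (induction I rule: finite_induct)
  case (insert i I)
  then have "J (finsum V f (insert i I)) = J (f i \<oplus> finsum V f I)"
    by (subst finsum_insert) auto
  also have "\<dots> = J (f i) + J (finsum V f I)"
    using insert by (intro J_add finsum_closed) auto
  finally show ?case using insert by auto
qed simp

lemma norm_J: "x \<in> carrier V \<Longrightarrow> mnorm V (mat1 x) = norm (J x)"
  using mnorm_J[OF mat1_mats] by (simp add: function_mnorm_mat1)

lemma J_eq_0_iff: "x \<in> carrier V \<Longrightarrow> J x = 0 \<longleftrightarrow> x = \<zero>"
  using norm_eq_0[of x] by (simp add: norm_J)

lemma J_inj: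
  assumes "x \<in> carrier V" "y \<in> carrier V" "J x = J y"
  shows "x = y"
proof -
  have eq: "x \<ominus> y \<oplus> y = x"
    using assms by (simp add: a_minus_def M.a_assoc M.l_neg)
  then have "J (x \<ominus> y) = 0"
    using J_add[of "x \<ominus> y" y] assms by simp
  then have "x \<ominus> y = \<zero>" using assms J_eq_0_iff[of "x \<ominus> y"] by simp
  then show ?thesis using eq assms by simp
qed

text \<open>The maps \<open>f\<close> and \<open>g\<close> are kept general so that one lemma covers
  scalar matrices and matrices over \<open>A\<close>, acting from either side.\<close>

lemma map_J_mat_prod:
  assumes "dim_col M = dim_row Z"
    and "\<And>a b. a \<in> elements_mat M \<Longrightarrow> b \<in> elements_mat Z \<Longrightarrow> \<mu> a b \<in> carrier V \<and> J (\<mu> a b) = f a * g b"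
  shows "map_mat J (mat_prod V \<mu> M Z) = map_mat f M * map_mat g Z"
proof (rule eq_matI)
  fix i j assume "i < dim_row (map_mat f M * map_mat g Z)" "j < dim_col (map_mat f M * map_mat g Z)"
  then have ij: "i < dim_row M" "j < dim_col Z" by auto
  have *: "\<mu> (M $$ (i, k)) (Z $$ (k, j)) \<in> carrier V \<and>
      J (\<mu> (M $$ (i, k)) (Z $$ (k, j))) = f (M $$ (i, k)) * g (Z $$ (k, j))" if "k < dim_col M" for k
    using ij that assms(1) by (intro assms(2)) (auto intro!: elements_matI)
  then have "J (finsum V (\<lambda>k. \<mu> (M $$ (i, k)) (Z $$ (k, j))) {..<dim_col M})
      = (\<Sum>k<dim_col M. f (M $$ (i, k)) * g (Z $$ (k, j)))"
    by (subst J_finsum) auto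
  then show "map_mat J (mat_prod V \<mu> M Z) $$ (i, j) = (map_mat f M * map_mat g Z) $$ (i, j)"
    using ij assms(1) by (simp add: mat_prod_def scalar_prod_def atLeast0LessThan)
qed (auto simp: mat_prod_def)

lemma mat_prod_mats:
  assumes "M \<in> carrier_mat m p" "Z \<in> carrier_mat p n"
    and "\<And>a b. a \<in> elements_mat M \<Longrightarrow> b \<in> elements_mat Z \<Longrightarrow> \<mu> a b \<in> carrier V"
  shows "mat_prod V \<mu> M Z \<in> mats V m n"
  using assms by (intro matsI) (auto simp: mat_prod_def intro!: finsum_closed assms(3) elements_matI)

lemma mats_elements: "M \<in> mats V m n \<Longrightarrow> x \<in> elements_mat M \<Longrightarrow> x \<in> carrier V"
  unfolding mats_def by auto

lemma operator_space: "operator_space V"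
proof
  fix x m n assume x: "x \<in> mats V m n"
  show "mnorm V x = 0 \<longleftrightarrow> x = mat m n (\<lambda>_. \<zero>)"
    unfolding mnorm_J[OF x] function_mnorm_eq_0_iff
    using x J_eq_0_iff[OF mats_entry[OF x]] by (auto intro!: eq_matI)
  fix c
  have "map_mat J (map_mat (\<lambda>z. c \<odot>\<^bsub>V\<^esub> z) x) = const_bcontfun c \<cdot>\<^sub>m map_mat J x"
    using x by (intro eq_matI) (auto simp: J_smult mats_entry)
  then show "mnorm V (map_mat (\<lambda>z. c \<odot>\<^bsub>V\<^esub> z) x) = cmod c * mnorm V x"
    using mnorm_J[OF mats_map[OF x], of "\<lambda>z. c \<odot>\<^bsub>V\<^esub> z"] mnorm_J[OF x] smult_carrier
    by (simp add: function_mnorm_const_smult)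
next
  fix x y m n assume x: "x \<in> mats V m n" and y: "y \<in> mats V m n"
  have "mat_sum V x y \<in> mats V m n"
    using x y by (intro matsI) (auto simp: mat_sum_def mats_entry)
  moreover have "map_mat J (mat_sum V x y) = map_mat J x + map_mat J y"
    using x y by (intro eq_matI) (auto simp: mat_sum_def J_add mats_entry)
  ultimately show "mnorm V (mat_sum V x y) \<le> mnorm V x + mnorm V y"
    using function_mnorm_add[of "map_mat J x" m n "map_mat J y"] x y
    by (simp add: mnorm_J mats_carrier)
next
  fix x y m n p q assume x: "x \<in> mats V m n" and y: "y \<in> mats V p q"
  have "mat_diag_sum V x y \<in> mats V (m + p) (n + q)"
    using x y by (intro matsI) (auto simp: mat_diag_sum_def mats_entry mats_carrier)
  moreover have "map_mat J (mat_diag_sum V x y) = four_block_mat (map_mat J x) (0\<^sub>m m q) (0\<^sub>m p n) (map_mat J y)"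
    using x y by (intro eq_matI) (auto simp: mat_diag_sum_def)
  ultimately show "mnorm V (mat_diag_sum V x y) = max (mnorm V x) (mnorm V y)"
    using x y by (simp add: mnorm_J function_mnorm_diag[of _ m n _ p q] mats_carrier)
next
  fix \<alpha> \<beta> :: "complex mat" and x m n p q
  assume \<alpha>: "\<alpha> \<in> carrier_mat m p" and x: "x \<in> mats V p q" and \<beta>: "\<beta> \<in> carrier_mat q n"
  let ?y = "mat_prod V (\<lambda>c z. c \<odot>\<^bsub>V\<^esub> z) \<alpha> x"
  let ?a = "map_mat const_bcontfun \<alpha> :: 'w cfun mat" and ?b = "map_mat const_bcontfun \<beta> :: 'w cfun mat"
  have y: "?y \<in> mats V m q"
    using \<alpha> x by (intro mat_prod_mats[of _ _ p]) (auto dest: mats_carrier mats_elements intro: smult_carrier)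
  have z: "mat_prod V (\<lambda>z d. d \<odot>\<^bsub>V\<^esub> z) ?y \<beta> \<in> mats V m n"
    using \<beta> y by (intro mat_prod_mats[of _ _ q]) (auto dest: mats_carrier mats_elements intro: smult_carrier)
  have "map_mat J (mat_prod V (\<lambda>z d. d \<odot>\<^bsub>V\<^esub> z) ?y \<beta>) = map_mat J ?y * ?b"
    using \<beta> y by (intro map_J_mat_prod) (auto dest: mats_elements intro: smult_carrier simp: J_smult mult.commute)
  moreover have "map_mat J ?y = ?a * map_mat J x"
    using \<alpha> x by (intro map_J_mat_prod) (auto dest: mats_elements intro: smult_carrier simp: J_smult)
  ultimately have "mnorm V (mat_prod V (\<lambda>z d. d \<odot>\<^bsub>V\<^esub> z) ?y \<beta>)
      = function_mnorm (?a * map_mat J x * ?b)"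
    unfolding mnorm_J[OF z] by simp
  also have "\<dots> \<le> function_mnorm (?a * map_mat J x) * function_mnorm (?b)"
    using \<alpha> \<beta> x by (intro function_mnorm_mult[of _ m q _ n]) (auto dest: mats_carrier)
  also have "\<dots> \<le> (cmat_norm \<alpha> * function_mnorm (map_mat J x)) * cmat_norm \<beta>"
  proof (intro mult_mono function_mnorm_const_le)
    have "function_mnorm (?a * map_mat J x)
        \<le> function_mnorm (?a) * function_mnorm (map_mat J x)"
      using \<alpha> x by (intro function_mnorm_mult) (auto dest: mats_carrier)
    also have "\<dots> \<le> cmat_norm \<alpha> * function_mnorm (map_mat J x)"
      by (intro mult_right_mono function_mnorm_const_le function_mnorm_nonneg)
    finally show "function_mnorm (?a * map_mat J x) \<le> \<dots>" .
  qed (auto simp: cmat_norm_nonneg function_mnorm_nonneg)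
  finally show "mnorm V (mat_prod V (\<lambda>z d. d \<odot>\<^bsub>V\<^esub> z) ?y \<beta>) \<le> cmat_norm \<alpha> * mnorm V x * cmat_norm \<beta>"
    unfolding mnorm_J[OF x] .
qed

end

section \<open>Bimodules of functions\<close>

locale function_bimodule =
  function_representation V J + uniform_algebra A + unital_action A V "lact V"
  for A :: "'w::t2_space cfun set" and V :: "('w cfun, 'x) op_bimodule" (structure) and J :: "'x \<Rightarrow> 'w cfun" +
  assumes ract_eq: "ract V = (\<lambda>x a. lact V a x)"
    and J_lact: "a \<in> A \<Longrightarrow> x \<in> carrier V \<Longrightarrow> J (lact V a x) = a * J x"
begin

lemma operator_bimodule: "operator_bimodule A V"
proof (intro operator_bimodule.intro operator_bimodule_axioms.intro)
  show "operator_space V" by (rule operator_space)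
  show "unital_action A V (lact V)" by unfold_locales
  then show "unital_action A V (\<lambda>a x. ract V x a)" by (simp add: ract_eq)
  show "ract V (lact V a x) b = lact V a (ract V x b)" if "a \<in> A" "b \<in> A" "x \<in> carrier V" for a b x
    using that act_mult[of a b x] act_mult[of b a x] by (simp add: ract_eq mult.commute)
next
  fix M Z m p n assume M: "M \<in> mats (function_opspace A) m p" and Z: "Z \<in> mats V p n"
  have M': "a \<in> A" if "a \<in> elements_mat M" for a
    using M that by (auto simp: mats_def function_opspace_def)
  have "mat_prod V (lact V) M Z \<in> mats V m n"
    using M Z M' by (intro mat_prod_mats[of _ _ p]) (auto intro: act_closed dest: mats_carrier mats_elements)
  moreover have "map_mat J (mat_prod V (lact V) M Z) = map_mat (\<lambda>a. a) M * map_mat J Z"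
    using M Z M' by (intro map_J_mat_prod) (auto intro: act_closed dest: mats_elements simp: J_lact)
  moreover have "map_mat (\<lambda>a. a) M = M" by (rule eq_matI) auto
  ultimately show "mnorm V (mat_prod V (lact V) M Z) \<le> function_mnorm M * mnorm V Z"
    using function_mnorm_mult[of M m p "map_mat J Z" n] M Z by (simp add: mnorm_J mats_carrier)
next
  fix M Z m p n assume Z: "Z \<in> mats V m p" and M: "M \<in> mats (function_opspace A) p n"
  have M': "a \<in> A" if "a \<in> elements_mat M" for a
    using M that by (auto simp: mats_def function_opspace_def)
  have "mat_prod V (ract V) Z M \<in> mats V m n"
    unfolding ract_eq
    using M Z M' by (intro mat_prod_mats[of _ _ p]) (auto intro: act_closed dest: mats_carrier mats_elements)
  moreover have "map_mat J (mat_prod V (ract V) Z M) = map_mat J Z * map_mat (\<lambda>a. a) M"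
    unfolding ract_eq
    using M Z M' by (intro map_J_mat_prod) (auto intro: act_closed dest: mats_elements simp: J_lact mult.commute)
  moreover have "map_mat (\<lambda>a. a) M = M" by (rule eq_matI) auto
  ultimately show "mnorm V (mat_prod V (ract V) Z M) \<le> mnorm V Z * function_mnorm M"
    using function_mnorm_mult[of "map_mat J Z" m p M n] M Z by (simp add: mnorm_J mats_carrier)
qed

end

section \<open>Linear extension of a pairing to formal tensors, and pairings given by products of
  functions\<close>

definition tensor_lift :: "('x \<Rightarrow> 'y \<Rightarrow> 'w::t2_space cfun) \<Rightarrow> ('x, 'y) formal_tensor \<Rightarrow> 'w cfun" where
  "tensor_lift \<beta> u = (\<Sum>k\<in>Poly_Mapping.keys u. const_bcontfun (Poly_Mapping.lookup u k) * \<beta> (fst k) (snd k))"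

lemma const_bcontfun_simps [simp]:
  "const_bcontfun 0 = (0 :: 'w::topological_space \<Rightarrow>\<^sub>C complex)"
  "const_bcontfun 1 = (1 :: 'w::topological_space \<Rightarrow>\<^sub>C complex)"
  "const_bcontfun (a + b) = (const_bcontfun a + const_bcontfun b :: 'w::topological_space \<Rightarrow>\<^sub>C complex)"
  "const_bcontfun (a * b) = (const_bcontfun a * const_bcontfun b :: 'w::topological_space \<Rightarrow>\<^sub>C complex)"
  by (auto intro!: bcontfun_eqI)

lemma tensor_lift_superset:
  assumes "finite S" "Poly_Mapping.keys u \<subseteq> S"
  shows "tensor_lift \<beta> u = (\<Sum>k\<in>S. const_bcontfun (Poly_Mapping.lookup u k) * \<beta> (fst k) (snd k))"
  unfolding tensor_lift_def using assms by (intro sum.mono_neutral_left) (auto simp: in_keys_iff)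

lemma tensor_lift_add: "tensor_lift \<beta> (u + v) = tensor_lift \<beta> u + tensor_lift \<beta> v"
proof -
  let ?S = "Poly_Mapping.keys u \<union> Poly_Mapping.keys v"
  show ?thesis
    using Poly_Mapping.keys_add[of u v]
    by (simp add: tensor_lift_superset[of ?S] lookup_add distrib_right sum.distrib)
qed

lemma tensor_lift_scale: "tensor_lift \<beta> (formal_scale c u) = const_bcontfun c * tensor_lift \<beta> u"
proof -
  have "Poly_Mapping.keys (formal_scale c u) \<subseteq> Poly_Mapping.keys u"
    by (auto simp: in_keys_iff lookup_formal_scale)
  then show ?thesis
    by (simp add: tensor_lift_superset[of "Poly_Mapping.keys u"] lookup_formal_scale sum_distrib_left mult.assoc)
qed

lemma tensor_lift_zero [simp]: "tensor_lift \<beta> 0 = 0"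
  by (simp add: tensor_lift_def)

lemma tensor_lift_diff: "tensor_lift \<beta> (u - v) = tensor_lift \<beta> u - tensor_lift \<beta> v"
  using tensor_lift_add[of \<beta> "u - v" v] by simp

lemma tensor_lift_sum: "tensor_lift \<beta> (\<Sum>i\<in>I. f i) = (\<Sum>i\<in>I. tensor_lift \<beta> (f i))"
  by (induction I rule: infinite_finite_induct) (auto simp: tensor_lift_add)

lemma tensor_lift_elem [simp]: "tensor_lift \<beta> (formal_elem x y) = \<beta> x y"
  by (simp add: tensor_lift_def formal_elem_def)

text \<open>The abstract form of the pair \<open>A f\<close> and its inverse bimodule. All
  quantitative content sits in \<open>approx_unit\<close>, which provides the lifts for the quotient
  maps as well as the rank one elements; the conditions are symmetric in \<open>X\<close> and
  \<open>Y\<close>, so the second pairing needs no separate proof.\<close>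

locale function_pairing =
  X: function_bimodule A X J + Y: function_bimodule A Y K
  for A :: "'w::t2_space cfun set"
    and X :: "('w cfun, 'x) op_bimodule" and J :: "'x \<Rightarrow> 'w cfun"
    and Y :: "('w cfun, 'y) op_bimodule" and K :: "'y \<Rightarrow> 'w cfun" +
  assumes prod_mem: "x \<in> carrier X \<Longrightarrow> y \<in> carrier Y \<Longrightarrow> J x * K y \<in> A"
    and approx_unit: "0 < \<epsilon> \<Longrightarrow> \<exists>x\<in>carrier X. \<exists>y\<in>carrier Y.
      J x * K y = 1 \<and> norm (J x) < 1 + \<epsilon> \<and> norm (K y) < 1 + \<epsilon>"
begin

sublocale operator_space_pair X Y
  by (intro operator_space_pair.intro X.operator_space Y.operator_space)

abbreviation "\<beta> x y \<equiv> J x * K y"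

text \<open>The pairing is bilinear, so it kills every generator of the relations; hence the lift
  depends only on the class of a formal tensor.\<close>

lemma tensor_lift_relations:
  assumes "u \<in> tensor_relations X Y"
  shows "tensor_lift \<beta> u = 0"
  using assms unfolding tensor_relations_def
proof (rule formal.span_induct)
  show "formal.subspace {u. tensor_lift \<beta> u = 0}"
    by (rule formal.subspaceI) (auto simp: tensor_lift_add tensor_lift_scale)
qed (auto simp: tensor_lift_diff tensor_lift_scale X.J_add Y.J_add X.J_smult Y.J_smult
    distrib_left distrib_right mult.left_commute mult.assoc)

lemma tensor_lift_rep:
  assumes "rep U x y"
  shows "map_mat (tensor_lift \<beta>) U = map_mat J x * map_mat K y"
proof -
  obtain p where xy: "x \<in> mats X (dim_row U) p" "y \<in> mats Y p (dim_col U)"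
    using assms unfolding tensor_rep_def by auto
  have "tensor_lift \<beta> (U $$ (i, j)) = (\<Sum>k<p. J (x $$ (i, k)) * K (y $$ (k, j)))"
    if "i < dim_row U" "j < dim_col U" for i j
  proof -
    have "tensor_lift \<beta> (U $$ (i, j) - (\<Sum>k<p. formal_elem (x $$ (i, k)) (y $$ (k, j)))) = 0"
      using assms that xy unfolding tensor_rep_def by (intro tensor_lift_relations) auto
    then show ?thesis by (simp add: tensor_lift_diff tensor_lift_sum)
  qed
  then show ?thesis
    using xy by (intro eq_matI) (auto simp: scalar_prod_def atLeast0LessThan)
qed

text \<open>A factorization \<open>x \<odot> y\<close> is sent to an honest product of matrices of
  functions, so the bound is submultiplicativity of \<open>function_mnorm\<close>, followed by the
  infimum over factorizations.\<close>

lemma tensor_lift_contractive: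
  assumes "U \<in> carrier_mat m n" "elements_mat U \<subseteq> formal_tensors X Y"
  shows "function_mnorm (map_mat (tensor_lift \<beta>) U) \<le> haag U"
proof -
  obtain x0 y0 where "rep U x0 y0" using rep_exists[OF assms] by auto
  then show ?thesis
  proof (rule le_haag)
    fix x y assume r: "rep U x y"
    then obtain p where xy: "x \<in> mats X (dim_row U) p" "y \<in> mats Y p (dim_col U)"
      unfolding tensor_rep_def by auto
    then show "function_mnorm (map_mat (tensor_lift \<beta>) U) \<le> mnorm X x * mnorm Y y"
      unfolding tensor_lift_rep[OF r] X.mnorm_J[OF xy(1)] Y.mnorm_J[OF xy(2)]
      by (intro function_mnorm_mult[of _ "dim_row U" p _ "dim_col U"]) (auto dest: mats_carrier)
  qed
qed

lemma tensor_lift_mem: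
  assumes "u \<in> formal_tensors X Y"
  shows "tensor_lift \<beta> u \<in> A"
  using assms
proof (induction rule: formal_tensors_induct)
  case zero
  then show ?case using X.const_mem[of 0] by simp
next
  case (add u c x y)
  then show ?case
    by (simp add: tensor_lift_add tensor_lift_scale X.add_mem X.mult_mem X.const_mem prod_mem)
qed

lemma tensor_lift_surj:
  assumes Z: "Z \<in> mats (function_opspace A) n n" and lt: "function_mnorm Z < 1"
  shows "\<exists>U\<in>carrier_mat n n. elements_mat U \<subseteq> formal_tensors X Y \<and> haag U < 1 \<and> map_mat (tensor_lift \<beta>) U = Z"
proof -
  let ?z = "function_mnorm Z"
  have z: "0 \<le> ?z" by (rule function_mnorm_nonneg)
  \<comment> \<open>The square of \<open>1 + \<epsilon>\<close> is \<open>2 / (1 + ?z)\<close>.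
    Multiplied by \<open>?z\<close> this gives \<open>2 ?z / (1 + ?z)\<close>, which stays below 1
    because \<open>?z < 1\<close>.\<close>
  define \<epsilon> where "\<epsilon> = sqrt (2 / (1 + ?z)) - 1"
  have \<epsilon>: "0 < \<epsilon>" using lt z unfolding \<epsilon>_def by simp
  then obtain x0 y0 where x0: "x0 \<in> carrier X" and y0: "y0 \<in> carrier Y" and one: "J x0 * K y0 = 1"
    and nx: "norm (J x0) < 1 + \<epsilon>" and ny: "norm (K y0) < 1 + \<epsilon>"
    using approx_unit by blast
  have ZA: "Z $$ (i, j) \<in> A" if "i < n" "j < n" for i j
    using mats_entry[OF Z that] by (simp add: function_opspace_def)
  define x where "x = map_mat (\<lambda>a. lact X a x0) Z"
  \<comment> \<open>The factorization is \<open>Z x0\<close> times the diagonal matrix with entries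
    \<open>y0\<close>. The off-diagonal summands are elementary tensors with a zero factor, so they
    vanish only modulo relations.\<close>
  define y where "y = mat n n (\<lambda>(i, j). if i = j then y0 else \<zero>\<^bsub>Y\<^esub>)"
  define U where "U = map_mat (\<lambda>a. formal_elem (lact X a x0) y0) Z"
  have x: "x \<in> mats X n n" unfolding x_def
    by (rule mats_map[OF Z]) (auto intro: X.act_closed x0 simp: function_opspace_def)
  have y: "y \<in> mats Y n n" unfolding y_def using y0 by (intro matsI) auto
  have U: "U \<in> carrier_mat n n" unfolding U_def using Z by (auto dest: mats_carrier)
  have el: "elements_mat U \<subseteq> formal_tensors X Y"
    unfolding U_def using Z x0 y0
    by (auto intro!: formal_elem_mem X.act_closed simp: mats_def function_opspace_def)
  have "U $$ (i, j) - (\<Sum>k<n. formal_elem (x $$ (i, k)) (y $$ (k, j))) \<in> tensor_relations X Y"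
    if ij: "i < n" "j < n" for i j
  proof -
    have "(\<Sum>k<n. formal_elem (x $$ (i, k)) (y $$ (k, j)))
        = formal_elem (x $$ (i, j)) (y $$ (j, j)) + (\<Sum>k\<in>{..<n} - {j}. formal_elem (x $$ (i, k)) (y $$ (k, j)))"
      using ij by (intro sum.remove) auto
    moreover have "formal_elem (x $$ (i, j)) (y $$ (j, j)) = U $$ (i, j)"
      using ij Z by (simp add: x_def y_def U_def)
    moreover have "(\<Sum>k\<in>{..<n} - {j}. formal_elem (x $$ (i, k)) (y $$ (k, j))) \<in> tensor_relations X Y"
      using ij mats_entry[OF x] by (intro formal.subspace_sum[OF relations_subspace]) (auto simp: y_def intro!: elem_zero_right)
    ultimately show ?thesis
      using formal.subspace_neg[OF relations_subspace] by simp
  qed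
  then have r: "rep U x y" unfolding tensor_rep_def using x y U by auto
  have Jx: "map_mat J x = Z * (J x0 \<cdot>\<^sub>m 1\<^sub>m n)"
  proof -
    have "map_mat J x = J x0 \<cdot>\<^sub>m Z"
      unfolding x_def using Z x0 ZA by (intro eq_matI) (auto simp: X.J_lact mult.commute)
    also have "\<dots> = Z * (J x0 \<cdot>\<^sub>m 1\<^sub>m n)"
      using Z by (auto dest!: mats_carrier simp: mult_smult_distrib[of Z n n "1\<^sub>m n" n])
    finally show ?thesis .
  qed
  have Ky: "map_mat K y = K y0 \<cdot>\<^sub>m 1\<^sub>m n"
    unfolding y_def by (intro eq_matI) auto
  have "mnorm X x \<le> ?z * norm (J x0)"
    unfolding X.mnorm_J[OF x] Jx
    using function_mnorm_mult[of Z n n "J x0 \<cdot>\<^sub>m 1\<^sub>m n" n] mats_carrier[OF Z]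
      mult_left_mono[OF function_mnorm_smult_one_le z, of "J x0" n] by simp
  moreover have "mnorm Y y \<le> norm (K y0)"
    unfolding Y.mnorm_J[OF y] Ky by (rule function_mnorm_smult_one_le)
  ultimately have "haag U \<le> (?z * norm (J x0)) * norm (K y0)"
    using haag_le[OF r] mult_mono[of "mnorm X x" "?z * norm (J x0)" "mnorm Y y" "norm (K y0)"]
      Y.mnorm_J[OF y] function_mnorm_nonneg[of "map_mat K y"] z by fastforce
  also have "?z * norm (J x0) * norm (K y0) \<le> ?z * (1 + \<epsilon>) * (1 + \<epsilon>)"
    using nx ny z \<epsilon> by (intro mult_mono) auto
  also have "\<dots> = ?z * (2 / (1 + ?z))"
    unfolding \<epsilon>_def using z by (simp add: mult.assoc)
  also have "\<dots> < 1" using z lt by (simp add: field_simps)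
  finally have "haag U < 1" .
  moreover have "map_mat (tensor_lift \<beta>) U = Z"
    using Z x0 y0 ZA one by (intro eq_matI) (auto simp: U_def X.J_lact mult.assoc)
  ultimately show ?thesis using U el by blast
qed

lemma quotient: "induces_complete_quotient X Y (function_opspace A) \<beta>"
proof -
  interpret matrix_seminorm "formal_tensors X Y" formal_scale haag
    by (rule haag_matrix_seminorm)
  have "\<exists>T. (\<forall>u\<in>formal_tensors X Y. T (null_relation (formal_tensors X Y) haag `` {\<lambda>_. u}) = tensor_lift \<beta> u) \<and>
      complete_quotient_map (X \<otimes>\<^sub>h Y) (function_opspace A) T"
    unfolding haagerup_tensor_def
    by (rule complete_quotient_completion)
      (rule X.closed tensor_lift_mem tensor_lift_add tensor_lift_scale tensor_lift_contractive tensor_lift_surj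
        | assumption)+
  then obtain T where "\<And>u. u \<in> formal_tensors X Y \<Longrightarrow>
      T (null_relation (formal_tensors X Y) haag `` {\<lambda>_. u}) = tensor_lift \<beta> u"
    "complete_quotient_map (X \<otimes>\<^sub>h Y) (function_opspace A) T" by blast
  then show ?thesis
    unfolding induces_complete_quotient_def haagerup_elem_def
    by (intro exI[of _ T]) (auto simp: formal_elem_mem)
qed

lemma balanced: "balanced_pairing A X Y \<beta>"
  by unfold_locales
    (auto simp: prod_mem X.J_add Y.J_add X.J_smult Y.J_smult X.J_lact Y.J_lact X.ract_eq Y.ract_eq algebra_simps)

lemma flip: "function_pairing A Y K X J"
  by unfold_locales (use prod_mem approx_unit in \<open>auto simp: mult.commute\<close>, metis mult.commute)

lemma strong_morita_context: "strong_morita_context A X Y \<beta> (\<lambda>y x. K y * J x)"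
proof -
  interpret flip: function_pairing A Y K X J by (rule flip)
  show ?thesis
  proof (intro strong_morita_context.intro strong_morita_context_axioms.intro)
    show "operator_bimodule A X" "operator_bimodule A Y"
      by (rule X.operator_bimodule Y.operator_bimodule)+
    show "balanced_pairing A X Y \<beta>" "balanced_pairing A Y X flip.\<beta>"
      by (rule balanced flip.balanced)+
    show "induces_complete_quotient X Y (function_opspace A) \<beta>"
      "induces_complete_quotient Y X (function_opspace A) flip.\<beta>"
      by (rule quotient flip.quotient)+
    \<comment> \<open>Under the injective map \<open>J\<close> both sides become
      \<open>J x * K y * J x'\<close>: associativity of the pairings is commutativity of the product
      of functions.\<close>
    show "lact X (\<beta> x y) x' = ract X x (K y * J x')" if "x \<in> carrier X" "y \<in> carrier Y" "x' \<in> carrier X" for x y x'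
      using that prod_mem flip.prod_mem
      by (intro X.J_inj) (auto simp: X.ract_eq X.J_lact X.act_closed algebra_simps)
    show "lact Y (K y * J x) y' = ract Y y (\<beta> x y')" if "y \<in> carrier Y" "x \<in> carrier X" "y' \<in> carrier Y" for x y y'
      using that prod_mem flip.prod_mem
      by (intro Y.J_inj) (auto simp: Y.ract_eq Y.J_lact Y.act_closed algebra_simps)
  qed
qed

end

section \<open>Submodules of continuous functions\<close>

lemma cring_complex_ring: "cring complex_ring"
proof (intro cringI abelian_groupI comm_monoidI)
  show "\<exists>y\<in>carrier complex_ring. y \<oplus>\<^bsub>complex_ring\<^esub> x = \<zero>\<^bsub>complex_ring\<^esub>" for x
    by (rule bexI[of _ "- x"]) auto
qed (auto simp: algebra_simps)

lemma norm_cfun_mult_le: "norm (f * g) \<le> norm f * norm (g :: 'w::topological_space \<Rightarrow>\<^sub>C complex)"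
proof (rule norm_bound)
  fix w
  show "cmod (apply_bcontfun (f * g) w) \<le> norm f * norm g"
    by (simp add: norm_mult mult_mono norm_bounded)
qed

lemma norm_const_mult: "norm (const_bcontfun c * f) = cmod c * norm (f :: 'w::t2_space cfun)"
proof -
  have "const_bcontfun c \<cdot>\<^sub>m mat1 f = mat1 (const_bcontfun c * f)"
    by (rule eq_matI) (auto simp: mat1_def)
  then show ?thesis
    using function_mnorm_const_smult[of c "mat1 f"] by (simp add: function_mnorm_mat1)
qed

lemma tendsto_cfun_mult_right:
  fixes f :: "nat \<Rightarrow> 'w::topological_space \<Rightarrow>\<^sub>C complex"
  assumes "f \<longlonglongrightarrow> l"
  shows "(\<lambda>n. f n * g) \<longlonglongrightarrow> l * g"
proof -
  have le: "norm (f n * g - l * g) \<le> norm (f n - l) * norm g" for n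
    using norm_cfun_mult_le[of "f n - l" g] by (simp only: left_diff_distrib)
  have "(\<lambda>n. norm (f n - l) * norm g) \<longlonglongrightarrow> 0"
    using tendsto_norm_zero[OF LIM_zero[OF assms]] by (intro tendsto_mult_left_zero)
  then have "(\<lambda>n. f n * g - l * g) \<longlonglongrightarrow> 0"
    by (rule Lim_null_comparison[rotated]) (simp add: le)
  then show ?thesis by (rule LIM_zero_cancel)
qed

text \<open>Off the carrier the addition is chosen such that the distance \<open>\<parallel>x \<ominus> y\<parallel>\<close> is symmetric on the whole
  type, which \<^locale>\<open>Metric_space\<close> requires.\<close>

definition submodule :: "'w::t2_space cfun set \<Rightarrow> ('w cfun, 'w cfun) op_bimodule" where
  "submodule S = (let p = (\<lambda>u. if u \<in> S then u else 0) in
    \<lparr>carrier = S, mult = undefined, one = undefined, zero = 0, add = (\<lambda>u v. p u + p v),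
     smult = (\<lambda>c u. const_bcontfun c * u), mnorm = function_mnorm, lact = (*), ract = (\<lambda>u a. a * u)\<rparr>)"

lemma submodule_simps [simp]:
  "carrier (submodule S) = S" "\<zero>\<^bsub>submodule S\<^esub> = 0" "c \<odot>\<^bsub>submodule S\<^esub> u = const_bcontfun c * u"
  "mnorm (submodule S) = function_mnorm" "lact (submodule S) = (*)" "ract (submodule S) = (\<lambda>u a. a * u)"
  "u \<in> S \<Longrightarrow> v \<in> S \<Longrightarrow> u \<oplus>\<^bsub>submodule S\<^esub> v = u + v"
  by (simp_all add: submodule_def Let_def)

lemma bcontfun_uminus: "- f = const_bcontfun (-1) * (f :: 'b::topological_space \<Rightarrow>\<^sub>C complex)"
  by (rule bcontfun_eqI) simp

context uniform_algebra
begin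

lemma one_mem: "1 \<in> A" and zero_mem: "0 \<in> A"
  using const_mem[of 1] const_mem[of 0] by simp_all

lemma submodule_bimodule:
  assumes "closed S" and zero: "0 \<in> S" and add: "\<And>u v. u \<in> S \<Longrightarrow> v \<in> S \<Longrightarrow> u + v \<in> S"
    and act: "\<And>a u. a \<in> A \<Longrightarrow> u \<in> S \<Longrightarrow> a * u \<in> S"
  shows "function_bimodule A (submodule S) (\<lambda>u. u)"
proof -
  let ?V = "submodule S"
  define p where "p u = (if u \<in> S then u else 0)" for u
  have p_mem: "p u \<in> S" for u using zero by (simp add: p_def)
  have p_add: "u \<oplus>\<^bsub>?V\<^esub> v = p u + p v" for u v by (simp add: submodule_def Let_def p_def)
  have neg: "u \<in> S \<Longrightarrow> - u \<in> S" for u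
    using act[OF const_mem, of u "-1"] by (simp add: bcontfun_uminus)
  have grp: "abelian_group ?V"
  proof (rule abelian_groupI)
    show "\<exists>y\<in>carrier ?V. y \<oplus>\<^bsub>?V\<^esub> x = \<zero>\<^bsub>?V\<^esub>" if "x \<in> carrier ?V" for x
      using that neg[of x] by (intro bexI[of _ "- x"]) auto
  qed (auto simp: add zero add.assoc add.commute)
  have mod: "module complex_ring ?V"
    using act[OF const_mem]
    by (intro moduleI cring_complex_ring grp) (auto simp: add algebra_simps)
  \<comment> \<open>Computed for every \<open>v\<close>, on or off \<open>S\<close>:
    \<open>\<ominus>\<close> enters the distance, and symmetry of the distance is required for all
    points of the type.\<close>
  have inv: "\<ominus>\<^bsub>?V\<^esub> v = - p v" for v
    unfolding a_inv_def m_inv_def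
  proof (rule the_equality)
    show "- p v \<in> carrier (add_monoid ?V) \<and> v \<otimes>\<^bsub>add_monoid ?V\<^esub> - p v = \<one>\<^bsub>add_monoid ?V\<^esub> \<and>
        - p v \<otimes>\<^bsub>add_monoid ?V\<^esub> v = \<one>\<^bsub>add_monoid ?V\<^esub>"
      using neg[OF p_mem[of v]] by (simp add: p_add) (simp add: p_def)
    show "y = - p v" if "y \<in> carrier (add_monoid ?V) \<and> v \<otimes>\<^bsub>add_monoid ?V\<^esub> y = \<one>\<^bsub>add_monoid ?V\<^esub> \<and>
        y \<otimes>\<^bsub>add_monoid ?V\<^esub> v = \<one>\<^bsub>add_monoid ?V\<^esub>" for y
      using that by (simp add: p_add) (simp add: p_def eq_neg_iff_add_eq_0 split: if_splits)
  qed
  have minus: "u \<ominus>\<^bsub>?V\<^esub> v = p u - p v" for u v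
    using neg[OF p_mem[of v]] by (simp add: a_minus_def inv p_add) (simp add: p_def)
  have "Metric_space.mcomplete S (\<lambda>x y. norm (p x - p y))"
  proof -
    interpret Metric_space S "\<lambda>x y. norm (p x - p y)"
      by unfold_locales (auto simp: p_def norm_minus_commute intro: norm_diff_triangle_le)
    show ?thesis
      unfolding mcomplete_def
    proof (intro allI impI)
      fix \<sigma> assume c: "MCauchy \<sigma>"
      have \<sigma>: "\<sigma> n \<in> S" for n using c unfolding MCauchy_def by auto
      have "Cauchy \<sigma>"
        using c \<sigma> unfolding MCauchy_def Cauchy_iff by (auto simp: p_def)
      then obtain l where l: "\<sigma> \<longlonglongrightarrow> l"
        using bcontfun_Cauchy_convergent unfolding convergent_def by blast
      have "l \<in> S" by (rule closed_sequentially[OF assms(1) \<sigma> l])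
      moreover have "\<exists>N. \<forall>n\<ge>N. norm (\<sigma> n - l) < e" if "0 < e" for e
        using LIMSEQ_D[OF l that] .
      ultimately show "\<exists>x. limitin mtopology \<sigma> x sequentially"
        by (intro exI[of _ l]) (simp only: limit_metric_sequentially, simp add: \<sigma> p_def)
    qed
  qed
  then have banach: "complex_banach_space ?V (\<lambda>x. mnorm ?V (mat1 x))"
    by (intro complex_banach_space.intro mod complex_banach_space_axioms.intro)
      (simp_all add: function_mnorm_mat1 minus norm_triangle_ineq norm_const_mult)
  show ?thesis
  proof (intro function_bimodule.intro function_representation.intro banach
      function_representation_axioms.intro uniform_algebra_axioms function_bimodule_axioms.intro)
    show "unital_action A ?V (lact ?V)"
      by unfold_locales (auto simp: act add algebra_simps)
    show "mnorm ?V M = function_mnorm (map_mat (\<lambda>u. u) M)" for M m n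
      by (simp, rule arg_cong[of _ _ function_mnorm], rule eq_matI) auto
  qed auto
qed

end

section \<open>Invertible elements whose moduli approximate a positive function\<close>

lemma bcontfun_inverse:
  fixes f :: "'w::t2_space cfun"
  assumes "compact (UNIV :: 'w set)" "\<And>w. apply_bcontfun f w \<noteq> 0"
  obtains g where "f * g = 1"
proof -
  have "continuous_on UNIV (\<lambda>w. inverse (apply_bcontfun f w))"
    using assms(2) by (intro continuous_on_inverse) (auto intro: continuous_on_apply_bcontfun)
  moreover from this have "bounded (range (\<lambda>w. inverse (apply_bcontfun f w)))"
    using assms(1) by (intro compact_imp_bounded compact_continuous_image)
  ultimately have "(\<lambda>w. inverse (apply_bcontfun f w)) \<in> bcontfun"
    by (simp add: bcontfun_def)
  then have "f * Bcontfun (\<lambda>w. inverse (apply_bcontfun f w)) = 1"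
    using assms(2) by (intro bcontfun_eqI) (simp add: Bcontfun_inverse)
  then show thesis by (rule that)
qed

text \<open>\<open>h\<close> is invertible in \<open>A\<close> with modulus uniformly close to
  \<open>f\<close>. Multiplying by \<open>g\<close>, the inverse of \<open>f\<close>, turns this
  into \<open>cmod (h g)\<close> being close to 1, at the price of a factor \<open>norm g\<close>;
  then \<open>h' f\<close>, the pointwise inverse of \<open>h g\<close>, has modulus close to 1
  too.\<close>

lemma (in uniform_algebra) positive_closure_approx:
  assumes f: "f \<in> positive_closure (modulus_set A)" and fg: "f * g = 1" and \<epsilon>: "0 < \<epsilon>"
  obtains h h' where "h \<in> A" "h' \<in> A" "h * h' = 1" "norm (h * g) < 1 + \<epsilon>" "norm (h' * f) < 1 + \<epsilon>"
proof -
  \<comment> \<open>Chosen so that \<open>1 / (1 - \<eta>) = 1 + \<epsilon> / 2\<close>, the bound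
    for \<open>h' f\<close>, while \<open>1 + \<eta>\<close>, the bound for \<open>h g\<close>, is
    no larger. Halving \<epsilon> makes the final inequalities strict after passing to
    suprema.\<close>
  define \<eta> where "\<eta> = \<epsilon> / (2 + \<epsilon>)"
  have \<eta>: "0 < \<eta>" "\<eta> < 1" "\<eta> \<le> \<epsilon> / 2" "1 / (1 - \<eta>) = 1 + \<epsilon> / 2"
    unfolding \<eta>_def using \<epsilon> by (auto simp: field_simps)
  have "f \<in> closure (modulus_set A)" using f by (simp add: positive_closure_def)
  moreover have "0 < \<eta> / (norm g + 1)" using \<eta>(1) by (simp add: add_nonneg_pos)
  ultimately obtain q where q: "q \<in> modulus_set A" "dist q f < \<eta> / (norm g + 1)"
    unfolding closure_approachable by blast
  then obtain h h' where h: "h \<in> A" "h' \<in> A" "h * h' = 1" and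
    qh: "\<And>w. apply_bcontfun q w = complex_of_real (cmod (apply_bcontfun h w))"
    unfolding modulus_set_def by blast
  have fgw: "apply_bcontfun f w * apply_bcontfun g w = 1" for w
    using arg_cong[OF fg, of "\<lambda>f. apply_bcontfun f w"] by simp
  have hw: "apply_bcontfun h w * apply_bcontfun h' w = 1" for w
    using arg_cong[OF h(3), of "\<lambda>f. apply_bcontfun f w"] by simp
  have near: "\<bar>cmod (apply_bcontfun h w * apply_bcontfun g w) - 1\<bar> \<le> \<eta>" for w
  proof -
    let ?f = "apply_bcontfun f w" and ?g = "apply_bcontfun g w" and ?h = "apply_bcontfun h w"
    have "Im ?f = 0" "0 < Re ?f"
      using f unfolding positive_closure_def by (auto simp: complex_is_Real_iff)
    then have "?f = complex_of_real (cmod ?f)"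
      by (simp add: complex_eq_iff cmod_eq_Re)
    then have "cmod (complex_of_real (cmod ?h) - complex_of_real (cmod ?f)) \<le> norm (q - f)"
      using norm_bounded[of "q - f" w] by (simp add: qh)
    then have le: "\<bar>cmod ?h - cmod ?f\<bar> \<le> norm (q - f)"
      by (simp flip: of_real_diff)
    have "cmod ?f * cmod ?g = 1" using fgw[of w] by (metis norm_mult norm_one)
    then have "cmod (?h * ?g) - 1 = (cmod ?h - cmod ?f) * cmod ?g"
      by (simp add: norm_mult algebra_simps)
    then have "\<bar>cmod (?h * ?g) - 1\<bar> = \<bar>cmod ?h - cmod ?f\<bar> * cmod ?g"
      by (simp add: abs_mult)
    also have "\<dots> \<le> norm (q - f) * norm g"
      by (intro mult_mono le norm_bounded) auto
    also have "\<dots> \<le> \<eta> / (norm g + 1) * (norm g + 1)"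
      using q(2) \<eta>(1) by (intro mult_mono) (auto simp: dist_norm)
    also have "\<dots> = \<eta>" using norm_ge_zero[of g] by (simp del: norm_ge_zero)
    finally show ?thesis .
  qed
  show thesis
  proof
    have "norm (h * g) \<le> 1 + \<epsilon> / 2"
    proof (rule norm_bound)
      fix w show "cmod (apply_bcontfun (h * g) w) \<le> 1 + \<epsilon> / 2"
        using near[of w] \<eta>(3) by simp
    qed
    then show "norm (h * g) < 1 + \<epsilon>" using \<epsilon> by simp
    have "norm (h' * f) \<le> 1 + \<epsilon> / 2"
    proof (rule norm_bound)
      fix w
      let ?x = "cmod (apply_bcontfun h w * apply_bcontfun g w)" and ?y = "cmod (apply_bcontfun (h' * f) w)"
      have "apply_bcontfun h w * apply_bcontfun g w * apply_bcontfun (h' * f) w = 1"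
        using fgw[of w] hw[of w] by (simp add: algebra_simps)
      then have "?x * ?y = 1" by (metis norm_mult norm_one)
      moreover have "1 - \<eta> \<le> ?x" using near[of w] by simp
      ultimately have "(1 - \<eta>) * ?y \<le> 1" by (metis mult_right_mono norm_ge_zero)
      then have "?y \<le> 1 / (1 - \<eta>)" using \<eta>(2) by (simp add: pos_le_divide_eq mult.commute)
      then show "?y \<le> 1 + \<epsilon> / 2" unfolding \<eta>(4) .
    qed
    then show "norm (h' * f) < 1 + \<epsilon>" using \<epsilon> by simp
  qed (fact h)+
qed

section \<open>The symmetric bimodule of \<open>X\<close> and its minimal structure\<close>

lemma symmetric_bimodule_simps [simp]:
  "carrier (symmetric_bimodule X N) = carrier X" "\<zero>\<^bsub>symmetric_bimodule X N\<^esub> = \<zero>\<^bsub>X\<^esub>"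
  "(\<oplus>\<^bsub>symmetric_bimodule X N\<^esub>) = (\<oplus>\<^bsub>X\<^esub>)" "(\<odot>\<^bsub>symmetric_bimodule X N\<^esub>) = (\<odot>\<^bsub>X\<^esub>)"
  "mnorm (symmetric_bimodule X N) = N" "lact (symmetric_bimodule X N) = act X"
  "ract (symmetric_bimodule X N) = (\<lambda>x a. act X a x)"
  by (simp_all add: symmetric_bimodule_def)

text \<open>Since zero, addition and carrier are shared, subtraction is the same function on the
  entire type, also off the carrier; the completeness axiom therefore carries over
  literally.\<close>

lemma complex_banach_space_symmetric_bimodule:
  assumes "complex_banach_space X M"
  shows "complex_banach_space (symmetric_bimodule X N) M"
proof -
  interpret complex_banach_space X M by (rule assms)
  let ?V = "symmetric_bimodule X N"
  have "abelian_group ?V"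
  proof (rule abelian_groupI)
    show "\<exists>y\<in>carrier ?V. y \<oplus>\<^bsub>?V\<^esub> x = \<zero>\<^bsub>?V\<^esub>" if "x \<in> carrier ?V" for x
      using that M.l_neg[of x] by (intro bexI[of _ "\<ominus>\<^bsub>X\<^esub> x"]) auto
  qed (auto simp: M.a_ac)
  then have "module complex_ring ?V"
    using smult_l_distr smult_r_distr smult_assoc1 smult_one smult_closed
    by (intro moduleI cring_complex_ring) auto
  moreover have "a_minus ?V = a_minus X"
    by (simp add: fun_eq_iff a_minus_def a_inv_def m_inv_def)
  ultimately show ?thesis
    using norm_eq_0 norm_triangle norm_scale complete
    by (intro complex_banach_space.intro complex_banach_space_axioms.intro) auto
qed

lemma Hausdorff_space_euclidean_t2: "Hausdorff_space (euclidean :: 'a::t2_space topology)"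
  unfolding Hausdorff_space_def
  by (metis disjnt_def hausdorff open_openin)

text \<open>\<open>\<Omega>\<close> itself, transported along \<open>w \<mapsto> (x \<mapsto> T x w)\<close>, serves as the compact space of the
  minimal structure.\<close>

lemma minimal_structure_function_module:
  fixes T :: "'x \<Rightarrow> 'w::t2_space cfun" and X :: "('w cfun, 'x) normed_module"
  assumes compact: "compact (UNIV :: 'w set)"
    and add: "\<And>x y. x \<in> carrier X \<Longrightarrow> y \<in> carrier X \<Longrightarrow> T (x \<oplus>\<^bsub>X\<^esub> y) = T x + T y"
    and smult: "\<And>c x. x \<in> carrier X \<Longrightarrow> T (c \<odot>\<^bsub>X\<^esub> x) = const_bcontfun c * T x"
    and norm: "\<And>x. x \<in> carrier X \<Longrightarrow> norm (T x) = nrm X x"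
    and sep: "\<And>v w. v \<noteq> w \<Longrightarrow> \<exists>x\<in>carrier X. apply_bcontfun (T x) v \<noteq> apply_bcontfun (T x) w"
    and N: "\<And>m n M. M \<in> mats X m n \<Longrightarrow> N M = function_mnorm (map_mat T M)"
  shows "minimal_structure X N"
proof -
  define \<Phi> where "\<Phi> w = (\<lambda>x. apply_bcontfun (T x) w)" for w
  have inj: "inj \<Phi>"
  proof (rule injI)
    fix v w assume "\<Phi> v = \<Phi> w"
    then show "v = w" using sep[of v w] unfolding \<Phi>_def by metis
  qed
  \<comment> \<open>With the topology pulled back along the inverse of \<open>\<Phi>\<close>, the
    map \<open>\<Phi>\<close> is a homeomorphism onto \<open>K\<close>; injectivity, and hence the
    separation assumption, is what makes this inverse available.\<close>
  define K where "K = pullback_topology (range \<Phi>) (inv_into UNIV \<Phi>) euclidean"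
  define j where "j x = apply_bcontfun (T x) \<circ> inv_into UNIV \<Phi>" for x
  have top: "topspace K = range \<Phi>" unfolding K_def by (auto simp: topspace_pullback_topology)
  have inv: "inv_into UNIV \<Phi> (\<Phi> w) = w" for w by (rule inv_f_f[OF inj])
  have jw: "j x (\<Phi> w) = apply_bcontfun (T x) w" for x w by (simp add: j_def inv)
  have "continuous_map euclidean K \<Phi>"
    unfolding K_def
  proof (rule continuous_map_pullback')
    have "inv_into UNIV \<Phi> \<circ> \<Phi> = id" by (auto simp: inv)
    then show "continuous_map euclidean euclidean (inv_into UNIV \<Phi> \<circ> \<Phi>)" by simp
  qed auto
  then have "compactin K (\<Phi> ` UNIV)"
    using compact by (intro image_compactin[of euclidean]) auto
  then have 1: "Abstract_Topology.compact_space K" by (simp add: compact_space_def top)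
  have "continuous_map K euclidean (id \<circ> inv_into UNIV \<Phi>)"
    unfolding K_def by (rule continuous_map_pullback) simp
  then have "continuous_map K euclidean (inv_into UNIV \<Phi>)" by simp
  moreover have "inj_on (inv_into UNIV \<Phi>) (topspace K)"
    unfolding top by (rule inj_onI) (auto simp: inv)
  ultimately have 2: "Hausdorff_space K"
    by (rule Hausdorff_space_injective_preimage[OF Hausdorff_space_euclidean_t2])
  have 3: "continuous_map K euclidean (j x)" for x
    unfolding K_def j_def by (rule continuous_map_pullback) (auto intro: continuous_on_apply_bcontfun)
  have 4: "(SUP k\<in>topspace K. cmod (j x k)) = nrm X x" if "x \<in> carrier X" for x
  proof -
    have "(SUP k\<in>topspace K. cmod (j x k)) = (SUP w. cmod (apply_bcontfun (T x) w))"
      unfolding top image_image jw ..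
    also have "\<dots> = function_mnorm (mat1 (T x))"
      by (simp add: function_mnorm_def cmat_norm_mat1)
    finally show ?thesis using norm[OF that] by (simp add: function_mnorm_mat1)
  qed
  have 5: "N M = (SUP k\<in>topspace K. cmat_norm (map_mat (\<lambda>x. j x k) M))" if "M \<in> mats X m n" for m n M
  proof -
    have "map_mat (\<lambda>f. apply_bcontfun f w) (map_mat T M) = map_mat (\<lambda>x. j x (\<Phi> w)) M" for w
      unfolding jw by (rule eq_matI) auto
    then show ?thesis unfolding N[OF that] function_mnorm_def top image_image by simp
  qed
  show ?thesis
    unfolding minimal_structure_def
    by (intro exI[of _ K] exI[of _ j] conjI ballI allI 1 2 3 4 5; assumption?)
      (auto simp: top jw add smult)
qed

lemma A_isometric_imp_rank_one:
  fixes A :: "'w::t2_space cfun set" and X :: "('w cfun, 'x) normed_module"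
  assumes A: "uniform_algebra A" and X: "banach_module A X"
    and f: "f \<in> positive_closure (modulus_set A)"
    and iso: "A_isometric A X (function_module {a * f | a. a \<in> A})"
  shows "\<exists>N. minimal_structure X N \<and> rank_one_strong_morita TYPE('w cfun) A (symmetric_bimodule X N)"
proof -
  interpret uniform_algebra A by (rule A)
  interpret X: banach_module A X by (rule X)
  let ?S = "{a * f | a. a \<in> A}"
  obtain T where bij: "bij_betw T (carrier X) ?S"
    and T_add: "\<And>x y. x \<in> carrier X \<Longrightarrow> y \<in> carrier X \<Longrightarrow> T (x \<oplus>\<^bsub>X\<^esub> y) = T x + T y"
    and T_smult: "\<And>c x. x \<in> carrier X \<Longrightarrow> T (c \<odot>\<^bsub>X\<^esub> x) = const_bcontfun c * T x"
    and T_act: "\<And>a x. a \<in> A \<Longrightarrow> x \<in> carrier X \<Longrightarrow> T (act X a x) = a * T x"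
    and T_norm: "\<And>x. x \<in> carrier X \<Longrightarrow> norm (T x) = nrm X x"
    using iso unfolding A_isometric_def module_iso_def function_module_def by auto
  have T_mem: "T x \<in> ?S" if "x \<in> carrier X" for x
    using bij that by (auto simp: bij_betw_def)
  have T_surj: "\<exists>x\<in>carrier X. T x = a * f" if "a \<in> A" for a
  proof -
    have "a * f \<in> T ` carrier X" using bij that unfolding bij_betw_def by blast
    then show ?thesis by auto
  qed
  have f_nz: "apply_bcontfun f w \<noteq> 0" for w
    using f unfolding positive_closure_def by (auto dest: spec[of _ w])
  obtain g where fg: "f * g = 1" by (rule bcontfun_inverse[OF compact_space f_nz])
  then have gf: "g * f = 1" by (simp add: mult.commute)

  \<comment> \<open>On \<open>1 \<times> 1\<close> matrices \<open>N\<close> is \<open>nrm X\<close> even off the carrier: the distance in the completeness axiom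
    is a function on the whole type, and this makes it the same one as for \<open>X\<close>.\<close>
  define N where "N M = (if dim_row M = 1 \<and> dim_col M = 1 then nrm X (M $$ (0, 0))
    else function_mnorm (map_mat T M))" for M
  have N1: "N (mat1 x) = nrm X x" for x by (simp add: N_def)
  have N: "N M = function_mnorm (map_mat T M)" if M: "M \<in> mats X m n" for M m n
  proof (cases "m = 1 \<and> n = 1")
    case True
    then obtain x where "x \<in> carrier X" "M = mat1 x" using M mats_1_1[of M X] by auto
    then show ?thesis by (simp add: N1 T_norm function_mnorm_mat1)
  qed (use M in \<open>auto simp: N_def\<close>)
  let ?X = "symmetric_bimodule X N"
  have X': "function_bimodule A ?X T"
  proof (intro function_bimodule.intro function_representation.intro function_representation_axioms.intro
      uniform_algebra_axioms function_bimodule_axioms.intro)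
    show "complex_banach_space ?X (\<lambda>x. mnorm ?X (mat1 x))"
      using complex_banach_space_symmetric_bimodule[OF X.complex_banach_space_axioms] by (simp add: N1)
    show "unital_action A ?X (lact ?X)"
      by unfold_locales
        (auto simp: X.act_closed X.act_add_left X.act_add_right X.act_scale_left X.act_scale_right
          X.act_mult X.act_one)
    show "mnorm ?X M = function_mnorm (map_mat T M)" if "M \<in> mats ?X m n" for M m n
      using N[of M m n] that by (simp add: mats_def)
  qed (auto simp: T_add T_smult T_act)

  define S where "S = {a * g | a. a \<in> A}"
  \<comment> \<open>As a preimage of \<open>A\<close> under multiplication by \<open>f\<close>, the
    set \<open>S\<close> inherits closedness and the module property from \<open>A\<close>.\<close>
  have S_eq: "S = (\<lambda>y. y * f) -` A"
  proof
    show "S \<subseteq> (\<lambda>y. y * f) -` A" unfolding S_def by (auto simp: mult.assoc gf)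
    have "y = y * f * g" for y by (simp add: mult.assoc fg)
    then show "(\<lambda>y. y * f) -` A \<subseteq> S" unfolding S_def by blast
  qed
  have "closed S"
    unfolding closed_sequential_limits
  proof (intro allI impI)
    fix s l assume "(\<forall>n. s n \<in> S) \<and> s \<longlonglongrightarrow> l"
    then have "\<And>n. s n * f \<in> A" "(\<lambda>n. s n * f) \<longlonglongrightarrow> l * f"
      by (auto simp: S_eq intro: tendsto_cfun_mult_right)
    then show "l \<in> S" using closed_sequentially[OF closed, of "\<lambda>n. s n * f" "l * f"] by (simp add: S_eq)
  qed
  then have Y': "function_bimodule A (submodule S) (\<lambda>u. u)"
    by (rule submodule_bimodule)
      (auto simp: S_eq zero_mem distrib_right mult.assoc intro: add_mem mult_mem)
  let ?Y = "submodule S"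

  have "function_pairing A ?X T ?Y (\<lambda>u. u)"
  proof (intro function_pairing.intro X' Y' function_pairing_axioms.intro)
    fix x y assume "x \<in> carrier ?X" "y \<in> carrier ?Y"
    then obtain a b where "a \<in> A" "b \<in> A" "T x = a * f" "y = b * g"
      using T_mem[of x] unfolding S_def by force
    then have "T x * y = a * b * (f * g)" by (simp add: mult.left_commute mult.assoc)
    then show "T x * y \<in> A" using \<open>a \<in> A\<close> \<open>b \<in> A\<close> by (simp add: fg mult_mem)
  next
    fix \<epsilon> :: real assume "0 < \<epsilon>"
    from positive_closure_approx[OF f fg this] obtain h h' where
      h: "h \<in> A" "h' \<in> A" "h * h' = 1" "norm (h * g) < 1 + \<epsilon>" "norm (h' * f) < 1 + \<epsilon>" .
    obtain x where x: "x \<in> carrier X" "T x = h' * f" using T_surj[OF h(2)] by auto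
    have "T x * (h * g) = (h * h') * (f * g)" unfolding x(2) by (simp add: algebra_simps)
    then have "T x * (h * g) = 1" by (simp add: h fg)
    moreover have "h * g \<in> S" using h(1) unfolding S_def by blast
    ultimately show "\<exists>x\<in>carrier ?X. \<exists>y\<in>carrier ?Y. T x * y = 1 \<and> norm (T x) < 1 + \<epsilon> \<and> norm y < 1 + \<epsilon>"
      using x h by (intro bexI[of _ x] bexI[of _ "h * g"]) auto
  qed
  then interpret P: function_pairing A ?X T ?Y "\<lambda>u. u" .

  have min: "minimal_structure X N"
  proof (rule minimal_structure_function_module[OF compact_space T_add T_smult T_norm _ N])
    fix v w :: 'w assume "v \<noteq> w"
    then obtain a where a: "a \<in> A" "apply_bcontfun a v \<noteq> apply_bcontfun a w"
      using separates_points by blast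
    obtain x where x: "x \<in> carrier X" "T x = a * f" using T_surj[OF a(1)] by auto
    \<comment> \<open>\<open>a * f\<close> may agree at \<open>v\<close> and \<open>w\<close>
      although \<open>a\<close> does not. Then \<open>f\<close> itself separates the two points:
      otherwise \<open>f\<close>, having no zero, could be cancelled.\<close>
    obtain y where y: "y \<in> carrier X" "T y = 1 * f" using T_surj[OF one_mem] by auto
    show "\<exists>x\<in>carrier X. apply_bcontfun (T x) v \<noteq> apply_bcontfun (T x) w"
    proof (rule ccontr)
      assume "\<not> ?thesis"
      then have "apply_bcontfun (T x) v = apply_bcontfun (T x) w" "apply_bcontfun (T y) v = apply_bcontfun (T y) w"
        using x y by auto
      then show False using a(2) f_nz[of w] by (simp add: x y)
    qed
  qed assumption+
  have units: "\<exists>x'\<in>carrier ?X. \<exists>y'\<in>carrier ?Y. T x' * y' = 1 \<and>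
      \<bar>mnorm ?X (mat1 x') - 1\<bar> < \<epsilon> \<and> \<bar>mnorm ?Y (mat1 y') - 1\<bar> < \<epsilon>" if \<epsilon>: "0 < \<epsilon>" for \<epsilon>
  proof -
    obtain x y where x: "x \<in> carrier ?X" and y: "y \<in> carrier ?Y" and one: "T x * y = 1"
      and lt: "norm (T x) < 1 + \<epsilon>" "norm y < 1 + \<epsilon>"
      using P.approx_unit[OF \<epsilon>] by blast
    \<comment> \<open>\<open>approx_unit\<close> bounds the norms only from above, but rank one asks
      for norms near 1 from both sides. As the product is 1 and each factor is below
      \<open>1 + \<epsilon>\<close>, the other is at least \<open>1 / (1 + \<epsilon>)\<close>,
      which exceeds \<open>1 - \<epsilon>\<close>.\<close>
    have "1 \<le> norm (T x) * norm y"
      using norm_cfun_mult_le[of "T x" y] norm_bounded[of "1 :: 'w cfun"] unfolding one by simp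
    moreover have "norm (T x) * norm y \<le> norm (T x) * (1 + \<epsilon>)" "norm (T x) * norm y \<le> (1 + \<epsilon>) * norm y"
      using lt by (auto intro: mult_left_mono mult_right_mono)
    ultimately have "1 / (1 + \<epsilon>) \<le> norm (T x)" "1 / (1 + \<epsilon>) \<le> norm y"
      using \<epsilon> by (auto simp: pos_divide_le_eq mult.commute)
    moreover have "1 - \<epsilon> < 1 / (1 + \<epsilon>)"
      using \<epsilon> by (simp add: field_simps)
    ultimately show ?thesis
      using x y one lt P.X.norm_J[OF x] P.Y.norm_J[OF y]
      by (intro bexI[of _ x] bexI[of _ y]) (auto simp: abs_less_iff)
  qed
  obtain x y where "x \<in> carrier ?X" "y \<in> carrier ?Y" "T x * y = 1"
    using P.approx_unit[of 1] by auto
  then have "rank_one_strong_morita TYPE('w cfun) A ?X"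
    unfolding rank_one_strong_morita_def
    using P.strong_morita_context units
    by (intro conjI exI[of _ ?Y] exI[of _ "\<lambda>x y. T x * y"] exI[of _ "\<lambda>y x. y * T x"])
      (auto simp: mult.commute intro!: bexI[of _ x] bexI[of _ y])
  with min show ?thesis by blast
qed

section \<open>Rank one bimodules\<close>

text \<open>The elementary tensor is its own factorization, so its Haagerup seminorm is at most the
  product of the norms, and a complete quotient map does not increase norms. Only the level of 1 by
  1 matrices is used.\<close>

lemma (in operator_space_pair) norm_induced_le:
  fixes \<beta> :: "'x \<Rightarrow> 'y \<Rightarrow> 'w::t2_space cfun"
  assumes ind: "induces_complete_quotient X Y (function_opspace A) \<beta>"
    and x: "x \<in> carrier X" and y: "y \<in> carrier Y"
  shows "norm (\<beta> x y) \<le> mnorm X (mat1 x) * mnorm Y (mat1 y)"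
proof (rule dense_ge)
  fix r assume r: "mnorm X (mat1 x) * mnorm Y (mat1 y) < r"
  interpret matrix_seminorm "formal_tensors X Y" formal_scale haag
    by (rule haag_matrix_seminorm)
  let ?V = "completion (formal_tensors X Y) formal_scale haag" and ?u = "formal_elem x y"
  obtain T where T: "\<And>x y. x \<in> carrier X \<Longrightarrow> y \<in> carrier Y \<Longrightarrow> T (haagerup_elem X Y x y) = \<beta> x y"
    and quot: "complete_quotient_map ?V (function_opspace A) T"
    using ind unfolding induces_complete_quotient_def haagerup_tensor_def by blast
  have u: "?u \<in> formal_tensors X Y" by (rule formal_elem_mem[OF x y])
  have le: "haag (mat1 ?u) \<le> mnorm X (mat1 x) * mnorm Y (mat1 y)" "0 \<le> haag (mat1 ?u)"
    by (rule haag_le[OF rep_elem[OF x y]], rule haag_nonneg[OF rep_elem[OF x y]])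
  then have r0: "0 < r" using r by linarith
  \<comment> \<open>Scaling by \<open>1 / r\<close> moves the tensor into the open unit ball, the
    only place where the definition of a quotient map gives information.\<close>
  define c where "c = complex_of_real (1 / r)"
  have c: "cmod c = 1 / r" using r0 by (simp add: c_def norm_divide)
  let ?P = "R `` {\<lambda>_. formal_scale c ?u}"
  have cu: "formal_scale c ?u \<in> formal_tensors X Y" by (rule sc_mem[OF u])
  have P: "mat1 ?P \<in> mats ?V 1 1" "mnorm ?V (mat1 ?P) = haag (mat1 (formal_scale c ?u))"
    using completion_mnorm_const[OF mat1_simps(4), of "formal_scale c ?u"] cu by auto
  have "haag (mat1 (formal_scale c ?u)) \<le> cmod c * haag (mat1 ?u)" by (rule N_scale[OF u])
  also have "\<dots> < 1" using le r r0 by (simp add: c)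
  finally have "map_mat T (mat1 ?P) \<in> map_mat T ` {x \<in> mats ?V 1 1. mnorm ?V x < 1}"
    using P by (intro imageI) simp
  then have "map_mat T (mat1 ?P) \<in> {y \<in> mats (function_opspace A) 1 1. mnorm (function_opspace A) y < 1}"
    using quot unfolding complete_quotient_map_def by blast
  then have "norm (T ?P) < 1" by (simp add: function_opspace_def function_mnorm_mat1)
  moreover have "T ?P = const_bcontfun c * \<beta> x y"
  proof -
    have "?P = c \<odot>\<^bsub>?V\<^esub> haagerup_elem X Y x y"
      unfolding haagerup_elem_def by (rule completion_smult[OF const_cauchy[OF u], symmetric])
    moreover have "haagerup_elem X Y x y \<in> carrier ?V"
      unfolding haagerup_elem_def by (rule class_mem[OF const_cauchy[OF u]])
    ultimately show ?thesis
      using quot T[OF x y] unfolding complete_quotient_map_def linear_map_def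
      by (simp add: function_opspace_def)
  qed
  ultimately have "cmod c * norm (\<beta> x y) < 1" by (simp add: norm_const_mult)
  then show "norm (\<beta> x y) \<le> r" using r0 by (simp add: c)
qed

text \<open>The norm of a 1 by 1 complex matrix is the modulus of its entry, so \<open>j\<close>
  being isometric is all that is used.\<close>

lemma minimal_structure_norm:
  assumes "minimal_structure X N" "x \<in> carrier X"
  shows "N (mat1 x) = nrm X x"
  using assms unfolding minimal_structure_def
  by (auto simp: cmat_norm_mat1 dest!: spec[of _ 1] bspec[OF _ mat1_mats[OF assms(2)]])

text \<open>\<open>z\<close> shows that the unit ball is nonempty and gives a nonnegative member of
  the set whose supremum is taken.\<close>

lemma op_norm_bounds:
  assumes "z \<in> carrier V" "nrm V z \<le> 1" "\<And>x. x \<in> carrier V \<Longrightarrow> nrm W (T x) \<le> c * nrm V x"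
    and "0 \<le> c" "0 \<le> nrm W (T z)"
  shows "0 \<le> op_norm V W T" "op_norm V W T \<le> c"
proof -
  have le: "nrm W (T x) \<le> c" if "x \<in> carrier V" "nrm V x \<le> 1" for x
    using assms(3)[OF that(1)] mult_left_mono[OF that(2) assms(4)] by simp
  then show "op_norm V W T \<le> c"
    unfolding op_norm_def using assms(1,2) by (intro cSUP_least) auto
  have "nrm W (T z) \<le> op_norm V W T"
    unfolding op_norm_def using assms(1,2) le by (intro cSUP_upper bdd_aboveI2[of _ _ c]) auto
  then show "0 \<le> op_norm V W T" using assms(5) by simp
qed

lemma (in banach_module) nrm_nonneg:
  assumes "x \<in> carrier X"
  shows "0 \<le> nrm X x"
proof -
  have "x \<oplus> (-1) \<odot>\<^bsub>X\<^esub> x = \<zero>"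
    using smult_l_distr[of 1 "-1" x] smult_one[of x] smult_l_null[of x] assms by simp
  then have "nrm X \<zero> \<le> nrm X x + nrm X x"
    using norm_triangle[of x "(-1) \<odot>\<^bsub>X\<^esub> x"] norm_scale[of x "-1"] smult_closed[of "-1" x] assms by simp
  then show ?thesis using norm_eq_0[of \<zero>] by simp
qed

text \<open>Two pairs of elements are at work. The pair \<open>x\<close>, \<open>y\<close> varies
  with \<epsilon> and controls norms: the map is bounded by the norm of \<open>y\<close> through
  \<open>norm_induced_le\<close>, its inverse by the norm of \<open>x\<close> through contractivity
  of the action. The fixed pair \<open>x2\<close>, \<open>y2\<close>, without norm control, makes
  \<open>X\<close> cyclic and so yields bijectivity.\<close>

lemma rank_one_imp_almost_isometric:
  fixes A :: "'w::t2_space cfun set" and X :: "('w cfun, 'x) normed_module"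
  assumes A: "uniform_algebra A" and X: "banach_module A X"
    and min: "minimal_structure X N"
    and morita: "rank_one_strong_morita TYPE('y) A (symmetric_bimodule X N)"
  shows "almost_A_isometric A X (function_module A)"
proof -
  interpret uniform_algebra A by (rule A)
  interpret X: banach_module A X by (rule X)
  let ?X = "symmetric_bimodule X N"
  obtain Y :: "('w cfun, 'y) op_bimodule" and pr br x1 y1 x2 y2 where ctx: "strong_morita_context A ?X Y pr br"
    and el: "x1 \<in> carrier X" "y1 \<in> carrier Y" "x2 \<in> carrier X" "y2 \<in> carrier Y" "pr x1 y1 = 1" "br y2 x2 = 1"
    and approx: "\<And>\<epsilon>. 0 < \<epsilon> \<Longrightarrow> \<exists>x\<in>carrier X. \<exists>y\<in>carrier Y. pr x y = 1 \<and>
        \<bar>N (mat1 x) - 1\<bar> < \<epsilon> \<and> \<bar>mnorm Y (mat1 y) - 1\<bar> < \<epsilon>"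
    using morita unfolding rank_one_strong_morita_def by auto
  interpret M: strong_morita_context A ?X Y pr br by (rule ctx)
  interpret pair: operator_space_pair ?X Y
    by (intro operator_space_pair.intro M.X.operator_space_axioms M.Y.operator_space_axioms)
  \<comment> \<open>\<open>x = x [y2, x2] = (x, y2) x2\<close>, so \<open>x2\<close> generates
    \<open>X\<close>.\<close>
  have gen: "x = act X (pr x y2) x2" if "x \<in> carrier X" for x
    using M.assoc_X[of x y2 x2] that el X.act_one[OF that] by simp
  show ?thesis
    unfolding almost_A_isometric_def
  proof (intro allI impI)
    fix \<epsilon> :: real assume \<epsilon>: "0 < \<epsilon>"
    \<comment> \<open>The square of \<open>1 + \<delta>\<close> is \<open>1 + \<epsilon>\<close>, as
      the two norms are multiplied.\<close>
    define \<delta> where "\<delta> = sqrt (1 + \<epsilon>) - 1"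
    have \<delta>: "0 < \<delta>" using \<epsilon> by (simp add: \<delta>_def)
    obtain x y where x: "x \<in> carrier X" and y: "y \<in> carrier Y" and one: "pr x y = 1"
      and xn: "\<bar>N (mat1 x) - 1\<bar> < \<delta>" and yn: "\<bar>mnorm Y (mat1 y) - 1\<bar> < \<delta>"
      using approx[OF \<delta>] by blast
    define T where "T z = pr z y" for z
    have T_mem: "T z \<in> A" if "z \<in> carrier X" for z
      unfolding T_def using M.pr.pairing_closed that y by simp
    have T_act: "T (act X a z) = a * T z" if "a \<in> A" "z \<in> carrier X" for a z
      unfolding T_def using M.pr.pairing_lact[of a z y] that y by simp
    have Tx: "T x = 1" unfolding T_def by (rule one)
    have ax: "T (act X a x) = a" if "a \<in> A" for a using T_act[OF that x] Tx by simp
    have inv: "act X (T z) x = z" if z: "z \<in> carrier X" for z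
    proof -
      let ?b = "pr x y2" and ?t = "T x2" and ?c = "pr z y2"
      have mem: "?b \<in> A" "?t \<in> A" "?c \<in> A"
        using M.pr.pairing_closed[of _ y2] x z el T_mem by auto
      \<comment> \<open>From \<open>x = ?b x2\<close> and \<open>T x = 1\<close>, the value
        \<open>?t\<close> of \<open>T\<close> at the generator is invertible with inverse
        \<open>?b\<close>. Hence \<open>(T z) x = ?c ?t ?b x2 = ?c x2 = z\<close>.\<close>
      have "1 = T (act X ?b x2)" using gen[OF x] Tx by simp
      then have bt: "?b * ?t = 1" using T_act[OF mem(1) el(3)] by simp
      have "T z = T (act X ?c x2)" using gen[OF z] by simp
      then have "T z = ?c * ?t" using T_act[OF mem(3) el(3)] by simp
      then have "act X (T z) x = act X (?c * ?t) (act X ?b x2)" using gen[OF x] by simp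
      also have "\<dots> = act X (?c * ?t * ?b) x2"
        using mem el by (simp add: X.act_mult mult_mem)
      also have "?c * ?t * ?b = ?c" using bt by (metis mult.assoc mult.commute mult.right_neutral)
      finally show ?thesis using gen[OF z] by simp
    qed
    have bij: "bij_betw T (carrier X) A"
      by (rule bij_betw_byWitness[where f' = "\<lambda>a. act X a x"])
        (auto simp: inv ax T_mem X.act_closed x)
    have iso: "module_iso A X (function_module A) T"
      unfolding module_iso_def
      using bij T_act M.pr.pairing_add_left[of _ _ y] M.pr.pairing_scale_left[of _ y] y
      by (auto simp: function_module_def T_def)
    have T_le: "norm (T z) \<le> mnorm Y (mat1 y) * nrm X z" if "z \<in> carrier X" for z
      using pair.norm_induced_le[OF M.pr_quotient, of z y] that y minimal_structure_norm[OF min that]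
      by (simp add: T_def mult.commute)
    have inv_T: "inv_into (carrier X) T a = act X a x" if "a \<in> A" for a
      using bij that ax[OF that] x X.act_closed by (intro inv_into_f_eq) (auto simp: bij_betw_def)
    have S_le: "nrm X (inv_into (carrier X) T a) \<le> nrm X x * norm a" if "a \<in> A" for a
      using X.act_contractive[OF that x] inv_T[OF that] by (simp add: mult.commute)
    note nn = X.nrm_nonneg
    have yn0: "0 \<le> mnorm Y (mat1 y)" by (rule M.Y.mnorm_nonneg[OF mat1_mats[OF y]])
    have nz: "nrm X \<zero>\<^bsub>X\<^esub> = 0" using X.norm_eq_0 by simp
    have b1: "0 \<le> op_norm X (function_module A) T" "op_norm X (function_module A) T \<le> mnorm Y (mat1 y)"
      using op_norm_bounds[of "\<zero>\<^bsub>X\<^esub>" X "function_module A" T "mnorm Y (mat1 y)"] T_le yn0 nz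
      by (auto simp: function_module_def)
    have b2: "0 \<le> op_norm (function_module A) X (inv_into (carrier X) T)"
      "op_norm (function_module A) X (inv_into (carrier X) T) \<le> nrm X x"
      using op_norm_bounds[of 0 "function_module A" X "inv_into (carrier X) T" "nrm X x"] S_le nn x zero_mem
        inv_T[OF zero_mem] X.act_closed
      by (auto simp: function_module_def)
    have "op_norm X (function_module A) T * op_norm (function_module A) X (inv_into (carrier X) T)
        \<le> mnorm Y (mat1 y) * nrm X x"
      using b1 b2 by (intro mult_mono) (auto intro: order_trans)
    also have "\<dots> < (1 + \<delta>) * (1 + \<delta>)"
      using xn yn yn0 nn[OF x] minimal_structure_norm[OF min x]
      by (intro mult_strict_mono) (auto simp: abs_less_iff)
    also have "\<dots> = 1 + \<epsilon>" using \<epsilon> by (simp add: \<delta>_def)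
    finally have prod: "op_norm X (function_module A) T * op_norm (function_module A) X (inv_into (carrier X) T) < 1 + \<epsilon>" .
    have "bounded_map X (function_module A) T" "bounded_map (function_module A) X (inv_into (carrier X) T)"
      unfolding bounded_map_def using T_le S_le by (auto simp: function_module_def)
    with iso prod show "\<exists>T. module_iso A X (function_module A) T \<and> bounded_map X (function_module A) T \<and>
        bounded_map (function_module A) X (inv_into (carrier X) T) \<and>
        op_norm X (function_module A) T * op_norm (function_module A) X (inv_into (carrier X) T) < 1 + \<epsilon>"
      by blast
  qed
qed

section \<open>Almost isometric modules\<close>

text \<open>Homogeneity is asked only along the multiples of \<open>x\<close>, so the bound applies
  alike to a map out of \<open>X\<close> and to its inverse out of \<open>function_module A\<close>.
  For norm 0 no normalization is possible, and boundedness of the map takes over.\<close>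

lemma op_norm_bound:
  assumes bdd: "bounded_map V W T" and x: "x \<in> carrier V"
    and cl: "\<And>c. c \<odot>\<^bsub>V\<^esub> x \<in> carrier V" and nV: "\<And>c. nrm V (c \<odot>\<^bsub>V\<^esub> x) = cmod c * nrm V x"
    and nW: "\<And>c. nrm W (T (c \<odot>\<^bsub>V\<^esub> x)) = cmod c * nrm W (T x)" and nonneg: "\<And>z. z \<in> carrier V \<Longrightarrow> 0 \<le> nrm V z"
  shows "nrm W (T x) \<le> op_norm V W T * nrm V x"
proof -
  obtain k where k: "\<And>x. x \<in> carrier V \<Longrightarrow> nrm W (T x) \<le> k * nrm V x"
    using bdd unfolding bounded_map_def by blast
  show ?thesis
  proof (cases "nrm V x = 0")
    case True
    then show ?thesis using k[OF x] by simp
  next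
    case False
    then have pos: "0 < nrm V x" using nonneg[OF x] by simp
    let ?c = "complex_of_real (1 / nrm V x)"
    have "nrm W (T (?c \<odot>\<^bsub>V\<^esub> x)) \<le> op_norm V W T"
      unfolding op_norm_def
    proof (rule cSUP_upper)
      show "?c \<odot>\<^bsub>V\<^esub> x \<in> {x \<in> carrier V. nrm V x \<le> 1}"
        unfolding mem_Collect_eq nV using cl pos by (simp add: norm_divide)
      show "bdd_above ((\<lambda>x. nrm W (T x)) ` {x \<in> carrier V. nrm V x \<le> 1})"
      proof (rule bdd_aboveI2)
        fix z assume "z \<in> {x \<in> carrier V. nrm V x \<le> 1}"
        then have z: "z \<in> carrier V" "nrm V z \<le> 1" by auto
        have "k * nrm V z \<le> \<bar>k\<bar> * 1"
          using z nonneg by (intro mult_mono) auto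
        then show "nrm W (T z) \<le> \<bar>k\<bar>" using k[OF z(1)] by simp
      qed
    qed
    then show ?thesis unfolding nW using pos by (simp add: norm_divide field_simps)
  qed
qed

text \<open>Only the product of the two operator norms is known to be near 1. Dividing the map by
  its own norm \<alpha> makes it a contraction and shifts the whole product \<alpha> \<gamma> to the
  inverse.\<close>

lemma almost_isometric_normalized:
  fixes A :: "'w::t2_space cfun set" and X :: "('w cfun, 'x) normed_module"
  assumes A: "uniform_algebra A" and X: "banach_module A X"
    and almost: "almost_A_isometric A X (function_module A)" and \<epsilon>: "0 < \<epsilon>"
  obtains T where "bij_betw T (carrier X) A"
    "\<And>x y. x \<in> carrier X \<Longrightarrow> y \<in> carrier X \<Longrightarrow> T (x \<oplus>\<^bsub>X\<^esub> y) = T x + T y"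
    "\<And>c x. x \<in> carrier X \<Longrightarrow> T (c \<odot>\<^bsub>X\<^esub> x) = const_bcontfun c * T x"
    "\<And>a x. a \<in> A \<Longrightarrow> x \<in> carrier X \<Longrightarrow> T (act X a x) = a * T x"
    "\<And>x. x \<in> carrier X \<Longrightarrow> norm (T x) \<le> nrm X x"
    "\<And>x. x \<in> carrier X \<Longrightarrow> nrm X x \<le> (1 + \<epsilon>) * norm (T x)"
proof -
  interpret uniform_algebra A by (rule A)
  interpret X: banach_module A X by (rule X)
  let ?W = "function_module A"
  obtain T where iso: "module_iso A X ?W T"
    and bdd: "bounded_map X ?W T" "bounded_map ?W X (inv_into (carrier X) T)"
    and lt: "op_norm X ?W T * op_norm ?W X (inv_into (carrier X) T) < 1 + \<epsilon>"
    using almost \<epsilon> unfolding almost_A_isometric_def by blast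
  let ?S = "inv_into (carrier X) T"
  define \<alpha> \<gamma> where "\<alpha> = op_norm X ?W T" and "\<gamma> = op_norm ?W X ?S"
  have bij: "bij_betw T (carrier X) A"
    and T_add: "\<And>x y. x \<in> carrier X \<Longrightarrow> y \<in> carrier X \<Longrightarrow> T (x \<oplus>\<^bsub>X\<^esub> y) = T x + T y"
    and T_smult: "\<And>c x. x \<in> carrier X \<Longrightarrow> T (c \<odot>\<^bsub>X\<^esub> x) = const_bcontfun c * T x"
    and T_act: "\<And>a x. a \<in> A \<Longrightarrow> x \<in> carrier X \<Longrightarrow> T (act X a x) = a * T x"
    using iso unfolding module_iso_def function_module_def by auto
  have cl: "c \<odot>\<^bsub>X\<^esub> x \<in> carrier X" if "x \<in> carrier X" for c x
    using X.smult_closed[of c x] that by simp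
  have T_mem: "T x \<in> A" if "x \<in> carrier X" for x
    using bij that by (auto simp: bij_betw_def)
  have ST: "?S (T x) = x" if "x \<in> carrier X" for x
    using bij that by (simp add: bij_betw_def)
  have T_le: "norm (T x) \<le> \<alpha> * nrm X x" if x: "x \<in> carrier X" for x
    using op_norm_bound[OF bdd(1) x] cl[OF x] X.norm_scale[OF x] T_smult[OF x] X.nrm_nonneg
    by (simp add: \<alpha>_def function_module_def norm_const_mult)
  have S_le: "nrm X x \<le> \<gamma> * norm (T x)" if x: "x \<in> carrier X" for x
  proof -
    have "?S (const_bcontfun c * T x) = c \<odot>\<^bsub>X\<^esub> x" for c
      using ST[OF cl[OF x]] T_smult[OF x] by metis
    then show ?thesis
      using op_norm_bound[OF bdd(2), of "T x"] ST[OF x] X.norm_scale[OF x] T_mem[OF x] mult_mem[OF const_mem]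
      by (simp add: \<gamma>_def function_module_def norm_const_mult)
  qed
  obtain e where e: "e \<in> carrier X" "T e = 1"
    using bij one_mem unfolding bij_betw_def by (metis imageE)
  \<comment> \<open>The map attains the value 1, so it is not zero and its norm may be divided
    by.\<close>
  have pos: "0 < \<alpha>"
  proof -
    have "(1 :: 'w cfun) \<noteq> 0" by simp
    then have "0 < \<alpha> * nrm X e" using T_le[OF e(1)] e(2) by (metis less_le_trans zero_less_norm_iff)
    then show ?thesis using X.nrm_nonneg[OF e(1)] by (simp add: zero_less_mult_iff)
  qed
  define T' where "T' x = const_bcontfun (of_real (1 / \<alpha>)) * T x" for x
  have inv: "const_bcontfun (of_real (1 / \<alpha>)) * (const_bcontfun (of_real \<alpha>) * a) = a"
    "const_bcontfun (of_real \<alpha>) * (const_bcontfun (of_real (1 / \<alpha>)) * a) = a" for a :: "'w cfun"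
    using pos by (auto intro!: bcontfun_eqI)
  have n: "norm (T' x) = norm (T x) / \<alpha>" for x
    using pos by (simp add: T'_def norm_const_mult norm_divide)
  show thesis
  proof
    have "bij_betw (\<lambda>a. const_bcontfun (of_real (1 / \<alpha>)) * a) A A"
      by (rule bij_betw_byWitness[where f' = "\<lambda>a. const_bcontfun (of_real \<alpha>) * a"])
        (auto simp: inv mult_mem const_mem simp del: of_real_divide)
    from bij_betw_trans[OF bij this] show "bij_betw T' (carrier X) A"
      by (simp add: T'_def[abs_def] comp_def)
    fix x assume x: "x \<in> carrier X"
    show "norm (T' x) \<le> nrm X x" using T_le[OF x] pos by (simp add: n field_simps)
    have "nrm X x \<le> \<gamma> * norm (T x)" by (rule S_le[OF x])
    also have "\<dots> = \<alpha> * \<gamma> * norm (T' x)" using pos by (simp add: n)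
    also have "\<dots> \<le> (1 + \<epsilon>) * norm (T' x)"
      using lt by (intro mult_right_mono) (auto simp: \<alpha>_def \<gamma>_def)
    finally show "nrm X x \<le> (1 + \<epsilon>) * norm (T' x)" .
  qed (auto simp: T'_def T_add T_smult T_act algebra_simps)
qed

lemma almost_isometric_imp_A_isometric:
  fixes A :: "'w::t2_space cfun set" and X :: "('w cfun, 'x) normed_module"
  assumes A: "uniform_algebra A" and X: "banach_module A X"
    and almost: "almost_A_isometric A X (function_module A)"
  shows "\<exists>f\<in>positive_closure (modulus_set A). A_isometric A X (function_module {a * f | a. a \<in> A})"
proof -
  interpret uniform_algebra A by (rule A)
  interpret X: banach_module A X by (rule X)
  \<comment> \<open>Besides tending to 0, this sequence stays at most 1, which keeps the factors
    \<open>1 + \<epsilon> n\<close> below 2 when \<open>f\<close> is shown to have no zero.\<close>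
  define \<epsilon> where "\<epsilon> n = inverse (real (Suc n))" for n
  have \<epsilon>: "0 < \<epsilon> n" "\<epsilon> n \<le> 1" for n by (simp_all add: \<epsilon>_def inverse_le_1_iff)
  have \<epsilon>0: "\<epsilon> \<longlonglongrightarrow> 0" unfolding \<epsilon>_def by (rule LIMSEQ_inverse_real_of_nat)
  define P where "P n T \<longleftrightarrow> bij_betw T (carrier X) A \<and>
      (\<forall>x\<in>carrier X. \<forall>y\<in>carrier X. T (x \<oplus>\<^bsub>X\<^esub> y) = T x + T y) \<and>
      (\<forall>c. \<forall>x\<in>carrier X. T (c \<odot>\<^bsub>X\<^esub> x) = const_bcontfun c * T x) \<and>
      (\<forall>a\<in>A. \<forall>x\<in>carrier X. T (act X a x) = a * T x) \<and>
      (\<forall>x\<in>carrier X. norm (T x) \<le> nrm X x) \<and>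
      (\<forall>x\<in>carrier X. nrm X x \<le> (1 + \<epsilon> n) * norm (T x))" for n T
  have "\<exists>T. P n T" for n
  proof (rule almost_isometric_normalized[OF A X almost \<epsilon>(1)[of n]])
    fix T
    assume T: "bij_betw T (carrier X) A"
      "\<And>x y. x \<in> carrier X \<Longrightarrow> y \<in> carrier X \<Longrightarrow> T (x \<oplus>\<^bsub>X\<^esub> y) = T x + T y"
      "\<And>c x. x \<in> carrier X \<Longrightarrow> T (c \<odot>\<^bsub>X\<^esub> x) = const_bcontfun c * T x"
      "\<And>a x. a \<in> A \<Longrightarrow> x \<in> carrier X \<Longrightarrow> T (act X a x) = a * T x"
      "\<And>x. x \<in> carrier X \<Longrightarrow> norm (T x) \<le> nrm X x"
      "\<And>x. x \<in> carrier X \<Longrightarrow> nrm X x \<le> (1 + \<epsilon> n) * norm (T x)"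
    show ?thesis unfolding P_def by (intro exI[of _ T] conjI ballI allI T)
  qed
  then obtain T where "\<And>n. P n (T n)" by metis
  then have bij: "\<And>n. bij_betw (T n) (carrier X) A"
    and T_add: "\<And>n x y. x \<in> carrier X \<Longrightarrow> y \<in> carrier X \<Longrightarrow> T n (x \<oplus>\<^bsub>X\<^esub> y) = T n x + T n y"
    and T_smult: "\<And>n c x. x \<in> carrier X \<Longrightarrow> T n (c \<odot>\<^bsub>X\<^esub> x) = const_bcontfun c * T n x"
    and T_act: "\<And>n a x. a \<in> A \<Longrightarrow> x \<in> carrier X \<Longrightarrow> T n (act X a x) = a * T n x"
    and T_le: "\<And>n x. x \<in> carrier X \<Longrightarrow> norm (T n x) \<le> nrm X x"
    and T_ge: "\<And>n x. x \<in> carrier X \<Longrightarrow> nrm X x \<le> (1 + \<epsilon> n) * norm (T n x)"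
    unfolding P_def by blast+
  have T_mem: "T n x \<in> A" if "x \<in> carrier X" for n x
    using bij[of n] that by (auto simp: bij_betw_def)
  \<comment> \<open>\<open>e\<close> comes from \<open>T 0\<close> but is then kept for every
    \<open>n\<close>: the \<open>g n\<close> are images of one and the same vector, which is what
    makes them comparable. By \<open>gen\<close> below, \<open>x\<close> is \<open>e\<close> with
    coefficient \<open>T 0 x\<close>.\<close>
  obtain e where e: "e \<in> carrier X" "T 0 e = 1"
    using bij[of 0] one_mem unfolding bij_betw_def by (metis imageE)
  have ae: "act X a e \<in> carrier X" if "a \<in> A" for a using X.act_closed[OF that e(1)] .
  have gen: "act X (T 0 x) e = x" if x: "x \<in> carrier X" for x
  proof -
    have "T 0 (act X (T 0 x) e) = T 0 x" using T_act[OF T_mem[OF x] e(1), of 0 0] e(2) by simp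
    then show ?thesis using bij[of 0] ae[OF T_mem[OF x]] x unfolding bij_betw_def by (meson inj_onD)
  qed

  define g where "g n = T n e" for n
  have gA: "g n \<in> A" for n unfolding g_def by (rule T_mem[OF e(1)])
  have Tg: "T n (act X a e) = a * g n" if "a \<in> A" for n a
    unfolding g_def by (rule T_act[OF that e(1)])
  have upper: "norm (a * g n) \<le> nrm X (act X a e)" if "a \<in> A" for a n
    using T_le[OF ae[OF that], of n] by (simp add: Tg[OF that])
  have lower: "nrm X (act X a e) \<le> (1 + \<epsilon> n) * norm (a * g n)" if "a \<in> A" for a n
    using T_ge[OF ae[OF that], of n] by (simp add: Tg[OF that])
  \<comment> \<open>If \<open>T n x = 1\<close>, then \<open>x = (T 0 x) e\<close> gives
    \<open>1 = (T 0 x) g n\<close>, so the inverse of \<open>g n\<close> is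
    \<open>T 0 x\<close>.\<close>
  have "\<exists>h\<in>A. g n * h = 1" for n
  proof -
    obtain x where x: "x \<in> carrier X" "T n x = 1"
      using bij[of n] one_mem unfolding bij_betw_def by (metis imageE)
    have "T 0 x * g n = 1" using Tg[OF T_mem[OF x(1), of 0], of n] gen[OF x(1)] x(2) by simp
    then show ?thesis using T_mem[OF x(1)] by (intro bexI[of _ "T 0 x"]) (auto simp: mult.commute)
  qed
  then obtain h where hA: "\<And>n. h n \<in> A" and gh: "\<And>n. g n * h n = 1" by metis

  text \<open>Testing the two-sided estimate on \<open>h m = (g m)\<^sup>-\<^sup>1\<close> compares \<open>\<bar>g n\<bar>\<close> and \<open>\<bar>g m\<bar>\<close> on all of
    \<open>\<Omega>\<close>, not only on the Shilov boundary.\<close>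
  have comp: "cmod (apply_bcontfun (g n) w) \<le> (1 + \<epsilon> m) * cmod (apply_bcontfun (g m) w)" for n m w
  proof -
    have "norm (h m * g n) \<le> (1 + \<epsilon> m) * norm (h m * g m)"
      using upper[OF hA, of m n] lower[OF hA, of m m] by simp
    also have "h m * g m = 1" using gh[of m] by (simp add: mult.commute)
    also have "norm (1 :: 'w cfun) \<le> 1" by (rule norm_bound) simp
    finally have le: "norm (h m * g n) \<le> 1 + \<epsilon> m" using \<epsilon>(1)[of m] by (simp add: mult_left_mono)
    have "apply_bcontfun (g m) w * apply_bcontfun (h m) w = 1"
      using arg_cong[OF gh[of m], of "\<lambda>f. apply_bcontfun f w"] by simp
    then have "apply_bcontfun (g n) w = apply_bcontfun (h m * g n) w * apply_bcontfun (g m) w"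
      by (simp add: mult.left_commute mult.commute)
    then have "cmod (apply_bcontfun (g n) w) = cmod (apply_bcontfun (h m * g n) w) * cmod (apply_bcontfun (g m) w)"
      by (metis norm_mult)
    also have "\<dots> \<le> (1 + \<epsilon> m) * cmod (apply_bcontfun (g m) w)"
      using norm_bounded[of "h m * g n" w] le by (intro mult_right_mono) auto
    finally show ?thesis .
  qed

  define q where "q n = Bcontfun (\<lambda>w. complex_of_real (cmod (apply_bcontfun (g n) w)))" for n
  have qw: "apply_bcontfun (q n) w = complex_of_real (cmod (apply_bcontfun (g n) w))" for n w
  proof -
    have "(\<lambda>w. complex_of_real (cmod (apply_bcontfun (g n) w))) \<in> bcontfun"
      by (rule bcontfun_normI[of _ "norm (g n)"])
        (auto intro!: continuous_intros continuous_on_apply_bcontfun norm_bounded)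
    then show ?thesis by (simp add: q_def Bcontfun_inverse)
  qed
  have qQ: "q n \<in> modulus_set A" for n
    unfolding modulus_set_def using gA hA gh qw by blast
  define B where "B = nrm X e"
  have gB: "norm (g n) \<le> B" for n
    using T_le[OF e(1), of n] by (simp add: g_def B_def)
  \<comment> \<open>\<open>comp\<close> gives a one-sided estimate whose error is relative to the
    modulus of \<open>g m\<close>; the uniform bound \<open>B\<close> makes it absolute, and
    exchanging \<open>n\<close> and \<open>m\<close> supplies the other side.\<close>
  have diff: "cmod (apply_bcontfun (g n) w) - cmod (apply_bcontfun (g m) w) \<le> \<epsilon> m * B" for n m w
  proof -
    have "\<epsilon> m * cmod (apply_bcontfun (g m) w) \<le> \<epsilon> m * B"
      using \<epsilon>(1)[of m] norm_bounded[of "g m" w] gB[of m] by (intro mult_left_mono) auto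
    then show ?thesis using comp[of n w m] by (simp add: algebra_simps)
  qed
  have B0: "0 \<le> B" unfolding B_def by (rule X.nrm_nonneg[OF e(1)])
  have q_diff: "norm (q n - q m) \<le> (\<epsilon> n + \<epsilon> m) * B" for n m
  proof (rule norm_bound)
    fix w
    have "cmod (apply_bcontfun (q n - q m) w) = \<bar>cmod (apply_bcontfun (g n) w) - cmod (apply_bcontfun (g m) w)\<bar>"
      by (simp add: qw flip: of_real_diff)
    also have "\<dots> \<le> (\<epsilon> n + \<epsilon> m) * B"
      using diff[of n w m] diff[of m w n] mult_nonneg_nonneg[OF _ B0, of "\<epsilon> n"] mult_nonneg_nonneg[OF _ B0, of "\<epsilon> m"]
        \<epsilon>(1)[of n] \<epsilon>(1)[of m] by (simp add: algebra_simps abs_le_iff)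
    finally show "cmod (apply_bcontfun (q n - q m) w) \<le> (\<epsilon> n + \<epsilon> m) * B" .
  qed
  have "Cauchy q"
  proof (rule CauchyI)
    fix r :: real assume r: "0 < r"
    have "(\<lambda>n. 2 * \<epsilon> n * B) \<longlonglongrightarrow> 2 * 0 * B" by (intro tendsto_intros \<epsilon>0)
    then have "eventually (\<lambda>n. 2 * \<epsilon> n * B < r) sequentially"
      using r by (intro order_tendstoD(2)[of _ "2 * 0 * B"]) auto
    then obtain M where M: "2 * \<epsilon> M * B < r" by (auto simp: eventually_sequentially)
    have "norm (q m - q n) < r" if "m \<ge> M" "n \<ge> M" for m n
    proof -
      have "\<epsilon> m \<le> \<epsilon> M" "\<epsilon> n \<le> \<epsilon> M" using that by (auto simp: \<epsilon>_def intro!: le_imp_inverse_le)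
      then have "(\<epsilon> m + \<epsilon> n) * B \<le> 2 * \<epsilon> M * B" using B0 by (intro mult_right_mono) auto
      then show ?thesis using q_diff[of m n] M by simp
    qed
    then show "\<exists>M. \<forall>m\<ge>M. \<forall>n\<ge>M. norm (q m - q n) < r" by blast
  qed
  then obtain f where f: "q \<longlonglongrightarrow> f"
    using bcontfun_Cauchy_convergent unfolding convergent_def by blast
  have fw: "(\<lambda>n. apply_bcontfun (q n) w) \<longlonglongrightarrow> apply_bcontfun f w" for w
  proof -
    have le: "norm (apply_bcontfun (q n) w - apply_bcontfun f w) \<le> norm (q n - f)" for n
      using norm_bounded[of "q n - f" w] by simp
    have "(\<lambda>n. apply_bcontfun (q n) w - apply_bcontfun f w) \<longlonglongrightarrow> 0"
      by (rule Lim_null_comparison[OF _ tendsto_norm_zero[OF LIM_zero[OF f]]]) (simp only: le eventually_True)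
    then show ?thesis by (rule LIM_zero_cancel)
  qed
  have f_pos: "apply_bcontfun f w \<in> \<real> \<and> 0 < Re (apply_bcontfun f w)" for w
  proof -
    have re: "(\<lambda>n. cmod (apply_bcontfun (g n) w)) \<longlonglongrightarrow> Re (apply_bcontfun f w)"
      and im: "(\<lambda>n. 0 :: real) \<longlonglongrightarrow> Im (apply_bcontfun f w)"
      using tendsto_Re[OF fw[of w]] tendsto_Im[OF fw[of w]] by (simp_all add: qw)
    have "apply_bcontfun (g 0) w * apply_bcontfun (h 0) w = 1"
      using arg_cong[OF gh[of 0], of "\<lambda>f. apply_bcontfun f w"] by simp
    then have "0 < cmod (apply_bcontfun (g 0) w) / 2" by auto
    \<comment> \<open>Passing to the limit could lose strict positivity. \<open>comp\<close> with
      the indices \<open>0\<close> and \<open>n\<close> bounds every \<open>cmod (g n w)\<close>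
      below by half of \<open>cmod (g 0 w)\<close>, which is nonzero as \<open>g 0\<close> is
      invertible.\<close>
    also have "cmod (apply_bcontfun (g 0) w) / 2 \<le> Re (apply_bcontfun f w)"
    proof (rule LIMSEQ_le_const[OF re], intro exI allI impI)
      fix n
      have "(1 + \<epsilon> n) * cmod (apply_bcontfun (g n) w) \<le> 2 * cmod (apply_bcontfun (g n) w)"
        using \<epsilon>(2)[of n] by (intro mult_right_mono) auto
      then show "cmod (apply_bcontfun (g 0) w) / 2 \<le> cmod (apply_bcontfun (g n) w)"
        using comp[of 0 w n] by simp
    qed
    finally have "0 < Re (apply_bcontfun f w)" .
    moreover have "Im (apply_bcontfun f w) = 0" using im by (simp add: LIMSEQ_const_iff)
    ultimately show ?thesis by (simp add: complex_is_Real_iff)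
  qed
  have f_cl: "f \<in> positive_closure (modulus_set A)"
    unfolding positive_closure_def using f_pos f qQ by (auto simp: closure_sequential)

  have f_norm: "norm (a * f) = nrm X (act X a e)" if a: "a \<in> A" for a
  proof (rule LIMSEQ_unique)
    \<comment> \<open>Passing from \<open>g n\<close> to its modulus changes no norm of a multiple
      \<open>a * g n\<close>, so the estimates \<open>upper\<close> and \<open>lower\<close> hold
      for the convergent sequence \<open>q\<close> as well.\<close>
    have eq: "norm (a * q n) = norm (a * g n)" for n
    proof (rule antisym)
      show "norm (a * q n) \<le> norm (a * g n)"
        using norm_bounded[of "a * g n"] by (intro norm_bound) (simp add: norm_mult qw)
      show "norm (a * g n) \<le> norm (a * q n)"
        using norm_bounded[of "a * q n"] by (intro norm_bound) (simp add: norm_mult qw)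
    qed
    show "(\<lambda>n. norm (a * q n)) \<longlonglongrightarrow> norm (a * f)"
      using tendsto_norm[OF tendsto_cfun_mult_right[OF f, of a]] by (simp add: mult.commute)
    have "(\<lambda>n. nrm X (act X a e) / (1 + \<epsilon> n)) \<longlonglongrightarrow> nrm X (act X a e) / (1 + 0)"
      by (intro tendsto_intros \<epsilon>0) simp
    then have lim: "(\<lambda>n. nrm X (act X a e) / (1 + \<epsilon> n)) \<longlonglongrightarrow> nrm X (act X a e)" by simp
    show "(\<lambda>n. norm (a * q n)) \<longlonglongrightarrow> nrm X (act X a e)"
    proof (rule tendsto_sandwich[OF _ _ lim tendsto_const])
      have "nrm X (act X a e) / (1 + \<epsilon> n) \<le> norm (a * q n)" for n
        using lower[OF a, of n] \<epsilon>(1)[of n] unfolding eq by (simp add: field_simps)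
      then show "\<forall>\<^sub>F n in sequentially. nrm X (act X a e) / (1 + \<epsilon> n) \<le> norm (a * q n)" by simp
      show "\<forall>\<^sub>F n in sequentially. norm (a * q n) \<le> nrm X (act X a e)"
        using upper[OF a] unfolding eq by simp
    qed
  qed
  have f_nz: "apply_bcontfun f w \<noteq> 0" for w using f_pos[of w] by auto
  have "A_isometric A X (function_module {a * f | a. a \<in> A})"
    unfolding A_isometric_def
  \<comment> \<open>The isometry \<open>a e \<mapsto> a f\<close>, written with \<open>T 0 x\<close>
    as the coefficient \<open>a\<close> of \<open>x\<close>. Only the algebra of \<open>T 0\<close>
    is used here; its norm estimates have been absorbed into \<open>f_norm\<close>.\<close>
  proof (intro exI[of _ "\<lambda>x. T 0 x * f"] conjI ballI)
    have "inj_on (\<lambda>x. T 0 x * f) (carrier X)"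
    proof (rule inj_onI)
      fix x y assume xy: "x \<in> carrier X" "y \<in> carrier X" "T 0 x * f = T 0 y * f"
      have "T 0 x = T 0 y"
      proof (rule bcontfun_eqI)
        fix w show "apply_bcontfun (T 0 x) w = apply_bcontfun (T 0 y) w"
          using arg_cong[OF xy(3), of "\<lambda>f. apply_bcontfun f w"] f_nz[of w] by simp
      qed
      then show "x = y" using bij[of 0] xy unfolding bij_betw_def by (meson inj_onD)
    qed
    moreover have "(\<lambda>x. T 0 x * f) ` carrier X = {a * f | a. a \<in> A}"
    proof -
      have "(\<lambda>x. T 0 x * f) ` carrier X = (\<lambda>a. a * f) ` (T 0 ` carrier X)" by (simp add: image_image)
      then show ?thesis using bij[of 0] unfolding bij_betw_def by auto
    qed
    ultimately show "module_iso A X (function_module {a * f | a. a \<in> A}) (\<lambda>x. T 0 x * f)"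
      unfolding module_iso_def bij_betw_def function_module_def
      by (auto simp: T_add T_smult T_act algebra_simps)
    fix x assume x: "x \<in> carrier X"
    show "nrm (function_module {a * f | a. a \<in> A}) (T 0 x * f) = nrm X x"
      using f_norm[OF T_mem[OF x, of 0]] gen[OF x] by (simp add: function_module_def)
  qed
  with f_cl show ?thesis by blast
qed

text \<open>The inverse bimodule built from (iii) consists of functions on \<Omega>, whence the type
  \<open>'w cfun\<close>. The step (ii) \<Rightarrow> (i) works for an inverse bimodule over any
  type; going round the circle shows that the choice of this type is no restriction, which is the
  last conjunct.\<close>

theorem corollary7p5:
  fixes A :: "'w::t2_space cfun set" and X :: "('w cfun, 'x) normed_module"
  assumes "uniform_algebra A" and "banach_module A X"
  shows
    "(almost_A_isometric A X (function_module A) \<longleftrightarrow>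
       (\<exists>N. minimal_structure X N \<and>
          rank_one_strong_morita TYPE('w cfun) A (symmetric_bimodule X N)))
   \<and> ((\<exists>N. minimal_structure X N \<and>
          rank_one_strong_morita TYPE('w cfun) A (symmetric_bimodule X N)) \<longleftrightarrow>
       (\<exists>f\<in>positive_closure (modulus_set A).
          A_isometric A X (function_module {a * f | a. a \<in> A})))
   \<and> ((\<exists>N. minimal_structure X N \<and>
          rank_one_strong_morita TYPE('y) A (symmetric_bimodule X N)) \<longrightarrow>
       (\<exists>N. minimal_structure X N \<and>
          rank_one_strong_morita TYPE('w cfun) A (symmetric_bimodule X N)))"
proof -
  note 1 = almost_isometric_imp_A_isometric[OF assms]
  note 2 = A_isometric_imp_rank_one[OF assms]
  note 3 = rank_one_imp_almost_isometric[OF assms]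
  show ?thesis by (intro conjI iffI impI) (blast dest: 1 2 3)+
qed

end
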